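(* Let $\alpha$ be a continuous rotationally symmetric norm, let $n\ge1$, and let $\mathcal{M}$ be an $\alpha$-closed linear subspace of $H^{\alpha}$ which is invariant under $H^\infty_1(z^n)$ but not under $H^\infty(z^n)$. Then there exist $n$-inner functions $J_1,\ldots,J_r$ ($r\le n$), an integer $k\le 2r-1$ and, for $i=1,\ldots,k$, functions \[\varphi_i=(\beta_{1i}+\beta_{2i}z^n)J_1+(\beta_{3i}+\beta_{4i}z^n)J_2+\cdots+(\beta_{2r-1,i}+\beta_{2r,i}z^n)J_r\] with complex numbers $\beta_{ji}$, such that \[\mathcal{M}=\Big(\sum_{i=1}^{k}\oplus\langle\varphi_i\rangle\Big)\oplus z^{2n}\big(J_1M_{\alpha}(z^n)\oplus\cdots\oplus J_rM_{\alpha}(z^n)\big),\] where $\langle\varphi_i\rangle$ is the span of $\varphi_i$ and $\oplus$ denotes a direct sum.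
   Context: $\mathbb T$ is the unit circle with normalized Lebesgue measure $m$; $L^p,H^p$ are the classical Lebesgue and Hardy spaces on $\mathbb T$. A norm $\alpha$ on $L^\infty$ is rotationally symmetric if $\alpha(1)=1$, $\alpha(|f|)=\alpha(f)$, and $\alpha(f_w)=\alpha(f)$ for all $f\in L^\infty$ and $w\in\mathbb T$, where $f_w(z)=f(\overline w z)$; it is continuous if $\alpha(\chi_E)\to0$ as $m(E)\to0^+$. It is extended to all measurable $f$ by $\alpha(f)=\sup\{\alpha(s): s\text{ simple},0\le s\le|f|\}$. $H^\alpha$ is the $\alpha$-closure of $H^\infty$; $[S]_\alpha$ denotes $\alpha$-closure. $H^\infty(z^n)=\{f(z^n): f\in H^\infty\}$, $M_\alpha(z^n)=[H^\infty(z^n)]_\alpha$, and $H^\infty_1(z^n)$ is the weak*-closure in $H^\infty$ of the linear span of $\{1,z^{2n},z^{3n},\ldots\}$. A subspace $\mathcal M$ is invariant under an algebra $A\subset H^\infty$ if $a f\in\mathcal M$ for all $a\in A$, $f\in\mathcal M$. A function $\varphi\in H^\infty$ is $n$-inner if $\{z^{nm}\varphi: m=0,1,2,\ldots\}$ is an orthonormal set in $H^2$. *)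

theory Defs
  imports "HOL-Analysis.Analysis"
begin

text \<open>Normalized Lebesgue measure m on the unit circle, as the image of Lebesgue
  measure on [0,1] under t maps to exp(2 pi i t). Functions on the circle are
  represented as functions complex to complex; only values on the circle matter
  (the measure is concentrated there) and elements of the function spaces are
  considered up to m-a.e. equality.\<close>

definition circ :: "complex measure" where
  "circ = distr (restrict_space lborel {0..1::real}) borel (\<lambda>t. cis (2 * pi * t))"

definition Linf :: "(complex \<Rightarrow> complex) set" where
  "Linf = {f. f \<in> borel_measurable circ \<and> (\<exists>C. AE z in circ. cmod (f z) \<le> C)}"

definition L1 :: "(complex \<Rightarrow> complex) set" where
  "L1 = {g. integrable circ g}"

definition L2 :: "(complex \<Rightarrow> complex) set" where
  "L2 = {f. f \<in> borel_measurable circ \<and> integrable circ (\<lambda>z. (cmod (f z))\<^sup>2)}"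

text \<open>Hardy spaces: negative Fourier coefficients vanish, i.e. the integral of
  f(z) z^k over the circle is 0 for all k >= 1.\<close>

definition Hinf :: "(complex \<Rightarrow> complex) set" where
  "Hinf = {f \<in> Linf. \<forall>k::nat. k \<ge> 1 \<longrightarrow> (LINT z|circ. f z * z ^ k) = 0}"

definition H2 :: "(complex \<Rightarrow> complex) set" where
  "H2 = {f \<in> L2. \<forall>k::nat. k \<ge> 1 \<longrightarrow> (LINT z|circ. f z * z ^ k) = 0}"

definition inner2 :: "(complex \<Rightarrow> complex) \<Rightarrow> (complex \<Rightarrow> complex) \<Rightarrow> complex" where
  "inner2 f g = (LINT z|circ. f z * cnj (g z))"

definition rot :: "complex \<Rightarrow> (complex \<Rightarrow> complex) \<Rightarrow> (complex \<Rightarrow> complex)" where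
  "rot w f = (\<lambda>z. f (cnj w * z))"

definition rot_sym_norm :: "((complex \<Rightarrow> complex) \<Rightarrow> real) \<Rightarrow> bool" where
  "rot_sym_norm \<alpha> \<longleftrightarrow>
     (\<forall>f\<in>Linf. \<forall>g\<in>Linf. (AE z in circ. f z = g z) \<longrightarrow> \<alpha> f = \<alpha> g) \<and>
     (\<forall>f\<in>Linf. \<alpha> f = 0 \<longleftrightarrow> (AE z in circ. f z = 0)) \<and>
     (\<forall>f\<in>Linf. \<forall>g\<in>Linf. \<alpha> (\<lambda>z. f z + g z) \<le> \<alpha> f + \<alpha> g) \<and>
     (\<forall>f\<in>Linf. \<forall>c::complex. \<alpha> (\<lambda>z. c * f z) = cmod c * \<alpha> f) \<and>
     \<alpha> (\<lambda>z. 1) = 1 \<and>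
     (\<forall>f\<in>Linf. \<alpha> (\<lambda>z. complex_of_real (cmod (f z))) = \<alpha> f) \<and>
     (\<forall>f\<in>Linf. \<forall>w. cmod w = 1 \<longrightarrow> \<alpha> (rot w f) = \<alpha> f)"

definition cont_norm :: "((complex \<Rightarrow> complex) \<Rightarrow> real) \<Rightarrow> bool" where
  "cont_norm \<alpha> \<longleftrightarrow>
     (\<forall>\<epsilon>>0. \<exists>\<delta>>0. \<forall>E\<in>sets circ. measure circ E < \<delta> \<longrightarrow>
        \<alpha> (\<lambda>z. complex_of_real (indicator E z)) < \<epsilon>)"

definition alpha_ext :: "((complex \<Rightarrow> complex) \<Rightarrow> real) \<Rightarrow> (complex \<Rightarrow> complex) \<Rightarrow> ennreal" where
  "alpha_ext \<alpha> f =
     (SUP s \<in> {s :: complex \<Rightarrow> real. s \<in> borel_measurable circ \<and> finite (range s) \<and>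
                 (AE z in circ. 0 \<le> s z \<and> s z \<le> cmod (f z))}.
        ennreal (\<alpha> (\<lambda>z. complex_of_real (s z))))"

definition acl :: "((complex \<Rightarrow> complex) \<Rightarrow> real) \<Rightarrow> (complex \<Rightarrow> complex) set \<Rightarrow> (complex \<Rightarrow> complex) set" where
  "acl \<alpha> S = {f. f \<in> borel_measurable circ \<and>
      (\<exists>s::nat \<Rightarrow> complex \<Rightarrow> complex. (\<forall>i. s i \<in> S) \<and>
          (\<lambda>i. alpha_ext \<alpha> (\<lambda>z. s i z - f z)) \<longlonglongrightarrow> 0)}"

definition Halpha :: "((complex \<Rightarrow> complex) \<Rightarrow> real) \<Rightarrow> (complex \<Rightarrow> complex) set" where
  "Halpha \<alpha> = acl \<alpha> Hinf"

definition Hinf_zn :: "nat \<Rightarrow> (complex \<Rightarrow> complex) set" where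
  "Hinf_zn n = {(\<lambda>z. f (z ^ n)) | f. f \<in> Hinf}"

definition Malpha_zn :: "((complex \<Rightarrow> complex) \<Rightarrow> real) \<Rightarrow> nat \<Rightarrow> (complex \<Rightarrow> complex) set" where
  "Malpha_zn \<alpha> n = acl \<alpha> (Hinf_zn n)"

definition wstar_closure_Hinf :: "(complex \<Rightarrow> complex) set \<Rightarrow> (complex \<Rightarrow> complex) set" where
  "wstar_closure_Hinf S = {f \<in> Hinf. \<forall>G \<epsilon>. finite G \<and> G \<subseteq> L1 \<and> \<epsilon> > 0 \<longrightarrow>
      (\<exists>s\<in>S. \<forall>g\<in>G. cmod (LINT z|circ. (f z - s z) * g z) < \<epsilon>)}"

definition span_1_z2n :: "nat \<Rightarrow> (complex \<Rightarrow> complex) set" where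
  "span_1_z2n n = {(\<lambda>z. c 0 + (\<Sum>j\<in>{2..N}. c j * z ^ (j * n))) | c N. True}"

definition Hinf1_zn :: "nat \<Rightarrow> (complex \<Rightarrow> complex) set" where
  "Hinf1_zn n = wstar_closure_Hinf (span_1_z2n n)"

definition lin_subspace :: "(complex \<Rightarrow> complex) set \<Rightarrow> bool" where
  "lin_subspace M \<longleftrightarrow> (\<lambda>z. 0) \<in> M \<and>
     (\<forall>f\<in>M. \<forall>g\<in>M. (\<lambda>z. f z + g z) \<in> M) \<and>
     (\<forall>f\<in>M. \<forall>c::complex. (\<lambda>z. c * f z) \<in> M)"

definition invariant_under :: "(complex \<Rightarrow> complex) set \<Rightarrow> (complex \<Rightarrow> complex) set \<Rightarrow> bool" where
  "invariant_under A M \<longleftrightarrow> (\<forall>a\<in>A. \<forall>f\<in>M. (\<lambda>z. a z * f z) \<in> M)"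

definition n_inner :: "nat \<Rightarrow> (complex \<Rightarrow> complex) \<Rightarrow> bool" where
  "n_inner n \<phi> \<longleftrightarrow> \<phi> \<in> Hinf \<and>
     (\<forall>m m'::nat. inner2 (\<lambda>z. z ^ (n * m) * \<phi> z) (\<lambda>z. z ^ (n * m') * \<phi> z)
                   = (if m = m' then 1 else 0))"

end

theory Submission
  imports Defs
begin

text \<open>
  Let \<open>M'\<close> be the set of all \<open>f\<close> in the Hardy space with \<open>z\<^bsup>2n\<^esup> a f \<in> M\<close> for every \<open>a\<close> in \<open>H\<^sup>\<infinity>(z\<^sup>n)\<close>.
  It is closed, invariant under \<open>H\<^sup>\<infinity>(z\<^sup>n)\<close>, and \<open>z\<^bsup>2n\<^esup>M' \<subseteq> M \<subseteq> M'\<close>. Its bounded functions are the bounded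
  elements of a closed subspace \<open>N\<close> of \<open>H\<^sup>2\<close>, because every integrable function can be made bounded by
  multipliers from \<open>H\<^sup>\<infinity>(z\<^sup>n)\<close> that tend boundedly to 1; these are squares of solutions of a weighted
  extremal problem. Averaging \<open>f \<cdot> cnj J\<close> over the \<open>n\<close>-th roots of unity gives a function-valued inner
  product. A maximal family \<open>J\<^sub>1,\<dots>,J\<^sub>r\<close> in \<open>N\<close> that is orthonormal for it and orthogonal to
  \<open>z\<^sup>nN\<close> has \<open>r \<le> n\<close>, since it is pointwise an orthonormal family in an \<open>n\<close>-dimensional space, and it
  generates \<open>N\<close>, hence \<open>M'\<close>. Splitting off the frequencies 0 and \<open>n\<close> of the coefficients shows that
  \<open>M\<close> is \<open>z\<^bsup>2n\<^esup>M'\<close> plus a subspace of the span of the functions \<open>J\<^sub>j, z\<^sup>nJ\<^sub>j\<close>. This subspace is proper, as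
  otherwise \<open>M = M'\<close> would be invariant under \<open>H\<^sup>\<infinity>(z\<^sup>n)\<close>.
\<close>

section \<open>Square-integrable functions\<close>

text \<open>The difficulty is that \<alpha> is not a Hilbert norm and the spaces it defines need not
  be comparable with L2, so orthogonality cannot be used in \<open>M\<close> directly. Three facts
  carry information across: \<alpha> dominates the L1 norm, so Fourier coefficients are continuous
  for it; continuity of \<alpha> gives a bounded convergence theorem; and bounded multipliers act
  continuously. Compared with H_infinity(z^n), the algebra under which \<open>M\<close> is invariant
  lacks just the frequency n. Hence it contains z^(2n) a for every a in H_infinity(z^n), which is
  the origin of the exponent 2n, and each coefficient keeps two frequencies, 0 and n, outside z^(2n)
  M'. With r coefficients this makes 2r complex parameters; properness lowers the bound on k to 2r -
  1 and forces r > 0. Both the taming multipliers and the functions J_j arise as elements of least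
  norm with one prescribed Fourier coefficient. Orthogonality to multiples by powers of z^n then
  makes a weighted or averaged square constant, and this constancy yields boundedness.\<close>

definition L2m :: "'a measure \<Rightarrow> ('a \<Rightarrow> complex) set" where
  "L2m M = {f. f \<in> borel_measurable M \<and> integrable M (\<lambda>z. (cmod (f z))\<^sup>2)}"

text \<open>The measure is a parameter because \<open>weighted_extremal\<close> works over a density
  of \<open>circ\<close>. Keeping the square avoids roots; the price is the factor 2 in
  \<open>sqn_add_le\<close> and \<open>sqn_triangle\<close>.\<close>

definition sqn :: "'a measure \<Rightarrow> ('a \<Rightarrow> complex) \<Rightarrow> real" where
  "sqn M f = (LINT z|M. (cmod (f z))\<^sup>2)"

definition conv2 :: "'a measure \<Rightarrow> (nat \<Rightarrow> 'a \<Rightarrow> complex) \<Rightarrow> ('a \<Rightarrow> complex) \<Rightarrow> bool" where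
  "conv2 M s f \<longleftrightarrow> (\<lambda>i. sqn M (\<lambda>z. s i z - f z)) \<longlonglongrightarrow> 0"

lemma L2m_meas [measurable_dest]: "f \<in> L2m M \<Longrightarrow> f \<in> borel_measurable M"
  by (simp add: L2m_def)

lemma L2m_int: "f \<in> L2m M \<Longrightarrow> integrable M (\<lambda>z. (cmod (f z))\<^sup>2)"
  by (simp add: L2m_def)

lemma sqn_nonneg: "0 \<le> sqn M f"
  by (simp add: sqn_def)

lemma L2m_0 [simp]: "(\<lambda>z. 0) \<in> L2m M"
  by (simp add: L2m_def)

lemma L2m_add:
  assumes "f \<in> L2m M" "g \<in> L2m M" shows "(\<lambda>z. f z + g z) \<in> L2m M"
proof -
  note [measurable] = assms[THEN L2m_meas]
  have "integrable M (\<lambda>z. (cmod (f z + g z))\<^sup>2)"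
  proof (rule Bochner_Integration.integrable_bound)
    show "integrable M (\<lambda>z. 2 * (cmod (f z))\<^sup>2 + 2 * (cmod (g z))\<^sup>2)"
      using assms by (auto simp: L2m_def)
    have "(cmod (f z + g z))\<^sup>2 \<le> 2 * (cmod (f z))\<^sup>2 + 2 * (cmod (g z))\<^sup>2" for z
    proof -
      have "(cmod (f z + g z))\<^sup>2 \<le> (cmod (f z) + cmod (g z))\<^sup>2"
        by (simp add: norm_triangle_ineq power_mono)
      also have "\<dots> \<le> 2 * (cmod (f z))\<^sup>2 + 2 * (cmod (g z))\<^sup>2"
        using zero_le_power2[of "cmod (f z) - cmod (g z)"]
        by (simp add: power2_sum power2_diff)
      finally show ?thesis .
    qed
    then show "AE z in M. norm ((cmod (f z + g z))\<^sup>2) \<le> norm (2 * (cmod (f z))\<^sup>2 + 2 * (cmod (g z))\<^sup>2)"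
      by simp
  qed measurable
  then show ?thesis by (auto simp: L2m_def)
qed

lemma L2m_scale: "f \<in> L2m M \<Longrightarrow> (\<lambda>z. c * f z) \<in> L2m M"
  by (auto simp: L2m_def norm_mult power_mult_distrib)

lemma L2m_uminus: "f \<in> L2m M \<Longrightarrow> (\<lambda>z. - f z) \<in> L2m M"
  by (auto simp: L2m_def)

lemma L2m_diff: "f \<in> L2m M \<Longrightarrow> g \<in> L2m M \<Longrightarrow> (\<lambda>z. f z - g z) \<in> L2m M"
  using L2m_add[OF _ L2m_uminus] by fastforce

lemma L2m_sum: "(\<And>i. i \<in> I \<Longrightarrow> f i \<in> L2m M) \<Longrightarrow> (\<lambda>z. \<Sum>i\<in>I. f i z) \<in> L2m M"
  by (induction I rule: infinite_finite_induct) (auto intro: L2m_add)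

lemma borel_measurable_cnj' [measurable]: "cnj \<in> borel_measurable borel"
  by (intro borel_measurable_continuous_onI continuous_intros)

lemma L2m_cnj: "f \<in> L2m M \<Longrightarrow> (\<lambda>z. cnj (f z)) \<in> L2m M"
  by (auto simp: L2m_def)

lemma L2m_bounded_mult:
  assumes f: "f \<in> L2m M" and [measurable]: "g \<in> borel_measurable M"
    and b: "AE z in M. cmod (g z) \<le> C"
  shows "(\<lambda>z. g z * f z) \<in> L2m M" "sqn M (\<lambda>z. g z * f z) \<le> C\<^sup>2 * sqn M f"
proof -
  note [measurable] = f[THEN L2m_meas]
  have b': "AE z in M. (cmod (g z * f z))\<^sup>2 \<le> C\<^sup>2 * (cmod (f z))\<^sup>2"
    using b
  proof eventually_elim
    case (elim z)
    then have "cmod (g z) * cmod (f z) \<le> C * cmod (f z)"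
      by (simp add: mult_right_mono)
    then have "(cmod (g z) * cmod (f z))\<^sup>2 \<le> (C * cmod (f z))\<^sup>2"
      by (intro power_mono) auto
    then show ?case by (simp add: norm_mult power_mult_distrib)
  qed
  have i: "integrable M (\<lambda>z. C\<^sup>2 * (cmod (f z))\<^sup>2)" using f by (auto simp: L2m_def)
  have "integrable M (\<lambda>z. (cmod (g z * f z))\<^sup>2)"
    by (rule Bochner_Integration.integrable_bound[OF i]) (use b' in auto)
  then show "(\<lambda>z. g z * f z) \<in> L2m M" by (auto simp: L2m_def)
  have "sqn M (\<lambda>z. g z * f z) \<le> (LINT z|M. C\<^sup>2 * (cmod (f z))\<^sup>2)"
    unfolding sqn_def by (rule integral_mono_AE) (use b' i L2m_int[OF \<open>(\<lambda>z. g z * f z) \<in> L2m M\<close>] in auto)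
  then show "sqn M (\<lambda>z. g z * f z) \<le> C\<^sup>2 * sqn M f" by (simp add: sqn_def)
qed

section \<open>Inner products and mean-square convergence\<close>

lemma L2m_mult_integrable:
  assumes "f \<in> L2m M" "g \<in> L2m M" shows "integrable M (\<lambda>z. f z * g z)"
proof (rule Bochner_Integration.integrable_bound)
  note [measurable] = assms[THEN L2m_meas]
  show "integrable M (\<lambda>z. (cmod (f z))\<^sup>2 + (cmod (g z))\<^sup>2)"
    using assms by (auto simp: L2m_def)
  have "cmod (f z) * cmod (g z) \<le> (cmod (f z))\<^sup>2 + (cmod (g z))\<^sup>2" for z
    using zero_le_power2[of "cmod (f z) - cmod (g z)"]
      mult_nonneg_nonneg[OF norm_ge_zero[of "f z"] norm_ge_zero[of "g z"]]
    unfolding power2_diff by linarith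
  then show "AE z in M. norm (f z * g z) \<le> norm ((cmod (f z))\<^sup>2 + (cmod (g z))\<^sup>2)"
    by (simp add: norm_mult)
  show "(\<lambda>z. f z * g z) \<in> borel_measurable M" by measurable
qed

lemma sqn_eq_inner:
  "f \<in> L2m M \<Longrightarrow> (LINT z|M. f z * cnj (f z)) = complex_of_real (sqn M f)"
  by (simp add: sqn_def complex_norm_square[symmetric] flip: integral_complex_of_real)

lemma sqn_add:
  assumes "f \<in> L2m M" "g \<in> L2m M"
  shows "sqn M (\<lambda>z. f z + g z) = sqn M f + sqn M g + 2 * Re (LINT z|M. f z * cnj (g z))"
proof -
  note i = L2m_mult_integrable[OF assms(1) L2m_cnj[OF assms(2)]]
  have *: "(cmod (f z + g z))\<^sup>2 = (cmod (f z))\<^sup>2 + (cmod (g z))\<^sup>2 + 2 * Re (f z * cnj (g z))" for z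
    unfolding cmod_power2 by (simp add: power2_sum algebra_simps)
  have "sqn M (\<lambda>z. f z + g z) =
    (LINT z|M. (cmod (f z))\<^sup>2 + (cmod (g z))\<^sup>2 + 2 * Re (f z * cnj (g z)))"
    unfolding sqn_def * ..
  also have "\<dots> = sqn M f + sqn M g + 2 * Re (LINT z|M. f z * cnj (g z))"
    using assms[THEN L2m_int] i integrable_Re[OF i] by (simp add: sqn_def del: times_complex.sel)
  finally show ?thesis .
qed

lemma sqn_scale: "sqn M (\<lambda>z. c * f z) = (cmod c)\<^sup>2 * sqn M f"
  by (simp add: sqn_def norm_mult power_mult_distrib)

lemma sqn_minus_commute: "sqn M (\<lambda>z. f z - g z) = sqn M (\<lambda>z. g z - f z)"
  by (simp add: sqn_def norm_minus_commute)

lemma sqn_parallelogram: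
  assumes "f \<in> L2m M" "g \<in> L2m M"
  shows "sqn M (\<lambda>z. f z + g z) + sqn M (\<lambda>z. f z - g z) = 2 * sqn M f + 2 * sqn M g"
  using sqn_add[OF assms] sqn_add[OF assms(1) L2m_uminus[OF assms(2)]]
  by (simp add: sqn_def)

lemma sqn_add_le:
  assumes "f \<in> L2m M" "g \<in> L2m M"
  shows "sqn M (\<lambda>z. f z + g z) \<le> 2 * sqn M f + 2 * sqn M g"
  using sqn_parallelogram[OF assms] sqn_nonneg[of M "\<lambda>z. f z - g z"] by linarith

lemma sqn_triangle:
  assumes "f \<in> L2m M" "g \<in> L2m M" "h \<in> L2m M"
  shows "sqn M (\<lambda>z. f z - h z) \<le> 2 * sqn M (\<lambda>z. f z - g z) + 2 * sqn M (\<lambda>z. g z - h z)"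
  using sqn_add_le[OF L2m_diff[OF assms(1,2)] L2m_diff[OF assms(2,3)]] by simp

text \<open>Perturbing \<open>f\<close> by a multiple of \<open>g\<close> cannot make the squared
  norm negative. With a real \<open>t\<close> times the inner product \<open>p\<close> itself as
  multiplier, the cross term is \<open>2 t |p|^2\<close>, and a real parabola in \<open>t\<close>
  remains.\<close>

lemma L2m_Cauchy_Schwarz:
  assumes "f \<in> L2m M" "g \<in> L2m M"
  shows "(cmod (LINT z|M. f z * cnj (g z)))\<^sup>2 \<le> sqn M f * sqn M g"
proof -
  define p where "p = (LINT z|M. f z * cnj (g z))"
  have *: "0 \<le> sqn M f + t\<^sup>2 * (cmod p)\<^sup>2 * sqn M g + 2 * t * (cmod p)\<^sup>2" for t :: real
  proof -
    let ?c = "complex_of_real t * p"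
    have "0 \<le> sqn M (\<lambda>z. f z + ?c * g z)" by (rule sqn_nonneg)
    also have "\<dots> = sqn M f + sqn M (\<lambda>z. ?c * g z) + 2 * Re (LINT z|M. f z * cnj (?c * g z))"
      by (rule sqn_add) (use assms L2m_scale in auto)
    also have "(LINT z|M. f z * cnj (?c * g z)) = (LINT z|M. cnj ?c * (f z * cnj (g z)))"
      by (simp add: mult_ac)
    also have "\<dots> = cnj ?c * p" unfolding p_def by simp
    also have "Re (cnj ?c * p) = t * (cmod p)\<^sup>2"
      unfolding cmod_power2 by (simp add: algebra_simps power2_eq_square)
    finally show ?thesis by (simp add: sqn_scale norm_mult power_mult_distrib mult_ac)
  qed
  show ?thesis
  proof (cases "sqn M g = 0")
    case True
    \<comment> \<open>With \<open>g\<close> null the parabola degenerates to a line in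
      \<open>t\<close>, which is bounded below only if its slope vanishes; the \<open>t\<close>
      chosen below gives it the value \<open>- sqn M f - 2\<close>.\<close>
    have "cmod p = 0"
    proof (rule ccontr)
      assume "cmod p \<noteq> 0"
      then have "2 * (- (sqn M f + 1) / (cmod p)\<^sup>2) * (cmod p)\<^sup>2 = - 2 * (sqn M f + 1)"
        by simp
      with *[of "- (sqn M f + 1) / (cmod p)\<^sup>2"] True sqn_nonneg[of M f]
      show False by simp
    qed
    then show ?thesis using True by (simp add: p_def)
  next
    case False
    then have g: "sqn M g > 0" using sqn_nonneg[of M g] by linarith
    have "0 \<le> sqn M f + (-1 / sqn M g)\<^sup>2 * (cmod p)\<^sup>2 * sqn M g + 2 * (-1 / sqn M g) * (cmod p)\<^sup>2"
      by (rule *)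
    also have "\<dots> = sqn M f - (cmod p)\<^sup>2 / sqn M g"
      using g by (simp add: field_simps power2_eq_square)
    finally show ?thesis using g by (simp add: p_def field_simps)
  qed
qed

lemma L2m_Cauchy_Schwarz':
  assumes "f \<in> L2m M" "g \<in> L2m M"
  shows "cmod (LINT z|M. f z * g z) \<le> sqrt (sqn M f) * sqrt (sqn M g)"
proof -
  have "(cmod (LINT z|M. f z * cnj (cnj (g z))))\<^sup>2 \<le> sqn M f * sqn M (\<lambda>z. cnj (g z))"
    by (rule L2m_Cauchy_Schwarz) (use assms L2m_cnj in auto)
  then show ?thesis
    by (simp add: sqn_def real_le_rsqrt flip: real_sqrt_mult)
qed

lemma conv2_tendsto_integral_mult:
  assumes "\<And>i. s i \<in> L2m M" "f \<in> L2m M" "conv2 M s f" "g \<in> L2m M"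
  shows "(\<lambda>i. LINT z|M. s i z * g z) \<longlonglongrightarrow> (LINT z|M. f z * g z)"
proof -
  have "(\<lambda>i. (LINT z|M. s i z * g z) - (LINT z|M. f z * g z)) \<longlonglongrightarrow> 0"
  proof (rule Lim_null_comparison)
    show "\<forall>\<^sub>F i in sequentially. norm ((LINT z|M. s i z * g z) - (LINT z|M. f z * g z))
        \<le> sqrt (sqn M (\<lambda>z. s i z - f z)) * sqrt (sqn M g)"
    proof (intro always_eventually allI)
      fix i
      have "(LINT z|M. s i z * g z) - (LINT z|M. f z * g z) = (LINT z|M. (s i z - f z) * g z)"
        using assms by (subst Bochner_Integration.integral_diff[symmetric])
          (auto intro: L2m_mult_integrable simp: algebra_simps)
      then show "norm ((LINT z|M. s i z * g z) - (LINT z|M. f z * g z))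
        \<le> sqrt (sqn M (\<lambda>z. s i z - f z)) * sqrt (sqn M g)"
        using L2m_Cauchy_Schwarz'[OF L2m_diff[OF assms(1)[of i] assms(2)] assms(4)] by simp
    qed
    have "(\<lambda>i. sqrt (sqn M (\<lambda>z. s i z - f z)) * sqrt (sqn M g)) \<longlonglongrightarrow> sqrt 0 * sqrt (sqn M g)"
      using assms(3) unfolding conv2_def by (intro tendsto_intros)
    then show "(\<lambda>i. sqrt (sqn M (\<lambda>z. s i z - f z)) * sqrt (sqn M g)) \<longlonglongrightarrow> 0" by simp
  qed
  then show ?thesis by (rule LIM_zero_cancel)
qed

lemma sqn_eq_0_iff: "f \<in> L2m M \<Longrightarrow> sqn M f = 0 \<longleftrightarrow> (AE z in M. f z = 0)"
  unfolding sqn_def using integral_nonneg_eq_0_iff_AE[OF L2m_int, of f M] by simp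

lemma conv2_AE_subseq:
  assumes "\<And>i. s i \<in> L2m M" "f \<in> L2m M" "conv2 M s f"
  obtains \<phi> where "strict_mono \<phi>" "AE z in M. (\<lambda>i. s (\<phi> i) z) \<longlonglongrightarrow> f z"
proof -
  have "\<exists>\<phi>. strict_mono \<phi> \<and> (AE z in M. (\<lambda>i. (cmod (s (\<phi> i) z - f z))\<^sup>2) \<longlonglongrightarrow> 0)"
  proof (rule tendsto_L1_AE_subseq)
    show "\<And>i. integrable M (\<lambda>z. (cmod (s i z - f z))\<^sup>2)"
      using L2m_int[OF L2m_diff[OF assms(1,2)]] .
    show "(\<lambda>i. LINT z|M. norm ((cmod (s i z - f z))\<^sup>2)) \<longlonglongrightarrow> 0"
      using assms(3) by (simp add: conv2_def sqn_def)
  qed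
  then obtain \<phi> where \<phi>: "strict_mono \<phi>" "AE z in M. (\<lambda>i. (cmod (s (\<phi> i) z - f z))\<^sup>2) \<longlonglongrightarrow> 0"
    by blast
  have "AE z in M. (\<lambda>i. s (\<phi> i) z) \<longlonglongrightarrow> f z"
    using \<phi>(2)
  proof eventually_elim
    case (elim z)
    have "(\<lambda>i. sqrt ((cmod (s (\<phi> i) z - f z))\<^sup>2)) \<longlonglongrightarrow> sqrt 0"
      by (intro tendsto_intros elim)
    then show ?case by (simp add: LIM_zero_iff tendsto_norm_zero_iff)
  qed
  with \<phi>(1) show thesis by (rule that)
qed

section \<open>Finite measures: L1 bounds and completeness\<close>

lemma (in finite_measure) L2m_const: "(\<lambda>z. c) \<in> L2m M"
  by (simp add: L2m_def)

lemma (in finite_measure) L2m_integrable: "f \<in> L2m M \<Longrightarrow> integrable M f"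
  using L2m_mult_integrable[OF _ L2m_const, of f 1] by simp

lemma (in finite_measure) L2m_bounded:
  assumes "f \<in> borel_measurable M" "AE z in M. cmod (f z) \<le> C"
  shows "f \<in> L2m M"
  using L2m_bounded_mult(1)[OF L2m_const[of 1] assms] by simp

lemma (in finite_measure) L2m_L1_le:
  assumes "f \<in> L2m M"
  shows "(LINT z|M. cmod (f z)) \<le> sqrt (sqn M f) * sqrt (measure M (space M))"
proof -
  note [measurable] = assms[THEN L2m_meas]
  have "(\<lambda>z. complex_of_real (cmod (f z))) \<in> L2m M" using assms by (auto simp: L2m_def)
  from L2m_Cauchy_Schwarz'[OF this L2m_const[of 1]]
  have "cmod (LINT z|M. complex_of_real (cmod (f z))) \<le> sqrt (sqn M f) * sqrt (measure M (space M))"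
    by (simp add: sqn_def)
  then show ?thesis by (simp add: integral_complex_of_real)
qed

text \<open>Monotone convergence bounds the integral of the pointwise sum by the sum of the
  \<open>c k\<close>. It serves completeness and, later, an integrable majorant of all deviations of
  a convergent sequence.\<close>

lemma integrable_suminf_nonneg:
  fixes d :: "nat \<Rightarrow> 'a \<Rightarrow> real"
  assumes d: "\<And>k. integrable M (d k)" "\<And>k z. 0 \<le> d k z"
    and b: "\<And>k. (LINT z|M. d k z) \<le> c k" and c: "summable c"
  shows "AE z in M. summable (\<lambda>k. d k z)" "integrable M (\<lambda>z. \<Sum>k. d k z)"
proof -
  have c0: "0 \<le> c k" for k
  proof -
    have "0 \<le> (LINT z|M. d k z)" by (rule Bochner_Integration.integral_nonneg) (rule d(2))
    then show ?thesis using b[of k] by linarith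
  qed
  have [measurable]: "d k \<in> borel_measurable M" for k using d(1) by auto
  have "(\<integral>\<^sup>+ z. (\<Sum>k. ennreal (d k z)) \<partial>M) = (\<Sum>k. \<integral>\<^sup>+ z. ennreal (d k z) \<partial>M)"
    by (rule nn_integral_suminf) measurable
  also have "\<dots> = (\<Sum>k. ennreal (LINT z|M. d k z))"
    using d by (subst nn_integral_eq_integral) auto
  also have "\<dots> \<le> (\<Sum>k. ennreal (c k))"
    using b by (intro suminf_le) (auto intro: ennreal_leI)
  also have "\<dots> = ennreal (\<Sum>k. c k)" using c c0 by (intro suminf_ennreal2)
  also have "\<dots> < \<infinity>" by simp
  finally have "(\<integral>\<^sup>+ z. (\<Sum>k. ennreal (d k z)) \<partial>M) \<noteq> \<infinity>" by simp
  then have "AE z in M. (\<Sum>k. ennreal (d k z)) \<noteq> \<infinity>"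
    by (intro nn_integral_PInf_AE) measurable
  then show s: "AE z in M. summable (\<lambda>k. d k z)"
    by eventually_elim (rule summable_suminf_not_top, auto simp: d(2))
  show "integrable M (\<lambda>z. \<Sum>k. d k z)"
  proof (rule integrable_suminf[OF d(1)])
    show "AE z in M. summable (\<lambda>k. norm (d k z))" using s d(2) by simp
    have "summable (\<lambda>k. LINT z|M. d k z)"
      by (rule summable_comparison_test'[OF c, of 0]) (use b d(2) in \<open>auto simp: abs_of_nonneg Bochner_Integration.integral_nonneg\<close>)
    then show "summable (\<lambda>k. LINT z|M. norm (d k z))" using d(2) by simp
  qed
qed

text \<open>Riesz-Fischer. A subsequence with squared gaps below \<open>(1/4)^k\<close> has L1 gaps
  at most a constant times \<open>(1/2)^k\<close>, hence converges almost everywhere; Fatou's lemma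
  then controls the distance of every late term of the full sequence to that limit.\<close>

lemma (in finite_measure) L2m_complete:
  assumes s: "\<And>i. s i \<in> L2m M"
    and C: "\<And>e. e > 0 \<Longrightarrow> \<exists>N. \<forall>i\<ge>N. \<forall>j\<ge>N. sqn M (\<lambda>z. s i z - s j z) < e"
  obtains f where "f \<in> L2m M" "conv2 M s f"
proof -
  note [measurable] = s[THEN L2m_meas]
  have "\<exists>N. \<forall>i\<ge>N. \<forall>j\<ge>N. sqn M (\<lambda>z. s i z - s j z) < (1/4) ^ k" for k :: nat
    by (rule C) simp
  then obtain N where N: "\<And>k i j. i \<ge> N k \<Longrightarrow> j \<ge> N k \<Longrightarrow> sqn M (\<lambda>z. s i z - s j z) < (1/4) ^ k"
    by metis
  \<comment> \<open>Adding up all thresholds so far makes \<open>\<phi> k\<close> at least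
    \<open>N k\<close> and \<open>\<phi> (Suc k)\<close> at least \<open>N k\<close> as well; the
    summand \<open>k\<close> makes it tend to infinity.\<close>
  define \<phi> where "\<phi> k = (\<Sum>i\<le>k. N i) + k" for k
  have \<phi>N: "\<phi> k \<ge> N k" for k
    unfolding \<phi>_def using member_le_sum[of k "{..k}" N] by auto
  have \<phi>k: "\<phi> k \<ge> k" for k unfolding \<phi>_def by simp
  have \<phi>N': "\<phi> (Suc k) \<ge> N k" for k
    unfolding \<phi>_def using member_le_sum[of k "{..Suc k}" N] by (auto simp del: sum.atMost_Suc)
  define d where "d k z = s (\<phi> (Suc k)) z - s (\<phi> k) z" for k z
  have dL: "d k \<in> L2m M" for k unfolding d_def by (rule L2m_diff[OF s s])
  have dsq: "sqn M (d k) \<le> (1/4)^k" for k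
    unfolding d_def using N[OF \<phi>N' \<phi>N, of k] by simp
  define A where "A = sqrt (measure M (space M))"
  have d1: "(LINT z|M. cmod (d k z)) \<le> (1/2)^k * A" for k
  proof -
    have "sqrt (sqn M (d k)) \<le> sqrt ((1/4)^k)" using dsq by simp
    also have "\<dots> = (1/2)^k"
      by (simp add: real_sqrt_power real_sqrt_divide)
    finally show ?thesis using L2m_L1_le[OF dL, of k] unfolding A_def
      by (meson mult_right_mono order_trans real_sqrt_ge_zero measure_nonneg)
  qed
  have di: "integrable M (d k)" for k by (rule L2m_integrable[OF dL])
  have "summable (\<lambda>k. (1/2::real) ^ k * A)" by (intro summable_mult2 summable_geometric) simp
  with d1 have "AE z in M. summable (\<lambda>k. cmod (d k z))"
    using di by (intro integrable_suminf_nonneg(1)[of M "\<lambda>k z. cmod (d k z)"]) auto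
  then have lim: "AE z in M. convergent (\<lambda>k. s (\<phi> k) z)"
  proof eventually_elim
    case (elim z)
    then have "summable (\<lambda>k. d k z)" by (rule summable_norm_cancel)
    then have "(\<lambda>n. \<Sum>k<n. d k z) \<longlonglongrightarrow> suminf (\<lambda>k. d k z)" by (rule summable_LIMSEQ)
    moreover have "(\<Sum>k<n. d k z) = s (\<phi> n) z - s (\<phi> 0) z" for n
      unfolding d_def by (rule sum_lessThan_telescope)
    ultimately have "(\<lambda>n. s (\<phi> n) z - s (\<phi> 0) z) \<longlonglongrightarrow> suminf (\<lambda>k. d k z)" by simp
    from tendsto_add[OF this tendsto_const[of "s (\<phi> 0) z"]]
    show ?case by (auto simp: convergent_def)
  qed
  define f where "f z = lim (\<lambda>k. s (\<phi> k) z)" for z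
  have [measurable]: "f \<in> borel_measurable M" unfolding f_def
    by (rule borel_measurable_lim_metric) measurable
  have fl: "AE z in M. (\<lambda>k. s (\<phi> k) z) \<longlonglongrightarrow> f z"
    using lim by eventually_elim (simp add: f_def convergent_LIMSEQ_iff)
  have main: "(\<integral>\<^sup>+ z. ennreal ((cmod (s i z - f z))\<^sup>2) \<partial>M) \<le> ennreal e"
    if e: "e > 0" and i: "\<And>j. j \<ge> i \<Longrightarrow> sqn M (\<lambda>z. s i z - s j z) < e" for e i
  proof -
    have "(\<integral>\<^sup>+ z. ennreal ((cmod (s i z - f z))\<^sup>2) \<partial>M)
        = (\<integral>\<^sup>+ z. liminf (\<lambda>k. ennreal ((cmod (s i z - s (\<phi> k) z))\<^sup>2)) \<partial>M)"
    proof (rule nn_integral_cong_AE)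
      show "AE z in M. ennreal ((cmod (s i z - f z))\<^sup>2) = liminf (\<lambda>k. ennreal ((cmod (s i z - s (\<phi> k) z))\<^sup>2))"
        using fl
      proof eventually_elim
        case (elim z)
        have "(\<lambda>k. ennreal ((cmod (s i z - s (\<phi> k) z))\<^sup>2)) \<longlonglongrightarrow> ennreal ((cmod (s i z - f z))\<^sup>2)"
          by (intro tendsto_intros tendsto_ennrealI elim)
        from lim_imp_Liminf[OF _ this] show ?case by simp
      qed
    qed
    also have "\<dots> \<le> liminf (\<lambda>k. \<integral>\<^sup>+ z. ennreal ((cmod (s i z - s (\<phi> k) z))\<^sup>2) \<partial>M)"
      by (rule nn_integral_liminf) measurable
    also have "\<dots> = liminf (\<lambda>k. ennreal (sqn M (\<lambda>z. s i z - s (\<phi> k) z)))"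
      unfolding sqn_def using L2m_int[OF L2m_diff[OF s s]]
      by (subst nn_integral_eq_integral) auto
    also have "\<dots> \<le> liminf (\<lambda>k. ennreal e)"
    proof (rule Liminf_mono)
      show "\<forall>\<^sub>F k in sequentially. ennreal (sqn M (\<lambda>z. s i z - s (\<phi> k) z)) \<le> ennreal e"
        using eventually_ge_at_top[of i]
      proof eventually_elim
        case (elim k)
        then have "\<phi> k \<ge> i" using \<phi>k[of k] by linarith
        then show ?case using i[of "\<phi> k"] by (intro ennreal_leI) simp
      qed
    qed
    also have "\<dots> = ennreal e" by (simp add: Liminf_const)
    finally show ?thesis .
  qed
  have L: "(\<lambda>z. s i z - f z) \<in> L2m M" "sqn M (\<lambda>z. s i z - f z) \<le> e"
    if e: "e > 0" and i: "\<And>j. j \<ge> i \<Longrightarrow> sqn M (\<lambda>z. s i z - s j z) < e" for e i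
  proof -
    have m: "(\<integral>\<^sup>+ z. ennreal ((cmod (s i z - f z))\<^sup>2) \<partial>M) \<le> ennreal e" by (rule main[OF e i])
    have int: "integrable M (\<lambda>z. (cmod (s i z - f z))\<^sup>2)"
      by (rule integrableI_bounded) (use le_less_trans[OF m] in auto)
    then show "(\<lambda>z. s i z - f z) \<in> L2m M" by (auto simp: L2m_def)
    show "sqn M (\<lambda>z. s i z - f z) \<le> e"
      using m int e by (subst (asm) nn_integral_eq_integral) (auto simp: sqn_def)
  qed
  have fL: "f \<in> L2m M"
  proof -
    obtain n0 where n0: "\<forall>i\<ge>n0. \<forall>j\<ge>n0. sqn M (\<lambda>z. s i z - s j z) < 1" using C[of 1] by auto
    then have "(\<lambda>z. s n0 z - f z) \<in> L2m M" using L(1)[of 1 n0] by auto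
    from L2m_diff[OF s[of n0] this] show ?thesis by simp
  qed
  have "conv2 M s f" unfolding conv2_def
  proof (rule LIMSEQ_I)
    fix e :: real assume e: "e > 0"
    obtain n0 where n0: "\<forall>i\<ge>n0. \<forall>j\<ge>n0. sqn M (\<lambda>z. s i z - s j z) < e/2" using C[of "e/2"] e by auto
    show "\<exists>n0. \<forall>n\<ge>n0. norm (sqn M (\<lambda>z. s n z - f z) - 0) < e"
    proof (intro exI allI impI)
      fix i assume "i \<ge> n0"
      then have "sqn M (\<lambda>z. s i z - f z) \<le> e/2" using n0 e by (intro L(2)) auto
      then show "norm (sqn M (\<lambda>z. s i z - f z) - 0) < e"
        using e sqn_nonneg[of M "\<lambda>z. s i z - f z"] by simp
    qed
  qed
  with fL show thesis by (rule that)
qed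

section \<open>Elements of minimal norm\<close>

definition closed2 :: "'a measure \<Rightarrow> ('a \<Rightarrow> complex) set \<Rightarrow> bool" where
  "closed2 M S \<longleftrightarrow> (\<forall>s f. (\<forall>i. s i \<in> S) \<and> f \<in> L2m M \<and> conv2 M s f \<longrightarrow> f \<in> S)"

text \<open>By the parallelogram law a minimizing sequence is Cauchy as soon as midpoints stay in
  the set; this form applies alike to affine sets and to translates of subspaces.\<close>

lemma (in finite_measure) L2m_minimizer_exists:
  assumes S: "S \<subseteq> L2m M" and ne: "S \<noteq> {}"
    and mid: "\<And>f g. f \<in> S \<Longrightarrow> g \<in> S \<Longrightarrow> (\<lambda>z. (f z + g z) / 2) \<in> S"
    and cl: "closed2 M S"
  obtains f where "f \<in> S" "\<And>g. g \<in> S \<Longrightarrow> sqn M f \<le> sqn M g"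
proof -
  define \<delta> where "\<delta> = (INF f\<in>S. sqn M f)"
  have bb: "bdd_below (sqn M ` S)" by (rule bdd_belowI[of _ 0]) (auto simp: sqn_nonneg)
  have low: "\<delta> \<le> sqn M f" if "f \<in> S" for f
    unfolding \<delta>_def using bb that by (rule cINF_lower)
  have "\<exists>f\<in>S. sqn M f < \<delta> + 1 / real (Suc i)" for i
    using cINF_less_iff[OF ne bb, of "\<delta> + 1 / real (Suc i)"] unfolding \<delta>_def[symmetric] by simp
  then obtain s where s: "\<And>i. s i \<in> S" "\<And>i. sqn M (s i) < \<delta> + 1 / real (Suc i)" by metis
  have sL: "s i \<in> L2m M" for i using s(1) S by auto
  have par: "sqn M (\<lambda>z. f z - g z) \<le> 2 * (sqn M f - \<delta>) + 2 * (sqn M g - \<delta>)"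
    if f: "f \<in> S" and g: "g \<in> S" for f g
  proof -
    have "\<delta> \<le> sqn M (\<lambda>z. (f z + g z) / 2)" using low[OF mid[OF f g]] .
    also have "\<dots> = sqn M (\<lambda>z. f z + g z) / 4"
      using sqn_scale[of M "1/2" "\<lambda>z. f z + g z"] by (simp add: power2_eq_square)
    finally show ?thesis using sqn_parallelogram[of f M g] f g S by (auto simp: subset_eq)
  qed
  obtain f where f: "f \<in> L2m M" "conv2 M s f"
  proof (rule L2m_complete[of s])
    fix e :: real assume e: "e > 0"
    then obtain N where N: "inverse (real (Suc N)) < e/4" using reals_Archimedean[of "e/4"] by auto
    show "\<exists>N. \<forall>i\<ge>N. \<forall>j\<ge>N. sqn M (\<lambda>z. s i z - s j z) < e"
    proof (intro exI allI impI)
      fix i j assume ij: "i \<ge> N" "j \<ge> N"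
      have "sqn M (s k) - \<delta> < e/4" if "k \<ge> N" for k
      proof -
        have "1 / real (Suc k) \<le> inverse (real (Suc N))" using that by (simp add: field_simps)
        then show ?thesis using s(2)[of k] N by linarith
      qed
      from this[OF ij(1)] this[OF ij(2)] show "sqn M (\<lambda>z. s i z - s j z) < e"
        using par[OF s(1)[of i] s(1)[of j]] by (simp add: algebra_simps)
    qed
  qed (use sL in auto)
  have fS: "f \<in> S" using cl s(1) f unfolding closed2_def by blast
  \<comment> \<open>The inner products of the sequence with \<open>f\<close> tend to the squared
    norm of \<open>f\<close>, while Cauchy-Schwarz bounds their limit by
    \<open>sqrt \<delta>\<close> times the norm of \<open>f\<close>.\<close>
  have "sqn M f \<le> \<delta>"
  proof -
    have "(\<lambda>i. LINT z|M. s i z * cnj (f z)) \<longlonglongrightarrow> (LINT z|M. f z * cnj (f z))"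
      by (rule conv2_tendsto_integral_mult[OF sL f L2m_cnj[OF f(1)]])
    then have 1: "(\<lambda>i. cmod (LINT z|M. s i z * cnj (f z))) \<longlonglongrightarrow> sqn M f"
      using sqn_eq_inner[OF f(1)] sqn_nonneg[of M f] tendsto_norm by fastforce
    have 2: "(\<lambda>i. sqrt (\<delta> + 1 / real (Suc i)) * sqrt (sqn M f)) \<longlonglongrightarrow> sqrt (\<delta> + 0) * sqrt (sqn M f)"
      by (intro tendsto_intros LIMSEQ_Suc[OF lim_1_over_n])
    have "sqn M f \<le> sqrt (\<delta> + 0) * sqrt (sqn M f)"
    proof (rule LIMSEQ_le[OF 1 2], intro exI allI impI)
      fix i :: nat
      have "cmod (LINT z|M. s i z * cnj (f z)) \<le> sqrt (sqn M (s i)) * sqrt (sqn M f)"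
        using L2m_Cauchy_Schwarz'[OF sL[of i] L2m_cnj[OF f(1)]] by (simp add: sqn_def)
      also have "\<dots> \<le> sqrt (\<delta> + 1 / real (Suc i)) * sqrt (sqn M f)"
        using s(2)[of i] sqn_nonneg[of M f] by (intro mult_right_mono real_sqrt_le_mono) auto
      finally show "cmod (LINT z|M. s i z * cnj (f z)) \<le> sqrt (\<delta> + 1 / real (Suc i)) * sqrt (sqn M f)" .
    qed
    then have "sqrt (sqn M f) * sqrt (sqn M f) \<le> sqrt \<delta> * sqrt (sqn M f)" using sqn_nonneg[of M f] by simp
    then have "sqn M f = 0 \<or> sqrt (sqn M f) \<le> sqrt \<delta>"
      using sqn_nonneg[of M f] mult_right_le_imp_le[of "sqrt (sqn M f)" "sqrt (sqn M f)" "sqrt \<delta>"] by fastforce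
    moreover have "\<delta> \<ge> 0" unfolding \<delta>_def by (rule cINF_greatest[OF ne]) (rule sqn_nonneg)
    ultimately show ?thesis by auto
  qed
  with low have "\<And>g. g \<in> S \<Longrightarrow> sqn M f \<le> sqn M g" by force
  with fS show thesis by (rule that)
qed

text \<open>First-order condition in the complex direction given by a real \<open>t\<close> times
  the inner product \<open>p\<close>: the increment \<open>t^2 |p|^2 sqn M h + 2 t |p|^2\<close> is
  nonnegative for all \<open>t\<close>.\<close>

lemma L2m_minimizer_orthogonal:
  assumes f: "f \<in> L2m M" and h: "h \<in> L2m M"
    and min: "\<And>c. sqn M f \<le> sqn M (\<lambda>z. f z + c * h z)"
  shows "(LINT z|M. f z * cnj (h z)) = 0"
proof -
  define p where "p = (LINT z|M. f z * cnj (h z))"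
  have *: "0 \<le> t\<^sup>2 * (cmod p)\<^sup>2 * sqn M h + 2 * t * (cmod p)\<^sup>2" for t :: real
  proof -
    let ?c = "complex_of_real t * p"
    have "sqn M f \<le> sqn M (\<lambda>z. f z + ?c * h z)" by (rule min)
    also have "\<dots> = sqn M f + sqn M (\<lambda>z. ?c * h z) + 2 * Re (LINT z|M. f z * cnj (?c * h z))"
      by (rule sqn_add) (use f h L2m_scale in auto)
    also have "(LINT z|M. f z * cnj (?c * h z)) = (LINT z|M. cnj ?c * (f z * cnj (h z)))"
      by (simp add: mult_ac)
    also have "\<dots> = cnj ?c * p" unfolding p_def by simp
    also have "Re (cnj ?c * p) = t * (cmod p)\<^sup>2"
      unfolding cmod_power2 by (simp add: algebra_simps power2_eq_square)
    finally show ?thesis by (simp add: sqn_scale norm_mult power_mult_distrib mult_ac)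
  qed
  have h0: "sqn M h \<ge> 0" by (rule sqn_nonneg)
  \<comment> \<open>At this \<open>t\<close> the increment is a negative multiple of
    \<open>|p|^2\<close>; the \<open>+ 1\<close> keeps the denominator positive when
    \<open>h\<close> is null.\<close>
  have "(-1 / (sqn M h + 1))\<^sup>2 * (cmod p)\<^sup>2 * sqn M h + 2 * (-1 / (sqn M h + 1)) * (cmod p)\<^sup>2
      = (cmod p)\<^sup>2 * (- (sqn M h + 2) / (sqn M h + 1)\<^sup>2)"
    using h0 by (simp add: divide_simps) (simp add: algebra_simps power2_eq_square)
  then have "0 \<le> (cmod p)\<^sup>2 * (- (sqn M h + 2) / (sqn M h + 1)\<^sup>2)"
    using *[of "-1 / (sqn M h + 1)"] by simp
  moreover have "- (sqn M h + 2) / (sqn M h + 1)\<^sup>2 < 0"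
    using h0 by (intro divide_neg_pos) auto
  ultimately have "(cmod p)\<^sup>2 \<le> 0"
    by (metis linorder_not_less zero_le_mult_iff zero_le_power2 order_le_less)
  then show ?thesis by (simp add: p_def)
qed

section \<open>Measures on the circle and their moments\<close>

lemma space_circ [simp]: "space circ = UNIV" by (simp add: circ_def)

lemma sets_circ [simp, measurable_cong]: "sets circ = sets borel" by (simp add: circ_def)

lemma cis_meas: "(\<lambda>t. cis (2 * pi * t)) \<in> borel_measurable (restrict_space lborel {0..1::real})"
  by (intro measurable_restrict_space1) (auto intro!: borel_measurable_continuous_onI continuous_intros)

lemma AE_circ: "AE z in circ. cmod z = 1"
  unfolding circ_def by (subst AE_distr_iff[OF cis_meas]) auto

lemma AE_circ_ne_0: "AE z in circ. z \<noteq> 0"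
  using AE_circ by eventually_elim auto

lemma emeasure_circ_UNIV: "emeasure circ UNIV = 1"
  unfolding circ_def
  by (subst emeasure_distr[OF cis_meas]) (auto simp: emeasure_restrict_space space_restrict_space)

interpretation circ: finite_measure circ
  by (rule finite_measureI) (simp add: emeasure_circ_UNIV)

lemma measure_circ_UNIV [simp]: "measure circ UNIV = 1"
  by (simp add: measure_def emeasure_circ_UNIV)

lemma borel_measurable_powi [measurable]: "(\<lambda>z::complex. z powi k) \<in> borel_measurable borel"
  unfolding power_int_def by (cases "k \<ge> 0") auto

lemma integral_circ:
  fixes f :: "complex \<Rightarrow> complex"
  assumes "f \<in> borel_measurable borel"
  shows "(LINT z|circ. f z) = (LINT t|lborel. indicator {0..1} t *\<^sub>R f (cis (2 * pi * t)))"
  unfolding circ_def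
  by (subst integral_distr[OF cis_meas]) (auto simp: assms integral_restrict_space)

lemma integral_circ_powi: "(LINT z|circ. z powi k) = (if k = 0 then 1 else 0)"
proof (cases "k = 0")
  case False
  define a where "a = 2 * pi * of_int k"
  have a: "a \<noteq> 0" using False by (simp add: a_def)
  have "(LINT z|circ. z powi k) = (LINT t|lborel. indicator {0..1} t *\<^sub>R cis (a * t))"
    by (subst integral_circ) (auto simp: cis_power_int a_def mult_ac)
  also have "\<dots> = cis (a * 1) / (\<i> * a) - cis (a * 0) / (\<i> * a)"
  proof (rule integral_FTC_Icc)
    fix x :: real
    show "((\<lambda>t. cis (a * t) / (\<i> * a)) has_vector_derivative cis (a * x)) (at x within {0..1})"
      unfolding has_vector_derivative_def using a
      by (auto intro!: derivative_eq_intros ext simp: scaleR_conv_of_real divide_simps complex_eq_iff)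
  qed (auto intro!: continuous_intros)
  also have "\<dots> = 0"
    using cis_multiple_2pi[of "of_int k"] by (simp add: a_def)
  finally show ?thesis using False by simp
qed simp

section \<open>Trigonometric polynomials and measures determined by moments\<close>

inductive_set trigp :: "int set \<Rightarrow> (complex \<Rightarrow> complex) set" for A where
  zero: "(\<lambda>z. 0) \<in> trigp A"
| mono: "k \<in> A \<Longrightarrow> (\<lambda>z. c * z powi k) \<in> trigp A"
| add: "f \<in> trigp A \<Longrightarrow> g \<in> trigp A \<Longrightarrow> (\<lambda>z. f z + g z) \<in> trigp A"

lemma trigp_scale: "f \<in> trigp A \<Longrightarrow> (\<lambda>z. c * f z) \<in> trigp A"
proof (induction rule: trigp.induct)
  case zero show ?case using trigp.zero by simp
next
  case (mono k d) then show ?case using trigp.mono[of k A "c * d"] by (simp add: mult_ac)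
next
  case (add f g) then show ?case using trigp.add by (simp add: algebra_simps)
qed

lemma trigp_meas: "f \<in> trigp A \<Longrightarrow> f \<in> borel_measurable borel"
  by (induction rule: trigp.induct) auto

lemma trigp_bounded: "f \<in> trigp A \<Longrightarrow> \<exists>C. \<forall>z. cmod z = 1 \<longrightarrow> cmod (f z) \<le> C"
proof (induction rule: trigp.induct)
  case (mono k c) then show ?case by (intro exI[of _ "cmod c"]) (auto simp: norm_mult norm_power_int)
next
  case (add f g)
  then obtain C D where "\<forall>z. cmod z = 1 \<longrightarrow> cmod (f z) \<le> C" "\<forall>z. cmod z = 1 \<longrightarrow> cmod (g z) \<le> D" by auto
  then show ?case by (intro exI[of _ "C + D"]) (auto intro: norm_triangle_le add_mono)
qed auto

lemma trigp_mono: "f \<in> trigp A \<Longrightarrow> A \<subseteq> B \<Longrightarrow> f \<in> trigp B"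
  by (induction rule: trigp.induct) (auto intro: trigp.intros)

text \<open>Frequencies add under multiplication. Equality is claimed off 0 because
  \<open>z powi j * z powi k\<close> and \<open>z powi (j + k)\<close> can differ at 0, a point that
  measures living on the circle do not see.\<close>

lemma trigp_mult:
  assumes "f \<in> trigp A" "g \<in> trigp B"
  shows "\<exists>h\<in>trigp {a + b |a b. a \<in> A \<and> b \<in> B}. \<forall>z. z \<noteq> 0 \<longrightarrow> h z = f z * g z"
  using assms
proof (induction rule: trigp.induct)
  case zero then show ?case by (intro bexI[of _ "\<lambda>z. 0"]) (auto intro: trigp.zero)
next
  case (mono k c)
  show ?case using mono.prems
  proof (induction rule: trigp.induct)
    case zero then show ?case by (intro bexI[of _ "\<lambda>z. 0"]) (auto intro: trigp.zero)
  next
    case (mono j d)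
    then show ?case using \<open>k \<in> A\<close>
      by (intro bexI[of _ "\<lambda>z. (c * d) * z powi (k + j)"]) (auto intro!: trigp.mono simp: power_int_add)
  next
    case (add g g')
    then obtain h h' where "h\<in>trigp {a + b |a b. a \<in> A \<and> b \<in> B}" "h'\<in>trigp {a + b |a b. a \<in> A \<and> b \<in> B}"
      "\<forall>z. z \<noteq> 0 \<longrightarrow> h z = c * z powi k * g z" "\<forall>z. z \<noteq> 0 \<longrightarrow> h' z = c * z powi k * g' z" by blast
    then show ?case by (intro bexI[of _ "\<lambda>z. h z + h' z"]) (auto intro: trigp.add simp: algebra_simps)
  qed
next
  case (add f f')
  then obtain h h' where "h\<in>trigp {a + b |a b. a \<in> A \<and> b \<in> B}" "h'\<in>trigp {a + b |a b. a \<in> A \<and> b \<in> B}"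
      "\<forall>z. z \<noteq> 0 \<longrightarrow> h z = f z * g z" "\<forall>z. z \<noteq> 0 \<longrightarrow> h' z = f' z * g z" by blast
  then show ?case by (intro bexI[of _ "\<lambda>z. h z + h' z"]) (auto intro: trigp.add simp: algebra_simps)
qed

lemma cnj_powi: "cmod z = 1 \<Longrightarrow> cnj (z powi k) = z powi (- k)"
proof -
  assume z: "cmod z = 1"
  then have "cnj z = inverse z"
    by (metis complex_cnj_one complex_mod_cnj divide_conv_cnj inverse_eq_divide mult_1)
  then show ?thesis by (simp add: power_int_minus power_int_inverse)
qed

text \<open>On the circle the conjugate of \<open>z\<close> is \<open>z powi (-1)\<close>, so
  polynomials in the real coordinates are trigonometric polynomials. \<open>a\<close> is chosen so
  that a real linear functional becomes the real part of \<open>a z\<close>.\<close>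

lemma real_polynomial_trigp:
  assumes "real_polynomial_function g"
  shows "\<exists>t\<in>trigp UNIV. \<forall>z. cmod z = 1 \<longrightarrow> t z = complex_of_real (g z)"
  using assms
proof (induction rule: real_polynomial_function.induct)
  case (linear f)
  interpret bounded_linear f by fact
  define a where "a = Complex (f 1) (- f \<i>)"
  let ?t = "\<lambda>z. (a/2) * z powi 1 + (cnj a/2) * z powi (-1)"
  have "?t z = complex_of_real (f z)" if "cmod z = 1" for z
  proof -
    have "z = Re z *\<^sub>R 1 + Im z *\<^sub>R \<i>" by (simp add: complex_eq_iff)
    then have "f z = Re z * f 1 + Im z * f \<i>" by (metis add scaleR real_scaleR_def)

    then have "(a/2) * z + (cnj a/2) * cnj z = complex_of_real (f z)"
      by (simp add: complex_eq_iff a_def diff_divide_distrib add_divide_distrib)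
    then show ?thesis using cnj_powi[OF that, of 1] by simp
  qed
  moreover have "?t \<in> trigp UNIV" by (intro trigp.add trigp.mono) auto
  ultimately show ?case by (intro bexI[of _ ?t]) auto
next
  case (const c)
  show ?case using trigp.mono[of 0 UNIV "complex_of_real c"] by (intro bexI[of _ "\<lambda>z. complex_of_real c"]) auto
next
  case (add f g)
  then obtain t t' where "t\<in>trigp UNIV" "t'\<in>trigp UNIV" "\<forall>z. cmod z = 1 \<longrightarrow> t z = complex_of_real (f z)"
    "\<forall>z. cmod z = 1 \<longrightarrow> t' z = complex_of_real (g z)" by blast
  then show ?case by (intro bexI[of _ "\<lambda>z. t z + t' z"]) (auto intro: trigp.add)
next
  case (mult f g)
  then obtain t t' where t: "t\<in>trigp UNIV" "t'\<in>trigp UNIV" "\<forall>z. cmod z = 1 \<longrightarrow> t z = complex_of_real (f z)"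
    "\<forall>z. cmod z = 1 \<longrightarrow> t' z = complex_of_real (g z)" by blast
  obtain h where h: "h \<in> trigp {a + b |a b. a \<in> UNIV \<and> b \<in> UNIV}" "\<forall>z. z \<noteq> 0 \<longrightarrow> h z = t z * t' z"
    using trigp_mult[OF t(1,2)] by blast
  have "h \<in> trigp UNIV" using h(1) by (rule trigp_mono) simp
  then show ?case using t h(2) by (intro bexI[of _ h]) (auto, metis norm_zero zero_neq_one)
qed

lemma circle_moments_trigp:
  assumes [simp, measurable_cong]: "sets M = sets borel" and fM: "finite_measure M" and cM: "AE z in M. cmod z = 1"
    and [simp, measurable_cong]: "sets N = sets borel" and fN: "finite_measure N" and cN: "AE z in N. cmod z = 1"
    and mom: "\<And>k::nat. (LINT z|M. z ^ k) = (LINT z|N. z ^ k)"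
    and t: "t \<in> trigp A"
  shows "integrable M t \<and> integrable N t \<and> (LINT z|M. t z) = (LINT z|N. t z)"
proof -
  interpret M: finite_measure M by fact
  interpret N: finite_measure N by fact
  have i: "integrable M (\<lambda>z. z powi k)" "integrable N (\<lambda>z. z powi k)" for k
    using cM cN by (auto intro!: M.integrable_const_bound[of _ 1] N.integrable_const_bound[of _ 1] simp: norm_power_int)
  have m: "(LINT z|M. z powi k) = (LINT z|N. z powi k)" for k
  proof (cases "k \<ge> 0")
    case True then show ?thesis using mom[of "nat k"] by (simp add: power_int_def)
  next
    case False
    have *: "(LINT z|R. z powi k) = cnj (LINT z|R. z ^ nat (-k))" if "sets R = sets borel" "AE z in R. cmod z = 1" for R
    proof -
      note [measurable_cong] = that(1)
      have "(LINT z|R. z powi k) = (LINT z|R. cnj (z ^ nat (-k)))"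
      proof (rule integral_cong_AE)
        show "AE z in R. z powi k = cnj (z ^ nat (-k))"
          using that(2)
        proof eventually_elim
          case (elim z)
          show ?case using cnj_powi[OF elim, of "-k"] False by (simp add: power_int_def)
        qed
      qed measurable
      then show ?thesis by (simp only: Bochner_Integration.integral_cnj)
    qed
    show ?thesis using *[of M] *[of N] cM cN mom by simp
  qed
  show ?thesis using t
    by (induction rule: trigp.induct) (auto simp: i m)
qed

text \<open>Stone-Weierstrass on the circle turns equality on trigonometric polynomials into
  equality on bounded continuous functions; these approximate indicators of closed sets, which form
  an intersection-stable generator. Moments of negative order are conjugates of the given
  ones.\<close>

lemma circle_measure_eqI:
  assumes sM [simp, measurable_cong]: "sets M = sets borel" and fM: "finite_measure M" and cM: "AE z in M. cmod z = 1"
    and sN [simp, measurable_cong]: "sets N = sets borel" and fN: "finite_measure N" and cN: "AE z in N. cmod z = 1"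
    and mom: "\<And>k::nat. (LINT z|M. z ^ k) = (LINT z|N. z ^ k)"
  shows "M = N"
proof -
  interpret M: finite_measure M by fact
  interpret N: finite_measure N by fact
  have cont: "(LINT z|M. \<phi> z) = (LINT z|N. \<phi> z)"
    if \<phi>: "continuous_on UNIV \<phi>" and b: "\<And>z. \<bar>\<phi> z\<bar> \<le> 1" for \<phi> :: "complex \<Rightarrow> real"
  proof -
    have [measurable]: "\<phi> \<in> borel_measurable borel" using \<phi> by (rule borel_measurable_continuous_onI)
    have near: "\<bar>(LINT z|R. \<phi> z) - Re (LINT z|R. t z)\<bar> \<le> e * measure R (space R)"
      if R: "finite_measure R" "sets R = sets borel" "AE z in R. cmod z = 1"
        and t: "integrable R t" and e: "\<And>z. cmod z = 1 \<Longrightarrow> \<bar>\<phi> z - Re (t z)\<bar> \<le> e" for R t e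
    proof -
      interpret R: finite_measure R by fact
      note [measurable_cong] = R(2)
      have i\<phi>: "integrable R \<phi>" using b by (intro R.integrable_const_bound[of _ 1]) auto
      have "\<bar>(LINT z|R. \<phi> z) - Re (LINT z|R. t z)\<bar> = \<bar>LINT z|R. \<phi> z - Re (t z)\<bar>"
        using i\<phi> t by simp
      also have "\<dots> \<le> (LINT z|R. \<bar>\<phi> z - Re (t z)\<bar>)" by (rule integral_abs_bound)
      also have "\<dots> \<le> (LINT z|R. e)"
        using i\<phi> t R(3) e by (intro integral_mono_AE) (auto intro!: integrable_abs)
      finally show ?thesis by (simp add: mult.commute)
    qed
    have "\<bar>(LINT z|M. \<phi> z) - (LINT z|N. \<phi> z)\<bar> \<le> 0"
    proof (rule field_le_epsilon)
      fix e' :: real assume e': "e' > 0"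
      define e where "e = e' / (measure M (space M) + measure N (space N) + 1)"
      have pos: "measure M (space M) + measure N (space N) + 1 > 0" by (smt (verit) measure_nonneg)
      have e: "e > 0" using pos e' by (simp add: e_def)
      obtain g where g: "real_polynomial_function g" "\<And>x. x \<in> sphere 0 1 \<Longrightarrow> \<bar>\<phi> x - g x\<bar> < e"
        using Stone_Weierstrass_real_polynomial_function[OF compact_sphere[of 0 1] continuous_on_subset[OF \<phi>] e]
        by blast
      obtain t where t: "t \<in> trigp UNIV" "\<And>z. cmod z = 1 \<Longrightarrow> t z = complex_of_real (g z)"
        using real_polynomial_trigp[OF g(1)] by blast
      have T: "integrable M t \<and> integrable N t \<and> (LINT z|M. t z) = (LINT z|N. t z)"
        by (rule circle_moments_trigp[OF sM fM cM sN fN cN mom t(1)])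
      have te: "\<bar>\<phi> z - Re (t z)\<bar> \<le> e" if "cmod z = 1" for z
        using g(2)[of z] t(2)[OF that] that by simp
      have 1: "\<bar>(LINT z|M. \<phi> z) - Re (LINT z|M. t z)\<bar> \<le> e * measure M (space M)"
        using T te by (intro near fM sM cM) auto
      have 2: "\<bar>(LINT z|N. \<phi> z) - Re (LINT z|M. t z)\<bar> \<le> e * measure N (space N)"
        using near[OF fN sN cN, of t e] T te by simp
      have "\<bar>(LINT z|M. \<phi> z) - (LINT z|N. \<phi> z)\<bar> \<le> e * (measure M (space M) + measure N (space N))"
        using 1 2 by (simp add: distrib_left)
      also have "\<dots> \<le> e'" using pos e' by (simp add: e_def divide_simps mult_left_mono)
      finally show "\<bar>(LINT z|M. \<phi> z) - (LINT z|N. \<phi> z)\<bar> \<le> 0 + e'" by simp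
    qed
    then show ?thesis by simp
  qed
  have closed: "emeasure M C = emeasure N C" if C: "closed C" for C
  proof (cases "C = {}")
    case False
    define \<phi> where "\<phi> k z = max 0 (1 - real k * infdist z C)" for k :: nat and z
    have \<phi>c: "continuous_on UNIV (\<phi> k)" for k unfolding \<phi>_def by (intro continuous_intros)
    have \<phi>m [measurable]: "\<phi> k \<in> borel_measurable borel" for k using \<phi>c by (rule borel_measurable_continuous_onI)
    have \<phi>b: "\<bar>\<phi> k z\<bar> \<le> 1" for k z unfolding \<phi>_def by (simp add: infdist_nonneg)
    have [measurable]: "C \<in> sets borel" using C by auto
    have lim: "(\<lambda>k. \<phi> k z) \<longlonglongrightarrow> indicator C z" for z
    proof (cases "z \<in> C")
      case True then show ?thesis unfolding \<phi>_def by simp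
    next
      case False
      then have p: "infdist z C > 0" using in_closed_iff_infdist_zero[OF C \<open>C \<noteq> {}\<close>] infdist_nonneg[of z C] by force
      obtain K where K: "real K > 1 / infdist z C" using reals_Archimedean2 by blast
      have "\<phi> k z = 0" if "k \<ge> K" for k
      proof -
        have "real k > 1 / infdist z C" using K that by linarith
        then show ?thesis using p unfolding \<phi>_def by (simp add: field_simps)
      qed
      then have "\<forall>\<^sub>F k in sequentially. \<phi> k z = indicator C z"
        using False by (auto simp: eventually_sequentially)
      then show ?thesis by (rule tendsto_eventually)
    qed
    have R: "(\<lambda>k. LINT z|R. \<phi> k z) \<longlonglongrightarrow> measure R C" if "finite_measure R" "sets R = sets borel" for R
    proof -
      interpret R: finite_measure R by fact
      note [measurable_cong] = that(2)
      have "(\<lambda>k. LINT z|R. \<phi> k z) \<longlonglongrightarrow> (LINT z|R. indicator C z)"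
        by (rule integral_dominated_convergence[where w = "\<lambda>_. 1"]) (use lim \<phi>b in auto)
      then show ?thesis using that(2) sets_eq_imp_space_eq[OF that(2)] by simp
    qed
    have "measure M C = measure N C"
      using LIMSEQ_unique[OF R[OF fM sM]] R[OF fN sN] cont[OF \<phi>c \<phi>b] by simp
    then show ?thesis by (simp add: M.emeasure_eq_measure N.emeasure_eq_measure)
  qed simp
  show ?thesis
  proof (rule measure_eqI_generator_eq[where E = "Collect closed" and \<Omega> = UNIV and A = "\<lambda>_. UNIV"])
    show "sets M = sigma_sets UNIV (Collect closed)" "sets N = sigma_sets UNIV (Collect closed)"
      by (simp_all add: borel_eq_closed)
  qed (auto simp: Int_stable_def closed)
qed

text \<open>Moments characterize the measure, so invariance reduces to a computation with powers of
  \<open>z\<close>; the same argument gives \<open>distr_circ_power\<close>.\<close>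

lemma distr_circ_mult:
  assumes "cmod w = 1" shows "distr circ borel (\<lambda>z. w * z) = circ"
proof (rule circle_measure_eqI)
  show "finite_measure (distr circ borel ((*) w))" by (rule circ.finite_measure_distr) simp
  show "AE z in distr circ borel ((*) w). cmod z = 1"
    by (subst AE_distr_iff) (use AE_circ assms in \<open>auto simp: norm_mult\<close>)
  fix k :: nat
  have "(LINT z|distr circ borel ((*) w). z ^ k) = w ^ k * (LINT z|circ. z ^ k)"
    by (subst integral_distr) (auto simp: power_mult_distrib)
  then show "(LINT z|distr circ borel ((*) w). z ^ k) = (LINT z|circ. z ^ k)"
    using integral_circ_powi[of "int k"] by (cases "k = 0") auto
qed (auto simp: AE_circ circ.finite_measure_axioms)

lemma distr_circ_power:
  assumes "n \<ge> 1" shows "distr circ borel (\<lambda>z. z ^ n) = circ"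
proof (rule circle_measure_eqI)
  show "finite_measure (distr circ borel (\<lambda>z. z ^ n))" by (rule circ.finite_measure_distr) simp
  show "AE z in distr circ borel (\<lambda>z. z ^ n). cmod z = 1"
    by (subst AE_distr_iff) (use AE_circ assms in \<open>auto simp: norm_power\<close>)
  fix k :: nat
  have "(LINT z|distr circ borel (\<lambda>z. z ^ n). z ^ k) = (LINT z|circ. z ^ (n * k))"
    by (subst integral_distr) (auto simp: power_mult)
  then show "(LINT z|distr circ borel (\<lambda>z. z ^ n). z ^ k) = (LINT z|circ. z ^ k)"
    using integral_circ_powi[of "int k"] integral_circ_powi[of "int (n * k)"] assms
    by (cases "k = 0") (auto simp del: of_nat_mult)
qed (auto simp: AE_circ circ.finite_measure_axioms)

section \<open>Uniqueness of Fourier coefficients\<close>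

definition fc :: "(complex \<Rightarrow> complex) \<Rightarrow> int \<Rightarrow> complex" where
  "fc f k = (LINT z|circ. f z * z powi (- k))"

lemma integrable_mult_powi:
  assumes "integrable circ f" shows "integrable circ (\<lambda>z. f z * z powi k)"
proof (rule Bochner_Integration.integrable_bound[OF assms])
  show "(\<lambda>z. f z * z powi k) \<in> borel_measurable circ" using assms by measurable
  show "AE z in circ. norm (f z * z powi k) \<le> norm (f z)"
    using AE_circ by eventually_elim (simp add: norm_mult norm_power_int)
qed

text \<open>The measures with densities the positive and negative parts of \<open>u\<close> have
  equal moments, hence coincide. Their densities then agree almost everywhere, and as one of them
  vanishes at each point both are 0.\<close>

lemma real_fc_unique:
  fixes u :: "complex \<Rightarrow> real"
  assumes i: "integrable circ u" and z: "\<And>k. fc (\<lambda>z. complex_of_real (u z)) k = 0"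
  shows "AE z in circ. u z = 0"
proof -
  note [measurable] = borel_measurable_integrable[OF i]
  let ?M = "density circ (\<lambda>z. ennreal (max 0 (u z)))" and ?N = "density circ (\<lambda>z. ennreal (max 0 (- u z)))"
  have fin: "integral\<^sup>N circ (\<lambda>z. ennreal (max 0 (v z))) \<noteq> \<infinity>" if "integrable circ v" for v :: "complex \<Rightarrow> real"
    using that by (subst nn_integral_eq_integral) auto
  have "?M = ?N"
  proof (rule circle_measure_eqI)
    show "finite_measure ?M" "finite_measure ?N"
      using fin[OF i] fin[of "\<lambda>z. - u z"] i by (auto intro!: finite_measureI simp: emeasure_density)
    show "AE z in ?M. cmod z = 1" "AE z in ?N. cmod z = 1"
      using AE_circ by (auto simp: AE_density)
    fix k :: nat
    have int: "integrable circ (\<lambda>z. complex_of_real (max 0 (v z)) * z ^ k)" if "integrable circ v" for v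
      using integrable_mult_powi[of "\<lambda>z. complex_of_real (max 0 (v z))" "int k"] that by simp
    have "(LINT z|?M. z ^ k) - (LINT z|?N. z ^ k)
      = (LINT z|circ. complex_of_real (max 0 (u z)) * z ^ k) - (LINT z|circ. complex_of_real (max 0 (- u z)) * z ^ k)"
      by (simp add: integral_density scaleR_conv_of_real)
    also have "\<dots> = (LINT z|circ. complex_of_real (max 0 (u z)) * z ^ k - complex_of_real (max 0 (- u z)) * z ^ k)"
      using int[OF i] int[of "\<lambda>z. - u z"] i by simp
    also have "\<dots> = (LINT z|circ. complex_of_real (u z) * z ^ k)"
      by (rule Bochner_Integration.integral_cong) (auto simp: max_def)
    also have "\<dots> = 0" using z[of "- int k"] by (simp add: fc_def)
    finally show "(LINT z|?M. z ^ k) = (LINT z|?N. z ^ k)" by simp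
  qed auto
  then have "AE z in circ. ennreal (max 0 (u z)) = ennreal (max 0 (- u z))"
    using fin[OF i] by (subst (asm) finite_density_unique) auto
  then show ?thesis by eventually_elim (auto simp: max_def split: if_splits)
qed

lemma fc_unique:
  assumes i: "integrable circ f" and z: "\<And>k. fc f k = 0"
  shows "AE z in circ. f z = 0"
proof -
  have c: "fc (\<lambda>z. cnj (f z)) k = 0" for k
  proof -
    have [measurable]: "f \<in> borel_measurable circ" using i by auto
    have "fc (\<lambda>z. cnj (f z)) k = (LINT z|circ. cnj (f z * z powi (- (- k))))"
      unfolding fc_def
    proof (rule integral_cong_AE)
      show "AE z in circ. cnj (f z) * z powi - k = cnj (f z * z powi - (- k))"
        using AE_circ by eventually_elim (simp add: cnj_powi del: complex_cnj_power_int)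
    qed measurable
    also have "\<dots> = cnj (fc f (- k))" unfolding fc_def by (rule Bochner_Integration.integral_cnj)
    finally show ?thesis using z by simp
  qed
  have i': "integrable circ (\<lambda>z. cnj (f z))" using i by simp
  have "fc (\<lambda>z. complex_of_real (Re (f z))) k = 0" for k
  proof -
    have "fc (\<lambda>z. complex_of_real (Re (f z))) k = (LINT z|circ. (f z * z powi (-k) + cnj (f z) * z powi (-k)) / 2)"
      unfolding fc_def by (rule Bochner_Integration.integral_cong) (auto simp: complex_eq_iff algebra_simps)
    also have "\<dots> = (fc f k + fc (\<lambda>z. cnj (f z)) k) / 2"
      unfolding fc_def using integrable_mult_powi[OF i, of "-k"] integrable_mult_powi[OF i', of "-k"] by simp
    finally show ?thesis using z c by simp
  qed
  moreover have "fc (\<lambda>z. complex_of_real (Im (f z))) k = 0" for k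
  proof -
    have "fc (\<lambda>z. complex_of_real (Im (f z))) k = (LINT z|circ. (f z * z powi (-k) - cnj (f z) * z powi (-k)) / (2 * \<i>))"
      unfolding fc_def by (rule Bochner_Integration.integral_cong) (auto simp: complex_eq_iff algebra_simps Re_divide Im_divide)
    also have "\<dots> = (fc f k - fc (\<lambda>z. cnj (f z)) k) / (2 * \<i>)"
      unfolding fc_def using integrable_mult_powi[OF i, of "-k"] integrable_mult_powi[OF i', of "-k"] by simp
    finally show ?thesis using z c by simp
  qed
  ultimately have "AE z in circ. Re (f z) = 0" "AE z in circ. Im (f z) = 0"
    using i by (auto intro!: real_fc_unique)
  then show ?thesis by eventually_elim (simp add: complex_eq_iff)
qed

section \<open>Fourier coefficients\<close>

lemma fc_cong_AE:
  assumes "f \<in> borel_measurable circ" "g \<in> borel_measurable circ" "AE z in circ. f z = g z"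
  shows "fc f k = fc g k"
  unfolding fc_def
proof (rule integral_cong_AE)
  show "AE z in circ. f z * z powi - k = g z * z powi - k" using assms(3) by eventually_elim simp
qed (use assms(1,2) in measurable)

lemma fc_0 [simp]: "fc (\<lambda>z. 0) k = 0" by (simp add: fc_def)

lemma fc_add: "integrable circ f \<Longrightarrow> integrable circ g \<Longrightarrow> fc (\<lambda>z. f z + g z) k = fc f k + fc g k"
  unfolding fc_def using integrable_mult_powi[of f "-k"] integrable_mult_powi[of g "-k"] by (simp add: distrib_right)

lemma fc_diff: "integrable circ f \<Longrightarrow> integrable circ g \<Longrightarrow> fc (\<lambda>z. f z - g z) k = fc f k - fc g k"
  unfolding fc_def using integrable_mult_powi[of f "-k"] integrable_mult_powi[of g "-k"] by (simp add: left_diff_distrib)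

lemma fc_scale: "fc (\<lambda>z. c * f z) k = c * fc f k"
  unfolding fc_def by (simp add: mult.assoc)

lemma fc_divide: "fc (\<lambda>z. f z / c) k = fc f k / c"
  using fc_scale[of "inverse c" f k] by (simp add: field_simps)

lemma fc_sum:
  "finite I \<Longrightarrow> (\<And>i. i \<in> I \<Longrightarrow> integrable circ (f i)) \<Longrightarrow> fc (\<lambda>z. \<Sum>i\<in>I. f i z) k = (\<Sum>i\<in>I. fc (f i) k)"
  by (induction I rule: finite_induct) (auto simp: fc_add)

lemma fc_shift:
  assumes [measurable]: "f \<in> borel_measurable circ"
  shows "fc (\<lambda>z. z powi j * f z) k = fc f (k - j)"
  unfolding fc_def
proof (rule integral_cong_AE)
  show "AE z in circ. z powi j * f z * z powi - k = f z * z powi - (k - j)"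
    using AE_circ_ne_0
  proof eventually_elim
    case (elim z)
    then have "z powi (j + - k) = z powi j * z powi - k" by (intro power_int_add) auto
    then show ?case by (simp add: mult_ac)
  qed
qed measurable

lemma fc_powi: "fc (\<lambda>z. z powi j) k = (if j = k then 1 else 0)"
  using fc_shift[of "\<lambda>z. 1" j k] integral_circ_powi[of "j - k"] by (simp add: fc_def)

lemma fc_norm_le: "integrable circ f \<Longrightarrow> cmod (fc f k) \<le> (LINT z|circ. cmod (f z))"
proof -
  assume i: "integrable circ f"
  note [measurable] = borel_measurable_integrable[OF i]
  have "cmod (fc f k) \<le> (LINT z|circ. cmod (f z * z powi - k))"
    unfolding fc_def by (rule integral_norm_bound)
  also have "\<dots> = (LINT z|circ. cmod (f z))"
  proof (rule integral_cong_AE)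
    show "AE z in circ. cmod (f z * z powi - k) = cmod (f z)"
      using AE_circ by eventually_elim (simp add: norm_mult norm_power_int)
  qed measurable
  finally show ?thesis .
qed

lemma powi_bounded: "AE z in circ. cmod (z powi k) \<le> 1"
  using AE_circ by eventually_elim (simp add: norm_power_int)

lemma powi_L2m: "(\<lambda>z. z powi k) \<in> L2m circ"
  by (rule circ.L2m_bounded[OF _ powi_bounded]) measurable

lemma L2m_powi_mult: "f \<in> L2m circ \<Longrightarrow> (\<lambda>z. z powi k * f z) \<in> L2m circ"
  by (rule L2m_bounded_mult(1)[OF _ _ powi_bounded]) auto

lemma fc_conv2:
  assumes "\<And>i. s i \<in> L2m circ" "f \<in> L2m circ" "conv2 circ s f"
  shows "(\<lambda>i. fc (s i) k) \<longlonglongrightarrow> fc f k"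
  unfolding fc_def by (rule conv2_tendsto_integral_mult[OF assms powi_L2m])

lemma inner_powi:
  assumes [measurable]: "f \<in> borel_measurable circ"
  shows "(LINT z|circ. f z * cnj (z powi k)) = fc f k"
  unfolding fc_def
proof (rule integral_cong_AE)
  show "AE z in circ. f z * cnj (z powi k) = f z * z powi - k"
    using AE_circ by eventually_elim (simp add: cnj_powi del: complex_cnj_power_int)
qed measurable

lemma trigp_AE_bounded: "f \<in> trigp A \<Longrightarrow> \<exists>C. AE z in circ. cmod (f z) \<le> C"
proof -
  assume "f \<in> trigp A"
  then obtain C where "\<forall>z. cmod z = 1 \<longrightarrow> cmod (f z) \<le> C" using trigp_bounded by blast
  then have "AE z in circ. cmod (f z) \<le> C" using AE_circ by (auto elim: eventually_mono)
  then show ?thesis by blast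
qed

lemma trigp_L2m: "f \<in> trigp A \<Longrightarrow> f \<in> L2m circ"
proof -
  assume f: "f \<in> trigp A"
  then obtain C where C: "AE z in circ. cmod (f z) \<le> C" using trigp_AE_bounded by blast
  have "f \<in> borel_measurable circ" using trigp_meas[OF f] by simp
  from circ.L2m_bounded[OF this C] show ?thesis .
qed

lemma fc_trigp: "f \<in> trigp A \<Longrightarrow> k \<notin> A \<Longrightarrow> fc f k = 0"
proof (induction rule: trigp.induct)
  case (mono j c) then show ?case by (auto simp: fc_scale fc_powi)
next
  case (add f g) then show ?case by (auto simp: fc_add circ.L2m_integrable trigp_L2m)
qed simp

section \<open>Mean-square closures and density\<close>

definition cl2 :: "'a measure \<Rightarrow> ('a \<Rightarrow> complex) set \<Rightarrow> ('a \<Rightarrow> complex) set" where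
  "cl2 M S = {g \<in> L2m M. \<forall>e>0. \<exists>t\<in>S. sqn M (\<lambda>z. g z - t z) < e}"

text \<open>The explicit rate matters later: square roots of \<open>(1/4)^i\<close> are summable, so
  the deviations of the sequence from its limit have an integrable sum.\<close>

lemma cl2_seq:
  assumes "g \<in> cl2 M S"
  obtains s where "\<And>i. s i \<in> S" "conv2 M s g" "\<And>i. sqn M (\<lambda>z. g z - s i z) < (1/4) ^ i"
proof -
  have "\<exists>t\<in>S. sqn M (\<lambda>z. g z - t z) < (1/4) ^ i" for i :: nat
    using assms by (auto simp: cl2_def)
  then obtain s where s: "\<And>i. s i \<in> S" "\<And>i. sqn M (\<lambda>z. g z - s i z) < (1/4) ^ i" by metis
  have "(\<lambda>i. sqn M (\<lambda>z. s i z - g z)) \<longlonglongrightarrow> 0"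
  proof (rule real_tendsto_sandwich[OF _ _ tendsto_const])
    show "\<forall>\<^sub>F n in sequentially. 0 \<le> sqn M (\<lambda>z. s n z - g z)" by (simp add: sqn_nonneg)
    show "\<forall>\<^sub>F n in sequentially. sqn M (\<lambda>z. s n z - g z) \<le> (1/4) ^ n"
      using s(2) by (intro always_eventually allI) (simp add: sqn_minus_commute less_imp_le)
    show "(\<lambda>n. (1/4::real) ^ n) \<longlonglongrightarrow> 0" by (rule LIMSEQ_realpow_zero) auto
  qed
  with s that show thesis by (auto simp: conv2_def)
qed

lemma cl2_sub: "cl2 M S \<subseteq> L2m M" by (auto simp: cl2_def)

lemma cl2_sup: "S \<subseteq> L2m M \<Longrightarrow> S \<subseteq> cl2 M S"
proof
  fix f assume "S \<subseteq> L2m M" "f \<in> S"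
  moreover have "sqn M (\<lambda>z. f z - f z) = 0" by (simp add: sqn_def)
  ultimately show "f \<in> cl2 M S" unfolding cl2_def by (auto intro!: bexI[of _ f])
qed

lemma closed2_cl2:
  assumes S: "S \<subseteq> L2m M" shows "closed2 M (cl2 M S)"
  unfolding closed2_def
proof (intro allI impI, elim conjE)
  fix s f assume s: "\<forall>i. s i \<in> cl2 M S" and f: "f \<in> L2m M" "conv2 M s f"
  have "\<exists>t\<in>S. sqn M (\<lambda>z. f z - t z) < e" if e: "e > 0" for e
  proof -
    obtain i where i: "sqn M (\<lambda>z. s i z - f z) < e / 4"
      using LIMSEQ_D[OF f(2)[unfolded conv2_def], of "e/4"] e sqn_nonneg[of M] by (force simp: abs_of_nonneg)
    obtain t where t: "t \<in> S" "sqn M (\<lambda>z. s i z - t z) < e / 4"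
      using spec[OF s, of i] e unfolding cl2_def by (auto dest!: spec[of _ "e/4"])
    have "sqn M (\<lambda>z. f z - t z) \<le> 2 * sqn M (\<lambda>z. f z - s i z) + 2 * sqn M (\<lambda>z. s i z - t z)"
      using f spec[OF s, of i] t(1) S cl2_sub[of M S] by (intro sqn_triangle) auto
    then show ?thesis using i t by (intro bexI[of _ t]) (auto simp: sqn_minus_commute[of M f "s i"])
  qed
  then show "f \<in> cl2 M S" using f by (auto simp: cl2_def)
qed

lemma cl2_add:
  assumes S: "S \<subseteq> L2m M" and a: "\<And>f g. f \<in> S \<Longrightarrow> g \<in> S \<Longrightarrow> (\<lambda>z. f z + g z) \<in> S"
    and f: "f \<in> cl2 M S" and g: "g \<in> cl2 M S"
  shows "(\<lambda>z. f z + g z) \<in> cl2 M S"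
proof -
  have fg: "f \<in> L2m M" "g \<in> L2m M" using f g cl2_sub by auto
  have "\<exists>t\<in>S. sqn M (\<lambda>z. f z + g z - t z) < e" if e: "e > 0" for e
  proof -
    obtain t t' where t: "t \<in> S" "sqn M (\<lambda>z. f z - t z) < e / 4" "t' \<in> S" "sqn M (\<lambda>z. g z - t' z) < e / 4"
      using f g e unfolding cl2_def by (auto dest!: spec[of _ "e/4"])
    have "sqn M (\<lambda>z. (f z - t z) + (g z - t' z)) \<le> 2 * sqn M (\<lambda>z. f z - t z) + 2 * sqn M (\<lambda>z. g z - t' z)"
      using fg t S by (intro sqn_add_le L2m_diff) auto
    then show ?thesis using t a by (intro bexI[of _ "\<lambda>z. t z + t' z"]) (auto simp: algebra_simps)
  qed
  then show ?thesis using L2m_add[OF fg] by (auto simp: cl2_def)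
qed

lemma cl2_bounded_mult:
  assumes m: "\<And>f. f \<in> S \<Longrightarrow> (\<lambda>z. h z * f z) \<in> S" and S: "S \<subseteq> L2m M"
    and h: "h \<in> borel_measurable M" "AE z in M. cmod (h z) \<le> C"
    and f: "f \<in> cl2 M S"
  shows "(\<lambda>z. h z * f z) \<in> cl2 M S"
proof -
  have fL: "f \<in> L2m M" using f cl2_sub by auto
  have "\<exists>t\<in>S. sqn M (\<lambda>z. h z * f z - t z) < e" if e: "e > 0" for e
  proof -
    have "e / (C\<^sup>2 + 1) > 0" using e by (simp add: add_nonneg_pos)
    then obtain t where t: "t \<in> S" "sqn M (\<lambda>z. f z - t z) < e / (C\<^sup>2 + 1)"
      using f unfolding cl2_def by blast
    have "sqn M (\<lambda>z. h z * (f z - t z)) \<le> C\<^sup>2 * sqn M (\<lambda>z. f z - t z)"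
      using fL t S by (intro L2m_bounded_mult(2)[OF _ h] L2m_diff) auto
    also have "\<dots> \<le> (C\<^sup>2 + 1) * sqn M (\<lambda>z. f z - t z)"
      using sqn_nonneg[of M "\<lambda>z. f z - t z"] by (simp add: distrib_right)
    also have "\<dots> < e" using t(2) by (simp add: pos_less_divide_eq add_nonneg_pos mult.commute)
    finally show ?thesis using t(1) m by (intro bexI[of _ "\<lambda>z. h z * t z"]) (auto simp: right_diff_distrib)
  qed
  then show ?thesis using L2m_bounded_mult(1)[OF fL h] by (auto simp: cl2_def)
qed

lemma cl2_scale:
  assumes "\<And>c f. f \<in> S \<Longrightarrow> (\<lambda>z. c * f z) \<in> S" "S \<subseteq> L2m M" "f \<in> cl2 M S"
  shows "(\<lambda>z. c * f z) \<in> cl2 M S"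
  by (rule cl2_bounded_mult[where C = "cmod c" and h = "\<lambda>z. c"]) (use assms in auto)

lemma conv2_diff_const:
  "conv2 M (\<lambda>i z. f z - s i z) (\<lambda>z. f z - h z) \<longleftrightarrow> conv2 M s h"
proof -
  have "sqn M (\<lambda>z. f z - s i z - (f z - h z)) = sqn M (\<lambda>z. s i z - h z)" for i
    using sqn_minus_commute[of M h "s i"] by simp
  then show ?thesis unfolding conv2_def by simp
qed

text \<open>Let \<open>h\<close> be the difference of \<open>f\<close> and its closest point in the
  closure. Minimality makes \<open>h\<close> orthogonal to the frequencies in \<open>A\<close>, and
  outside \<open>A\<close> neither \<open>f\<close> nor the closure has coefficients; so all
  coefficients of \<open>h\<close> vanish.\<close>

lemma trigp_dense:
  assumes f: "f \<in> L2m circ" and A: "\<And>k. k \<notin> A \<Longrightarrow> fc f k = 0"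
  shows "f \<in> cl2 circ (trigp A)"
proof -
  let ?T = "cl2 circ (trigp A)"
  define S where "S = {(\<lambda>z. f z - g z) |g. g \<in> ?T}"
  have sub: "trigp A \<subseteq> L2m circ" using trigp_L2m by auto
  have add: "(\<lambda>z. g z + h z) \<in> ?T" if "g \<in> ?T" "h \<in> ?T" for g h
    by (rule cl2_add[OF sub]) (use that trigp.add in auto)
  have sc: "(\<lambda>z. c * g z) \<in> ?T" if "g \<in> ?T" for g c
    by (rule cl2_scale) (use that trigp_scale sub in auto)
  have SL: "S \<subseteq> L2m circ" using f cl2_sub L2m_diff unfolding S_def by fastforce
  obtain h where h: "h \<in> S" "\<And>g. g \<in> S \<Longrightarrow> sqn circ h \<le> sqn circ g"
  proof (rule circ.L2m_minimizer_exists[OF SL])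
    show "S \<noteq> {}" using cl2_sup[OF sub] trigp.zero[of A] unfolding S_def by auto
    fix u v assume "u \<in> S" "v \<in> S"
    then obtain g g' where g: "u = (\<lambda>z. f z - g z)" "v = (\<lambda>z. f z - g' z)" "g \<in> ?T" "g' \<in> ?T"
      unfolding S_def by auto
    have "(\<lambda>z. (u z + v z) / 2) = (\<lambda>z. f z - (1/2) * (g z + g' z))"
      using g by (auto simp: field_simps)
    then show "(\<lambda>z. (u z + v z) / 2) \<in> S" unfolding S_def using sc[OF add[OF g(3,4)], of "1/2"]
      by (intro CollectI exI[of _ "\<lambda>z. (1/2) * (g z + g' z)"]) simp
  next
    show "closed2 circ S" unfolding closed2_def
    proof (intro allI impI, elim conjE)
      fix s u assume s: "\<forall>i. s i \<in> S" and u: "u \<in> L2m circ" "conv2 circ s u"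
      define g where "g i = (\<lambda>z. f z - s i z)" for i
      have "g i \<in> ?T" for i
      proof -
        obtain g' where "g' \<in> ?T" "s i = (\<lambda>z. f z - g' z)" using s unfolding S_def by force
        then show ?thesis by (simp add: g_def)
      qed
      moreover have "conv2 circ g (\<lambda>z. f z - u z)" unfolding g_def conv2_diff_const by fact
      moreover have "(\<lambda>z. f z - u z) \<in> L2m circ" using f u L2m_diff by auto
      ultimately have "(\<lambda>z. f z - u z) \<in> ?T" using closed2_cl2[OF sub] unfolding closed2_def by blast
      then show "u \<in> S" unfolding S_def by (intro CollectI exI[of _ "\<lambda>z. f z - u z"]) auto
    qed
  qed (rule that, assumption, blast)
  obtain g where g: "g \<in> ?T" "h = (\<lambda>z. f z - g z)" using h(1) unfolding S_def by auto
  have gL: "g \<in> L2m circ" using g(1) cl2_sub by auto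
  have hL: "h \<in> L2m circ" using h(1) SL by auto
  have "fc h k = 0" for k
  proof (cases "k \<in> A")
    case True
    have "(LINT z|circ. h z * cnj (z powi k)) = 0"
    proof (rule L2m_minimizer_orthogonal[OF hL powi_L2m])
      fix c
      have "(\<lambda>z. (- c) * z powi k) \<in> ?T" using trigp.mono[OF True, of "-c"] cl2_sup[OF sub] by auto
      from add[OF g(1) this] have "(\<lambda>z. f z - (g z + (- c) * z powi k)) \<in> S" unfolding S_def
        by (intro CollectI exI[of _ "\<lambda>z. g z + (- c) * z powi k"]) simp
      then show "sqn circ h \<le> sqn circ (\<lambda>z. h z + c * z powi k)"
        using h(2) g(2) by (simp add: algebra_simps)
    qed
    then show ?thesis using inner_powi[OF L2m_meas[OF hL], of k] by simp
  next
    case False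
    obtain s where s: "\<And>i. s i \<in> trigp A" "conv2 circ s g" using cl2_seq[OF g(1)] by metis
    have "(\<lambda>i. fc (s i) k) \<longlonglongrightarrow> fc g k" using s gL trigp_L2m by (intro fc_conv2) auto
    moreover have "fc (s i) k = 0" for i using s(1) False by (rule fc_trigp)
    ultimately have "fc g k = 0" using LIMSEQ_unique[OF tendsto_const[of 0 sequentially]] by simp
    then show ?thesis using A[OF False] f gL by (simp add: g(2) fc_diff circ.L2m_integrable)
  qed
  then have "AE z in circ. h z = 0" using hL by (intro fc_unique circ.L2m_integrable)
  then have ae: "AE z in circ. f z = g z" using g(2) by auto
  have "sqn circ (\<lambda>z. f z - t z) = sqn circ (\<lambda>z. g z - t z)" if "t \<in> trigp A" for t
  proof -
    have [measurable]: "f \<in> borel_measurable circ" "g \<in> borel_measurable circ" "t \<in> borel_measurable circ"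
      using f gL trigp_L2m[OF that] L2m_meas by auto
    show ?thesis unfolding sqn_def by (rule integral_cong_AE) (use ae in auto)
  qed
  then show ?thesis using g(1) f by (auto simp: cl2_def)
qed

text \<open>With a trigonometric polynomial in place of \<open>f\<close> this is the shift rule for
  coefficients. A coefficient of the product is mean-square continuous in \<open>f\<close> for fixed
  \<open>g\<close>, so density of the polynomials with frequencies in \<open>A\<close>
  finishes.\<close>

lemma fc_mult_supp:
  assumes f: "f \<in> L2m circ" "\<And>k. k \<notin> A \<Longrightarrow> fc f k = 0"
    and g: "g \<in> L2m circ" "\<And>k. k \<notin> B \<Longrightarrow> fc g k = 0"
    and k: "\<And>a b. a \<in> A \<Longrightarrow> b \<in> B \<Longrightarrow> k \<noteq> a + b"
  shows "fc (\<lambda>z. f z * g z) k = 0"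
proof -
  obtain s where s: "\<And>i. s i \<in> trigp A" "conv2 circ s f" using cl2_seq[OF trigp_dense[OF f]] by metis
  have sL: "s i \<in> L2m circ" for i using s(1) trigp_L2m by auto
  have gk: "(\<lambda>z. g z * z powi (-k)) \<in> L2m circ" using L2m_powi_mult[OF g(1), of "-k"] by (simp add: mult.commute)
  have *: "(\<lambda>i. LINT z|circ. s i z * (g z * z powi (-k))) \<longlonglongrightarrow> (LINT z|circ. f z * (g z * z powi (-k)))"
    by (rule conv2_tendsto_integral_mult[OF sL f(1) s(2) gk])
  have "(LINT z|circ. t z * (g z * z powi (-k))) = 0" if "t \<in> trigp A" for t
    using that
  proof (induction rule: trigp.induct)
    case (mono a c)
    have "fc (\<lambda>z. z powi a * g z) k = fc g (k - a)" using g L2m_meas by (intro fc_shift) auto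
    also have "\<dots> = 0" using k[of a "k - a"] mono by (intro g(2)) auto
    finally show ?case by (simp add: fc_def mult.assoc)
  next
    case (add t u)
    then show ?case using L2m_mult_integrable[OF trigp_L2m gk] by (simp add: distrib_right)
  qed simp
  then have "(LINT z|circ. f z * (g z * z powi (-k))) = 0"
    using LIMSEQ_unique[OF *] s(1) by simp
  then show ?thesis by (simp add: fc_def mult.assoc)
qed

section \<open>Bounded functions with frequencies in a given set\<close>

definition HA :: "int set \<Rightarrow> (complex \<Rightarrow> complex) set" where
  "HA A = {f \<in> Linf. \<forall>k. k \<notin> A \<longrightarrow> fc f k = 0}"

lemma LinfD: "f \<in> Linf \<Longrightarrow> f \<in> borel_measurable circ" "f \<in> Linf \<Longrightarrow> \<exists>C. AE z in circ. cmod (f z) \<le> C"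
  by (auto simp: Linf_def)

lemma LinfE:
  assumes "f \<in> Linf" obtains C where "C > 0" "AE z in circ. cmod (f z) \<le> C"
proof -
  obtain C where C: "AE z in circ. cmod (f z) \<le> C" using LinfD(2)[OF assms] by auto
  have "AE z in circ. cmod (f z) \<le> max C 1" using C by eventually_elim auto
  then show thesis by (intro that[of "max C 1"]) auto
qed

lemma Linf_L2m: "f \<in> Linf \<Longrightarrow> f \<in> L2m circ"
  by (meson LinfD circ.L2m_bounded)

lemma Linf_integrable: "f \<in> Linf \<Longrightarrow> integrable circ f"
  by (intro circ.L2m_integrable Linf_L2m)

lemma Linf_add: "f \<in> Linf \<Longrightarrow> g \<in> Linf \<Longrightarrow> (\<lambda>z. f z + g z) \<in> Linf"
proof -
  assume f: "f \<in> Linf" and g: "g \<in> Linf"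
  then obtain C D where "AE z in circ. cmod (f z) \<le> C" "AE z in circ. cmod (g z) \<le> D" using LinfD(2) by metis
  then have "AE z in circ. cmod (f z + g z) \<le> C + D" by eventually_elim (auto intro: norm_triangle_le)
  then show ?thesis using f g by (auto simp: Linf_def)
qed

lemma Linf_mult: "f \<in> Linf \<Longrightarrow> g \<in> Linf \<Longrightarrow> (\<lambda>z. f z * g z) \<in> Linf"
proof -
  assume f: "f \<in> Linf" and g: "g \<in> Linf"
  then obtain C D where "AE z in circ. cmod (f z) \<le> C" "AE z in circ. cmod (g z) \<le> D" using LinfD(2) by metis
  then have "AE z in circ. cmod (f z * g z) \<le> C * D"
    by eventually_elim (auto simp: norm_mult intro!: mult_mono order_trans[OF norm_ge_zero])
  then show ?thesis using f g by (auto simp: Linf_def)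
qed

lemma Linf_const [simp]: "(\<lambda>z. c) \<in> Linf" by (auto simp: Linf_def)

lemma Linf_scale: "f \<in> Linf \<Longrightarrow> (\<lambda>z. c * f z) \<in> Linf" by (rule Linf_mult) simp_all

lemma Linf_uminus: "f \<in> Linf \<Longrightarrow> (\<lambda>z. - f z) \<in> Linf" using Linf_scale[of f "-1"] by simp

lemma Linf_diff: "f \<in> Linf \<Longrightarrow> g \<in> Linf \<Longrightarrow> (\<lambda>z. f z - g z) \<in> Linf"
  using Linf_add[of f "\<lambda>z. - g z"] Linf_uminus[of g] by simp

lemma Linf_cnj: "f \<in> Linf \<Longrightarrow> (\<lambda>z. cnj (f z)) \<in> Linf" by (auto simp: Linf_def)

lemma Linf_sum: "(\<And>i. i \<in> I \<Longrightarrow> f i \<in> Linf) \<Longrightarrow> (\<lambda>z. \<Sum>i\<in>I. f i z) \<in> Linf"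
  by (induction I rule: infinite_finite_induct) (auto intro: Linf_add)

lemma Linf_powi [simp]: "(\<lambda>z. z powi k) \<in> Linf"
  using powi_bounded[of k] unfolding Linf_def by auto

lemma Linf_power [simp]: "(\<lambda>z. z ^ k) \<in> Linf"
  using Linf_powi[of "int k"] by simp

lemma Linf_bound: "g \<in> Linf \<Longrightarrow> f \<in> borel_measurable circ \<Longrightarrow> AE z in circ. cmod (f z) \<le> cmod (g z) \<Longrightarrow> f \<in> Linf"
proof -
  assume g: "g \<in> Linf" and f: "f \<in> borel_measurable circ" and le: "AE z in circ. cmod (f z) \<le> cmod (g z)"
  then obtain C where "AE z in circ. cmod (g z) \<le> C" using LinfD by blast
  with le have "AE z in circ. cmod (f z) \<le> C" by eventually_elim auto
  with f show ?thesis by (auto simp: Linf_def)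
qed

lemma trigp_HA: "t \<in> trigp A \<Longrightarrow> t \<in> HA A"
  unfolding HA_def Linf_def using trigp_AE_bounded[of t A] trigp_meas[of t A] fc_trigp[of t A] by auto

lemma HA_Linf: "f \<in> HA A \<Longrightarrow> f \<in> Linf" by (simp add: HA_def)

lemma HA_fc: "f \<in> HA A \<Longrightarrow> k \<notin> A \<Longrightarrow> fc f k = 0" by (simp add: HA_def)

lemma HA_mono: "f \<in> HA A \<Longrightarrow> A \<subseteq> B \<Longrightarrow> f \<in> HA B" by (auto simp: HA_def)

lemma HA_add: "f \<in> HA A \<Longrightarrow> g \<in> HA A \<Longrightarrow> (\<lambda>z. f z + g z) \<in> HA A"
  by (auto simp: HA_def Linf_add fc_add Linf_integrable)

lemma HA_mult:
  assumes "f \<in> HA A" "g \<in> HA B" "\<And>a b. a \<in> A \<Longrightarrow> b \<in> B \<Longrightarrow> a + b \<in> C"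
  shows "(\<lambda>z. f z * g z) \<in> HA C"
proof -
  have "fc (\<lambda>z. f z * g z) k = 0" if "k \<notin> C" for k
  proof (rule fc_mult_supp)
    show "f \<in> L2m circ" "g \<in> L2m circ" using assms by (auto intro: HA_Linf Linf_L2m)
    show "fc f k = 0" if "k \<notin> A" for k using assms(1) that by (rule HA_fc)
    show "fc g k = 0" if "k \<notin> B" for k using assms(2) that by (rule HA_fc)
  qed (use assms(3) that in auto)
  then show ?thesis using assms by (auto simp: HA_def Linf_mult)
qed

lemma HA_const: "0 \<in> A \<Longrightarrow> (\<lambda>z. c) \<in> HA A"
  using trigp_HA[OF trigp.mono[of 0 A c]] by simp

lemma HA_powi: "k \<in> A \<Longrightarrow> (\<lambda>z. z powi k) \<in> HA A"
  using trigp_HA[OF trigp.mono[of k A 1]] by simp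

lemma Hinf_eq_HA: "Hinf = HA {0..}"
proof -
  have "(\<forall>k::nat. k \<ge> 1 \<longrightarrow> (LINT z|circ. f z * z ^ k) = 0) \<longleftrightarrow> (\<forall>k::int. k \<notin> {0..} \<longrightarrow> fc f k = 0)" for f
  proof (intro iffI allI impI)
    fix k :: int assume *: "\<forall>k::nat. k \<ge> 1 \<longrightarrow> (LINT z|circ. f z * z ^ k) = 0" and k: "k \<notin> {0..}"
    then have "(LINT z|circ. f z * z ^ nat (-k)) = 0" by auto
    then show "fc f k = 0" using k by (simp add: fc_def power_int_def)
  next
    fix k :: nat assume *: "\<forall>k::int. k \<notin> {0..} \<longrightarrow> fc f k = 0" and k: "k \<ge> 1"
    have "fc f (- int k) = 0" using * k by auto
    then show "(LINT z|circ. f z * z ^ k) = 0" by (simp add: fc_def)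
  qed
  then show ?thesis by (auto simp: Hinf_def HA_def)
qed

section \<open>Averages over roots of unity and Fejer means\<close>

lemma integral_circ_rot:
  fixes f :: "complex \<Rightarrow> 'b::{banach, second_countable_topology}"
  assumes "cmod w = 1" "f \<in> borel_measurable circ"
  shows "(LINT z|circ. f (w * z)) = (LINT z|circ. f z)"
proof -
  have "(LINT z|distr circ borel (\<lambda>z. w * z). f z) = (LINT z|circ. f (w * z))"
    using assms(2) by (intro integral_distr) auto
  then show ?thesis by (simp add: distr_circ_mult[OF assms(1)])
qed

lemma measurable_rot:
  "f \<in> borel_measurable circ \<Longrightarrow> (\<lambda>z. f (w * z)) \<in> borel_measurable circ"
  by (rule measurable_compose[of "\<lambda>z. w * z" _ borel]) auto

lemma integrable_circ_rot:
  fixes f :: "complex \<Rightarrow> 'b::{banach, second_countable_topology}"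
  assumes "cmod w = 1" "integrable circ f"
  shows "integrable circ (\<lambda>z. f (w * z))"
proof -
  have "integrable (distr circ borel (\<lambda>z. w * z)) f" by (simp add: distr_circ_mult[OF assms(1)] assms(2))
  then show ?thesis by (rule integrable_distr[rotated]) simp
qed

lemma AE_circ_rot:
  assumes "cmod w = 1" "AE z in circ. P z" shows "AE z in circ. P (w * z)"
proof -
  have "AE z in distr circ borel (\<lambda>z. w * z). P z" unfolding distr_circ_mult[OF assms(1)] by (rule assms(2))
  then show ?thesis using AE_distrD[where f = "\<lambda>z. w * z" and M = circ and M' = borel and P = P] by simp
qed

lemma fc_rot:
  assumes w: "cmod w = 1" and [measurable]: "f \<in> borel_measurable circ"
  shows "fc (\<lambda>z. f (w * z)) k = w powi k * fc f k"
proof -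
  have "w \<noteq> 0" using w by auto
  then have w': "w powi k * w powi (-k) = 1" by (simp add: power_int_minus)
  have "fc (\<lambda>z. f (w * z)) k = (LINT z|circ. w powi k * (f (w * z) * (w * z) powi (-k)))"
    unfolding fc_def by (rule Bochner_Integration.integral_cong[OF refl])
      (simp add: power_int_mult_distrib mult.left_commute[of "w powi k"] mult.assoc[symmetric] w' del: power_int_minus)
  also have "\<dots> = w powi k * (LINT z|circ. f (w * z) * (w * z) powi (-k))" by simp
  also have "(LINT z|circ. f (w * z) * (w * z) powi (-k)) = fc f k"
    unfolding fc_def by (rule integral_circ_rot[OF w]) measurable
  finally show ?thesis .
qed

lemma Linf_rot: "cmod w = 1 \<Longrightarrow> f \<in> Linf \<Longrightarrow> (\<lambda>z. f (w * z)) \<in> Linf"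
proof -
  assume w: "cmod w = 1" and f: "f \<in> Linf"
  then obtain C where "AE z in circ. cmod (f z) \<le> C" using LinfD(2) by blast
  from AE_circ_rot[OF w this] have "AE z in circ. cmod (f (w * z)) \<le> C" .
  moreover have "(\<lambda>z. f (w * z)) \<in> borel_measurable circ" using LinfD(1)[OF f] by measurable
  ultimately show ?thesis unfolding Linf_def by blast
qed

definition om :: "nat \<Rightarrow> complex" where "om n = cis (2 * pi / real n)"

lemma om_norm [simp]: "cmod (om n) = 1" by (simp add: om_def)

lemma om_norm_power [simp]: "cmod (om n ^ j) = 1" by (simp add: norm_power)

lemma om_power_n: "n \<ge> 1 \<Longrightarrow> om n ^ n = 1"
proof -
  assume "n \<ge> 1"
  then have "real n * (2 * pi / real n) = 2 * pi" by simp
  then show ?thesis using cis_power_int[of "2 * pi / real n" "int n"] by (simp only: om_def of_int_of_nat_eq power_int_of_nat cis_2pi)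
qed

lemma om_powi_eq_1_iff:
  assumes "n \<ge> 1" shows "om n powi k = 1 \<longleftrightarrow> int n dvd k"
proof -
  have "om n powi k = 1 \<longleftrightarrow> cos (of_int k * (2 * pi / real n)) = 1"
  proof
    assume "om n powi k = 1"
    then have "Re (cis (of_int k * (2 * pi / real n))) = 1" by (simp add: om_def cis_power_int)
    then show "cos (of_int k * (2 * pi / real n)) = 1" by simp
  next
    assume c: "cos (of_int k * (2 * pi / real n)) = 1"
    then have "sin (of_int k * (2 * pi / real n)) = 0" using sin_cos_squared_add[of "of_int k * (2 * pi / real n)"] by simp
    then show "om n powi k = 1" using c by (simp add: om_def cis_power_int complex_eq_iff)
  qed
  also have "\<dots> \<longleftrightarrow> (\<exists>m::int. of_int k * (2 * pi / real n) = of_int m * 2 * pi)"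
    by (simp add: cos_one_2pi_int)
  also have "\<dots> \<longleftrightarrow> (\<exists>m::int. real_of_int k = real_of_int (m * int n))"
    using assms by (intro ex_cong1) (auto simp: field_simps)
  also have "\<dots> \<longleftrightarrow> int n dvd k" unfolding of_int_eq_iff by (auto simp: dvd_def mult.commute)
  finally show ?thesis .
qed

lemma om_sum:
  assumes "n \<ge> 1"
  shows "(\<Sum>j<n. (om n powi k) ^ j) = (if int n dvd k then of_nat n else 0)"
proof (cases "int n dvd k")
  case True
  then show ?thesis using om_powi_eq_1_iff[OF assms, of k] by simp
next
  case False
  then have "om n powi k \<noteq> 1" using om_powi_eq_1_iff[OF assms] by simp
  moreover have "(om n powi k) ^ n = 1"
    using om_powi_eq_1_iff[OF assms, of "k * int n"] by (simp add: power_int_mult)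
  ultimately show ?thesis using False by (simp add: sum_gp_strict)
qed

text \<open>The conditional expectation onto functions of \<open>z^n\<close>: by
  \<open>fc_avg\<close> it keeps the frequencies divisible by \<open>n\<close> and removes the
  others. Applied to \<open>f\<close> times the conjugate of \<open>g\<close> it is, up to the
  factor \<open>1 / n\<close>, the inner product of their values on an orbit.\<close>

definition avg :: "nat \<Rightarrow> (complex \<Rightarrow> complex) \<Rightarrow> complex \<Rightarrow> complex" where
  "avg n f z = (\<Sum>j<n. f (om n ^ j * z)) / of_nat n"

lemma avg_meas [measurable]: "f \<in> borel_measurable circ \<Longrightarrow> avg n f \<in> borel_measurable circ"
  unfolding avg_def by (rule borel_measurable_divide, rule borel_measurable_sum, erule measurable_rot) simp

lemma avg_integrable: "integrable circ f \<Longrightarrow> integrable circ (avg n f)"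
  unfolding avg_def by (intro integrable_divide Bochner_Integration.integrable_sum integrable_circ_rot) auto

lemma fc_avg:
  assumes n: "n \<ge> 1" and f: "integrable circ f"
  shows "fc (avg n f) k = (if int n dvd k then fc f k else 0)"
proof -
  have [measurable]: "f \<in> borel_measurable circ" using f by auto
  have "fc (avg n f) k = (\<Sum>j<n. fc (\<lambda>z. f (om n ^ j * z)) k) / of_nat n"
    unfolding avg_def fc_divide by (subst fc_sum) (auto intro!: integrable_circ_rot f)
  also have "\<dots> = (\<Sum>j<n. (om n powi k) ^ j * fc f k) / of_nat n"
  proof -
    have "(om n ^ j) powi k = (om n powi k) ^ j" for j
      by (metis mult.commute power_int_mult power_int_of_nat)
    moreover have "fc (\<lambda>z. f (om n ^ j * z)) k = (om n ^ j) powi k * fc f k" for j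
      by (rule fc_rot) auto
    ultimately show ?thesis by simp
  qed
  also have "\<dots> = (if int n dvd k then fc f k else 0)"
    unfolding sum_distrib_right[symmetric] om_sum[OF n] using n by simp
  finally show ?thesis .
qed

lemma AE_avg_all:
  assumes "AE z in circ. P z" shows "AE z in circ. \<forall>j. P (om n ^ j * z)"
  by (subst AE_all_countable) (auto intro: AE_circ_rot assms)

lemma avg_bound:
  assumes n: "n \<ge> 1" and "AE z in circ. cmod (f z) \<le> C" shows "AE z in circ. cmod (avg n f z) \<le> C"
  using AE_avg_all[OF assms(2), of n]
proof eventually_elim
  case (elim z)
  have "cmod (\<Sum>j<n. f (om n ^ j * z)) \<le> (\<Sum>j<n. C)" using elim by (intro sum_norm_le) auto
  then show ?case using n by (simp add: avg_def norm_divide field_simps)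
qed

lemma avg_Linf: "n \<ge> 1 \<Longrightarrow> f \<in> Linf \<Longrightarrow> avg n f \<in> Linf"
  using avg_bound[of n f] avg_meas[of f n] unfolding Linf_def by blast

lemma inv_all:
  assumes "AE z in circ. h (om n * z) = h z" shows "AE z in circ. \<forall>j. h (om n ^ j * z) = h z"
  using AE_avg_all[OF assms, of n]
proof eventually_elim
  case (elim z)
  have "h (om n ^ j * z) = h z" for j
  proof (induction j)
    case (Suc j) then show ?case using elim[rule_format, of j] by (simp add: mult.assoc)
  qed simp
  then show ?case by blast
qed

lemma avg_mult_inv:
  assumes "AE z in circ. h (om n * z) = h z"
  shows "AE z in circ. avg n (\<lambda>z. h z * f z) z = h z * avg n f z"
  using inv_all[OF assms] by eventually_elim (simp add: avg_def sum_distrib_left)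

lemma avg_inv:
  assumes n: "n \<ge> 1" shows "avg n f (om n * z) = avg n f z"
proof -
  have "(\<Sum>j<n. f (om n ^ j * (om n * z))) = (\<Sum>j<n. f (om n ^ Suc j * z))"
    by (simp add: mult_ac)
  also have "\<dots> = (\<Sum>j<Suc n. f (om n ^ j * z)) - f z" by (subst sum.lessThan_Suc_shift) simp
  also have "\<dots> = (\<Sum>j<n. f (om n ^ j * z))" using om_power_n[OF n] by simp
  finally show ?thesis by (simp add: avg_def)
qed

text \<open>Rotation by \<open>om n\<close> multiplies the coefficient at \<open>k\<close> by
  \<open>om n powi k\<close>, which is 1 exactly for multiples of \<open>n\<close>; uniqueness of
  coefficients does the rest.\<close>

lemma supp_inv:
  assumes n: "n \<ge> 1" and h: "integrable circ h" and s: "\<And>k. \<not> int n dvd k \<Longrightarrow> fc h k = 0"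
  shows "AE z in circ. h (om n * z) = h z"
proof -
  have [measurable]: "h \<in> borel_measurable circ" using h by auto
  have i: "integrable circ (\<lambda>z. h (om n * z))" by (intro integrable_circ_rot h) simp
  have "AE z in circ. h (om n * z) - h z = 0"
  proof (rule fc_unique)
    fix k
    have "fc (\<lambda>z. h (om n * z)) k = fc h k"
      using s[of k] om_powi_eq_1_iff[OF n, of k] by (cases "int n dvd k") (auto simp: fc_rot)
    then show "fc (\<lambda>z. h (om n * z) - h z) k = 0" by (simp add: fc_diff[OF i h])
  qed (use i h in auto)
  then show ?thesis by auto
qed

lemma inv_fc:
  assumes n: "n \<ge> 1" and [measurable]: "h \<in> borel_measurable circ"
    and i: "AE z in circ. h (om n * z) = h z" and k: "\<not> int n dvd k"
  shows "fc h k = 0"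
proof -
  have "fc (\<lambda>z. h (om n * z)) k = fc h k" by (rule fc_cong_AE[OF _ _ i]) measurable
  then have "om n powi k * fc h k = fc h k" by (simp add: fc_rot)
  then show ?thesis using om_powi_eq_1_iff[OF n, of k] k by simp
qed

text \<open>Up to null sets \<open>HA (nn n)\<close> is \<open>Hinf_zn n\<close>. The work is done
  with the former because membership there is visible on coefficients.\<close>

definition nn :: "nat \<Rightarrow> int set" where "nn n = {k. k \<ge> 0 \<and> int n dvd k}"

lemma nn_add: "a \<in> nn n \<Longrightarrow> b \<in> nn n \<Longrightarrow> a + b \<in> nn n" by (auto simp: nn_def)

lemma nn_0 [simp]: "0 \<in> nn n" by (simp add: nn_def)

lemma HA_nn_inv: "n \<ge> 1 \<Longrightarrow> h \<in> HA (nn n) \<Longrightarrow> AE z in circ. h (om n * z) = h z"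
  by (rule supp_inv) (auto simp: nn_def intro: HA_fc Linf_integrable HA_Linf)

section \<open>Functions of z^n\<close>

lemma integral_circ_power:
  fixes f :: "complex \<Rightarrow> complex"
  assumes "n \<ge> 1" "f \<in> borel_measurable circ"
  shows "(LINT z|circ. f (z ^ n)) = (LINT z|circ. f z)"
proof -
  have "(LINT z|distr circ borel (\<lambda>z. z ^ n). f z) = (LINT z|circ. f (z ^ n))"
    using assms(2) by (intro integral_distr) auto
  then show ?thesis by (simp add: distr_circ_power[OF assms(1)])
qed

lemma fc_power:
  assumes "n \<ge> 1" and [measurable]: "f \<in> borel_measurable circ"
  shows "fc (\<lambda>z. f (z ^ n)) (int n * j) = fc f j"
proof -
  have "fc (\<lambda>z. f (z ^ n)) (int n * j) = (LINT z|circ. (\<lambda>w. f w * w powi (-j)) (z ^ n))"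
  proof -
    have "z powi - (int n * j) = (z ^ n) powi (- j)" for z :: complex
      using power_int_mult[of z "int n" "-j"] by simp
    then show ?thesis by (simp add: fc_def)
  qed
  also have "\<dots> = fc f j" unfolding fc_def by (rule integral_circ_power[OF assms(1)]) measurable
  finally show ?thesis .
qed

lemma Hinf_zn_HA:
  assumes n: "n \<ge> 1" and g: "g \<in> Hinf_zn n" shows "g \<in> HA (nn n)"
proof -
  obtain f where f: "f \<in> HA {0..}" and gf: "g = (\<lambda>z. f (z ^ n))"
    using g by (auto simp: Hinf_zn_def Hinf_eq_HA)
  note [measurable] = LinfD(1)[OF HA_Linf[OF f]]
  obtain C where C: "AE z in circ. cmod (f z) \<le> C" using LinfD(2)[OF HA_Linf[OF f]] by blast
  have "AE z in circ. cmod (f (z ^ n)) \<le> C"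
  proof -
    have "AE z in distr circ borel (\<lambda>z. z ^ n). cmod (f z) \<le> C" unfolding distr_circ_power[OF n] by (rule C)
    then show ?thesis
      using AE_distrD[where f = "\<lambda>z. z ^ n" and M = circ and M' = borel and P = "\<lambda>z. cmod (f z) \<le> C"] by simp
  qed
  then have L: "g \<in> Linf" unfolding Linf_def gf by auto
  have "fc g k = 0" if k: "k \<notin> nn n" for k
  proof (cases "int n dvd k")
    case True
    then obtain j where j: "k = int n * j" by (auto simp: dvd_def)
    then have "j < 0" using k n by (auto simp: nn_def not_le zero_le_mult_iff)
    then show ?thesis using fc_power[OF n, of f j] f unfolding gf j by (auto simp: HA_def)
  next
    case False
    show ?thesis
      by (rule inv_fc[OF n _ _ False]) (auto simp: gf power_mult_distrib om_power_n[OF n])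
  qed
  with L show ?thesis by (auto simp: HA_def)
qed

text \<open>A function of \<open>z^n\<close> has to be produced from vanishing coefficients alone.
  Polynomials approximating \<open>h\<close> are polynomials in \<open>z^n\<close>, and the limit of
  the latter along an almost everywhere convergent subsequence is the required \<open>f\<close>. Its
  bound and its coefficients carry over as \<open>z^n\<close> preserves \<open>circ\<close>.\<close>

lemma HA_nn_Hinf_zn:
  assumes n: "n \<ge> 1" and h: "h \<in> HA (nn n)" shows "\<exists>g\<in>Hinf_zn n. AE z in circ. g z = h z"
proof -
  have hL: "h \<in> L2m circ" using h by (intro Linf_L2m HA_Linf)
  obtain t where t: "\<And>i. t i \<in> trigp (nn n)" "conv2 circ t h"
    using cl2_seq[OF trigp_dense[OF hL HA_fc[OF h]]] by metis
  obtain \<phi> where \<phi>: "AE z in circ. (\<lambda>i. t (\<phi> i) z) \<longlonglongrightarrow> h z"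
    using conv2_AE_subseq[OF trigp_L2m[OF t(1)] hL t(2)] by metis
  have "\<exists>p\<in>trigp {0..}. \<forall>z. u z = p (z ^ n)" if "u \<in> trigp (nn n)" for u
    using that
  proof (induction rule: trigp.induct)
    case zero show ?case by (rule bexI[OF _ trigp.zero]) auto
  next
    case (mono k c)
    then obtain j where j: "k = int n * j" "j \<ge> 0" using n by (auto simp: nn_def dvd_def zero_le_mult_iff)
    then have "(\<lambda>w. c * w powi j) \<in> trigp {0..}" by (intro trigp.mono) simp
    moreover have "c * z powi k = c * (z ^ n) powi j" for z :: complex
      unfolding j power_int_mult by simp
    ultimately show ?case by (intro bexI[of _ "\<lambda>w. c * w powi j"]) auto
  next
    case (add f g)
    then obtain p q where "p \<in> trigp {0..}" "q \<in> trigp {0..}" "\<forall>z. f z = p (z ^ n)" "\<forall>z. g z = q (z ^ n)" by blast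
    then show ?case by (intro bexI[of _ "\<lambda>z. p z + q z"]) (auto intro: trigp.add)
  qed
  from this[OF t(1)] have "\<forall>i. \<exists>p. p \<in> trigp {0..} \<and> (\<forall>z. t i z = p (z ^ n))" by blast
  then obtain p where p: "\<And>i. p i \<in> trigp {0..}" "\<And>i z. t i z = p i (z ^ n)" by (auto dest!: choice)
  have [measurable]: "p i \<in> borel_measurable circ" for i using trigp_meas[OF p(1)] by simp
  define f where "f w = lim (\<lambda>i. p (\<phi> i) w)" for w
  have [measurable]: "f \<in> borel_measurable circ" unfolding f_def by (rule borel_measurable_lim_metric) measurable
  have fh: "AE z in circ. f (z ^ n) = h z"
    using \<phi> by eventually_elim (simp add: f_def p(2) limI)
  obtain C where C: "AE z in circ. cmod (h z) \<le> C" using LinfD(2)[OF HA_Linf[OF h]] by blast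
  have "AE z in circ. cmod (f (z ^ n)) \<le> C" using C fh by eventually_elim simp
  then have "AE z in distr circ borel (\<lambda>z. z ^ n). cmod (f z) \<le> C"
    by (subst AE_distr_iff) auto
  then have "AE z in circ. cmod (f z) \<le> C" unfolding distr_circ_power[OF n] .
  then have "f \<in> Linf" unfolding Linf_def by auto
  moreover have "fc f j = 0" if "j \<notin> {0..}" for j
  proof -
    have "fc f j = fc (\<lambda>z. f (z ^ n)) (int n * j)" by (rule fc_power[OF n, symmetric]) measurable
    also have "\<dots> = fc h (int n * j)" by (rule fc_cong_AE[OF _ _ fh]) (use hL in measurable)
    also have "\<dots> = 0" using that n by (intro HA_fc[OF h]) (auto simp: nn_def zero_le_mult_iff)
    finally show ?thesis .
  qed
  ultimately have "f \<in> Hinf" by (auto simp: Hinf_eq_HA HA_def)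
  then show ?thesis using fh by (auto simp: Hinf_zn_def)
qed

section \<open>Fejer means and weak-star approximation\<close>

lemma trigp_sum: "finite I \<Longrightarrow> (\<And>i. i \<in> I \<Longrightarrow> f i \<in> trigp A) \<Longrightarrow> (\<lambda>z. \<Sum>i\<in>I. f i z) \<in> trigp A"
  by (induction I rule: finite_induct) (auto intro: trigp.zero trigp.add)

text \<open>The Cesaro mean of the partial Fourier sums, \<open>i - l = k\<close> having
  \<open>N - |k|\<close> solutions for \<open>|k| <= N\<close>. The double sum exhibits the kernel
  as the square of a modulus, from which its positivity is read off.\<close>

definition fejer :: "nat \<Rightarrow> (complex \<Rightarrow> complex) \<Rightarrow> complex \<Rightarrow> complex" where
  "fejer N f z = (\<Sum>i<N. \<Sum>l<N. fc f (int i - int l) / of_nat N * z powi (int i - int l))"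

lemma fejer_trigp:
  assumes "\<And>k. k \<notin> A \<Longrightarrow> fc f k = 0" shows "fejer N f \<in> trigp A"
proof -
  have "(\<lambda>z. fc f k / of_nat N * z powi k) \<in> trigp A" for k
  proof (cases "k \<in> A")
    case False
    then show ?thesis using assms[of k] trigp.zero[of A] by simp
  qed (rule trigp.mono)
  then show ?thesis unfolding fejer_def by (intro trigp_sum) auto
qed

text \<open>\<open>N\<close> times the mean is the integral of \<open>f\<close> against
  \<open>|D|^2\<close>, where \<open>D\<close> is a sum of \<open>N\<close> orthonormal monomials
  with unimodular factors. This positive kernel has total mass \<open>N\<close>, so the bound on
  \<open>f\<close> is not enlarged.\<close>

lemma fejer_bound:
  assumes f [measurable]: "f \<in> borel_measurable circ" and C: "AE z in circ. cmod (f z) \<le> C"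
    and z: "cmod z = 1" and N: "N \<ge> 1"
  shows "cmod (fejer N f z) \<le> C"
proof -
  have z0: "z \<noteq> 0" using z by auto
  have fi: "integrable circ f" using circ.L2m_bounded[OF f C] by (rule circ.L2m_integrable)
  define D where "D w = (\<Sum>i<N. z powi int i * w powi (- int i))" for w
  have Dm [measurable]: "D \<in> borel_measurable circ" unfolding D_def by measurable
  have DD: "D w * cnj (D w) = (\<Sum>i<N. \<Sum>l<N. z powi (int i - int l) * w powi (- (int i - int l)))"
    if w: "cmod w = 1" for w
  proof -
    have "w \<noteq> 0" using w by auto
    have "cnj (D w) = (\<Sum>l<N. z powi (- int l) * w powi (int l))"
      using cnj_powi[OF z] cnj_powi[OF w, of "- int _"]
      unfolding D_def cnj_sum complex_cnj_mult by (simp del: complex_cnj_power_int power_int_of_nat power_int_minus complex_cnj_power)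
    then have "D w * cnj (D w) = (\<Sum>i<N. \<Sum>l<N. (z powi int i * w powi (- int i)) * (z powi (- int l) * w powi (int l)))"
      unfolding D_def by (simp only: sum_product)
    also have "\<dots> = (\<Sum>i<N. \<Sum>l<N. z powi (int i + - int l) * w powi (- int i + int l))"
      using z0 \<open>w \<noteq> 0\<close> by (intro sum.cong refl) (simp only: power_int_add simp_thms mult_ac)
    finally show ?thesis by (simp add: algebra_simps)
  qed
  have int1: "(LINT w|circ. f w * (D w * cnj (D w))) = of_nat N * fejer N f z"
  proof -
    have "(LINT w|circ. f w * (D w * cnj (D w))) =
        (LINT w|circ. (\<Sum>i<N. \<Sum>l<N. z powi (int i - int l) * (f w * w powi (- (int i - int l)))))"
    proof (rule integral_cong_AE)
      show "AE w in circ. f w * (D w * cnj (D w)) = (\<Sum>i<N. \<Sum>l<N. z powi (int i - int l) * (f w * w powi (- (int i - int l))))"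
        using AE_circ
      proof eventually_elim
        case (elim w)
        show ?case unfolding DD[OF elim] by (simp add: sum_distrib_left mult_ac)
      qed
    qed measurable
    also have "\<dots> = (\<Sum>i<N. \<Sum>l<N. z powi (int i - int l) * fc f (int i - int l))"
      using integrable_mult_powi[OF fi]
      by (subst Bochner_Integration.integral_sum | intro Bochner_Integration.integrable_sum integrable_mult_right | simp add: fc_def)+
    also have "\<dots> = of_nat N * fejer N f z"
      using N by (simp add: fejer_def sum_distrib_left mult_ac)
    finally show ?thesis .
  qed
  have Db: "D \<in> L2m circ"
  proof -
    have "(\<lambda>w. z powi int i * w powi (- int i)) \<in> L2m circ" for i by (intro L2m_scale powi_L2m)
    then show ?thesis unfolding D_def by (intro L2m_sum)
  qed
  have int2: "sqn circ D = real N"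
  proof -
    have "complex_of_real (sqn circ D) = (LINT w|circ. D w * cnj (D w))" using sqn_eq_inner[OF Db] by simp
    also have "\<dots> = (LINT w|circ. (\<Sum>i<N. \<Sum>l<N. z powi (int i - int l) * (w powi (- (int i - int l)))))"
    proof (rule integral_cong_AE)
      show "AE w in circ. D w * cnj (D w) = (\<Sum>i<N. \<Sum>l<N. z powi (int i - int l) * (w powi (- (int i - int l))))"
        using AE_circ by eventually_elim (rule DD)
    qed measurable
    also have "\<dots> = (\<Sum>i<N. \<Sum>l<N. z powi (int i - int l) * (if i = l then 1 else 0))"
    proof -
      have *: "(LINT w|circ. w powi (- (int i - int l))) = (if i = l then 1 else 0)" for i l
        using integral_circ_powi[of "- (int i - int l)"] by simp
      have i: "integrable circ (\<lambda>w. w powi k)" for k by (rule circ.L2m_integrable[OF powi_L2m])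
      show ?thesis unfolding *[symmetric] 
        by (subst Bochner_Integration.integral_sum | intro Bochner_Integration.integrable_sum integrable_mult_right i | simp)+
    qed
    also have "\<dots> = of_nat N" by (simp add: if_distrib[of "\<lambda>x. _ * x"] cong: if_cong)
    finally show ?thesis by (metis of_real_eq_iff of_real_of_nat_eq)
  qed
  have "real N * cmod (fejer N f z) = cmod (LINT w|circ. f w * (D w * cnj (D w)))"
    unfolding int1 by (simp add: norm_mult)
  also have "\<dots> \<le> (LINT w|circ. cmod (f w * (D w * cnj (D w))))" by (rule integral_norm_bound)
  also have "\<dots> \<le> (LINT w|circ. C * (cmod (D w))\<^sup>2)"
  proof (rule integral_mono_AE)
    show "integrable circ (\<lambda>w. C * (cmod (D w))\<^sup>2)" using L2m_int[OF Db] by simp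
    have "(\<lambda>w. f w * D w) \<in> L2m circ" by (rule L2m_bounded_mult(1)[OF Db f C])
    from L2m_mult_integrable[OF this L2m_cnj[OF Db]]
    show "integrable circ (\<lambda>w. cmod (f w * (D w * cnj (D w))))" by (simp add: mult.assoc)
    show "AE w in circ. cmod (f w * (D w * cnj (D w))) \<le> C * (cmod (D w))\<^sup>2"
      using C by eventually_elim (auto simp: norm_mult power2_eq_square intro: mult_right_mono)
  qed
  also have "\<dots> = C * real N" using int2 by (simp add: sqn_def)
  finally show ?thesis using N by (simp add: field_simps)
qed

lemma fc_fejer: "N \<ge> nat \<bar>k\<bar> \<Longrightarrow> fc (fejer N f) k = fc f k * (of_nat (N - nat \<bar>k\<bar>) / of_nat N)"
proof -
  assume N: "N \<ge> nat \<bar>k\<bar>"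
  have i: "integrable circ (\<lambda>w. c * w powi k)" for k c by (intro integrable_mult_right circ.L2m_integrable[OF powi_L2m])
  have "fc (fejer N f) k = (\<Sum>i<N. \<Sum>l<N. fc f (int i - int l) / of_nat N * (if int i - int l = k then 1 else 0))"
  proof -
    have "fc (fejer N f) k = (\<Sum>i<N. fc (\<lambda>z. \<Sum>l<N. fc f (int i - int l) / of_nat N * z powi (int i - int l)) k)"
      unfolding fejer_def by (rule fc_sum) (auto intro!: Bochner_Integration.integrable_sum i)
    also have "\<dots> = (\<Sum>i<N. \<Sum>l<N. fc (\<lambda>z. fc f (int i - int l) / of_nat N * z powi (int i - int l)) k)"
      by (intro sum.cong refl fc_sum i) auto
    finally show ?thesis unfolding fc_scale fc_powi .
  qed
  also have "\<dots> = (\<Sum>i<N. \<Sum>l<N. if int l = int i - k then fc f k / of_nat N else 0)"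
    by (intro sum.cong refl) auto
  also have "\<dots> = (\<Sum>i<N. if 0 \<le> int i - k \<and> int i - k < int N then fc f k / of_nat N else 0)"
  proof (rule sum.cong[OF refl])
    fix i
    show "(\<Sum>l<N. if int l = int i - k then fc f k / of_nat N else 0) =
      (if 0 \<le> int i - k \<and> int i - k < int N then fc f k / of_nat N else 0)"
    proof (cases "0 \<le> int i - k \<and> int i - k < int N")
      case True
      then have "(\<Sum>l<N. if int l = int i - k then fc f k / of_nat N else 0) =
        (\<Sum>l<N. if l = nat (int i - k) then fc f k / of_nat N else 0)" by (intro sum.cong refl) auto
      also have "\<dots> = fc f k / of_nat N" using True by (subst sum.delta) auto
      finally show ?thesis using True by simp
    next
      case False
      then have "(\<Sum>l<N. if int l = int i - k then fc f k / of_nat N else 0) = (\<Sum>l<N. 0)"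
        by (intro sum.cong refl) auto
      then show ?thesis using False by auto
    qed
  qed
  also have "\<dots> = of_nat (card {i\<in>{..<N}. 0 \<le> int i - k \<and> int i - k < int N}) * (fc f k / of_nat N)"
    by (subst sum.inter_filter[symmetric]) auto
  also have "{i\<in>{..<N}. 0 \<le> int i - k \<and> int i - k < int N} = {nat k..<nat (min (int N) (int N + k))}"
    by auto
  also have "card \<dots> = N - nat \<bar>k\<bar>" using N by (cases "k \<ge> 0") (auto simp: min_def nat_add_distrib)
  finally show ?thesis by simp
qed

lemma fc_fejer_tendsto: "(\<lambda>N. fc (fejer N f) k) \<longlonglongrightarrow> fc f k"
proof -
  have "(\<lambda>N. fc f k * (1 - complex_of_real (real (nat \<bar>k\<bar>) / real N))) \<longlonglongrightarrow> fc f k * (1 - complex_of_real 0)"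
    by (intro tendsto_intros lim_const_over_n[where 'a = real])
  moreover have "\<forall>\<^sub>F N in sequentially. fc f k * (1 - complex_of_real (real (nat \<bar>k\<bar>) / real N)) = fc (fejer N f) k"
    using eventually_ge_at_top[of "Suc (nat \<bar>k\<bar>)"]
  proof eventually_elim
    case (elim N)
    define m where "m = nat \<bar>k\<bar>"
    have "of_nat (N - m) / of_nat N = 1 - complex_of_real (real m / real N)"
      using elim by (simp add: m_def[symmetric] of_nat_diff diff_divide_distrib)
    then show ?case using elim by (subst fc_fejer) (auto simp: m_def)
  qed
  ultimately show ?thesis by (simp add: tendsto_cong)
qed

lemma trigp_dense_L1:
  assumes g: "integrable circ g" and e: "e > 0"
  shows "\<exists>t\<in>trigp UNIV. (LINT z|circ. cmod (g z - t z)) < e"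
proof -
  have [measurable]: "g \<in> borel_measurable circ" using g by auto
  define u where "u m z = (if cmod (g z) \<le> real m then g z else 0)" for m z
  have [measurable]: "u m \<in> borel_measurable circ" for m unfolding u_def by measurable
  have "(\<lambda>m. LINT z|circ. cmod (g z - u m z)) \<longlonglongrightarrow> (LINT z|circ. 0)"
  proof (rule integral_dominated_convergence[where w = "\<lambda>z. cmod (g z)"])
    show "AE z in circ. (\<lambda>m. cmod (g z - u m z)) \<longlonglongrightarrow> 0"
    proof (rule AE_I2)
      fix z
      obtain m0 where m0: "cmod (g z) \<le> real m0" using real_arch_simple by blast
      have "\<forall>\<^sub>F m in sequentially. cmod (g z - u m z) = 0"
        using eventually_ge_at_top[of m0]
      proof eventually_elim
        case (elim m)
        then have "cmod (g z) \<le> real m" using m0 by linarith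
        then show ?case by (simp add: u_def)
      qed
      then show "(\<lambda>m. cmod (g z - u m z)) \<longlonglongrightarrow> 0" by (rule tendsto_eventually)
    qed
    show "AE z in circ. norm (cmod (g z - u m z)) \<le> cmod (g z)" for m by (auto simp: u_def)
  qed (use g in auto)
  then have "(\<lambda>m. LINT z|circ. cmod (g z - u m z)) \<longlonglongrightarrow> 0" by simp
  from LIMSEQ_D[OF this, of "e/2"] e obtain m where m: "(LINT z|circ. cmod (g z - u m z)) < e / 2" by force
  have uL: "u m \<in> L2m circ" by (rule circ.L2m_bounded[of _ "real m"]) (auto simp: u_def)
  have "u m \<in> cl2 circ (trigp UNIV)" by (rule trigp_dense[OF uL]) auto
  moreover have "(e/2)\<^sup>2 > 0" using e by simp
  ultimately obtain t where t: "t \<in> trigp UNIV" "sqn circ (\<lambda>z. u m z - t z) < (e/2)\<^sup>2" unfolding cl2_def by blast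
  have tL: "t \<in> L2m circ" using t(1) by (rule trigp_L2m)
  have "(LINT z|circ. cmod (u m z - t z)) \<le> sqrt (sqn circ (\<lambda>z. u m z - t z))"
    using circ.L2m_L1_le[OF L2m_diff[OF uL tL]] by simp
  also have "\<dots> < e / 2" using t(2) e by (intro real_less_lsqrt) (auto simp: sqn_nonneg)
  finally have "(LINT z|circ. cmod (u m z - t z)) < e / 2" .
  moreover have "(LINT z|circ. cmod (g z - t z)) \<le> (LINT z|circ. cmod (g z - u m z) + cmod (u m z - t z))"
    using g circ.L2m_integrable[OF uL] circ.L2m_integrable[OF tL]
    by (intro integral_mono) (auto intro: norm_diff_triangle_le)
  moreover have "\<dots> = (LINT z|circ. cmod (g z - u m z)) + (LINT z|circ. cmod (u m z - t z))"
    using g circ.L2m_integrable[OF uL] circ.L2m_integrable[OF tL] by (intro Bochner_Integration.integral_add) auto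
  ultimately show ?thesis using m t(1) by (intro bexI[of _ t]) linarith
qed

text \<open>On monomials the claim is convergence of coefficients. As the differences are bounded by
  \<open>2 * C\<close>, an integrable test function may be replaced by a trigonometric polynomial at
  the cost of \<open>2 * C\<close> times the L1 error.\<close>

lemma fejer_weak_tendsto:
  assumes f: "f \<in> Linf" and g: "integrable circ g"
  shows "(\<lambda>N. LINT z|circ. (f z - fejer N f z) * g z) \<longlonglongrightarrow> 0"
proof (rule LIMSEQ_I)
  fix e :: real assume e: "e > 0"
  obtain C where C: "C > 0" "AE z in circ. cmod (f z) \<le> C" using LinfE[OF f] by blast
  have fejL: "fejer N f \<in> Linf" for N using trigp_HA[OF fejer_trigp[of UNIV f N]] HA_Linf by blast
  have dL: "(\<lambda>z. f z - fejer N f z) \<in> Linf" for N by (intro Linf_diff f fejL)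
  have b: "AE z in circ. cmod (f z - fejer N f z) \<le> 2 * C" if "N \<ge> 1" for N
    using C(2) AE_circ
  proof eventually_elim
    case (elim z)
    have "cmod (fejer N f z) \<le> C" using fejer_bound[OF LinfD(1)[OF f] C(2) elim(2) that] .
    then show ?case using elim(1) norm_triangle_ineq4[of "f z" "fejer N f z"] by linarith
  qed
  have lim: "(\<lambda>N. LINT z|circ. (f z - fejer N f z) * t z) \<longlonglongrightarrow> 0" if "t \<in> trigp UNIV" for t
    using that
  proof (induction rule: trigp.induct)
    case (mono k c)
    have eq: "(LINT z|circ. (f z - fejer N f z) * (c * z powi k)) = c * (fc f (-k) - fc (fejer N f) (-k))" for N
    proof -
      have "(LINT z|circ. (f z - fejer N f z) * (c * z powi k)) = c * fc (\<lambda>z. f z - fejer N f z) (-k)"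
        by (simp add: fc_def mult.left_commute[of _ c])
      then show ?thesis by (simp add: fc_diff Linf_integrable f fejL)
    qed
    have "(\<lambda>N. c * (fc f (-k) - fc (fejer N f) (-k))) \<longlonglongrightarrow> c * (fc f (-k) - fc f (-k))"
      by (intro tendsto_intros fc_fejer_tendsto)
    then show ?case unfolding eq by simp
  next
    case (add t u)
    have "(LINT z|circ. (f z - fejer N f z) * (t z + u z)) = 
      (LINT z|circ. (f z - fejer N f z) * t z) + (LINT z|circ. (f z - fejer N f z) * u z)" for N
      using L2m_mult_integrable[OF Linf_L2m[OF dL] trigp_L2m[OF add(1)]]
        L2m_mult_integrable[OF Linf_L2m[OF dL] trigp_L2m[OF add(2)]] by (simp add: distrib_left)
    then show ?case using tendsto_add[OF add(3,4)] by simp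
  qed simp
  have "e / (4 * C) > 0" using e C by simp
  then obtain t where t: "t \<in> trigp UNIV" "(LINT z|circ. cmod (g z - t z)) < e / (4 * C)"
    using trigp_dense_L1[OF g] by blast
  have ti: "integrable circ t" by (rule circ.L2m_integrable[OF trigp_L2m[OF t(1)]])
  obtain N0 where N0: "\<And>N. N \<ge> N0 \<Longrightarrow> cmod (LINT z|circ. (f z - fejer N f z) * t z) < e / 2"
    using LIMSEQ_D[OF lim[OF t(1)], of "e/2"] e by auto
  show "\<exists>no. \<forall>N\<ge>no. norm ((LINT z|circ. (f z - fejer N f z) * g z) - 0) < e"
  proof (intro exI allI impI)
    fix N assume N: "N \<ge> max N0 1"
    have [measurable]: "(\<lambda>z. f z - fejer N f z) \<in> borel_measurable circ" using LinfD(1)[OF dL] .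
    have [measurable]: "g \<in> borel_measurable circ" "t \<in> borel_measurable circ" using g ti by auto
    have ie: "integrable circ (\<lambda>z. (f z - fejer N f z) * u z)" if u: "integrable circ u" for u
    proof (rule Bochner_Integration.integrable_bound[of _ "\<lambda>z. 2 * C * cmod (u z)"])
      have [measurable]: "u \<in> borel_measurable circ" using u by auto
      show "(\<lambda>z. (f z - fejer N f z) * u z) \<in> borel_measurable circ" by measurable
      show "AE z in circ. norm ((f z - fejer N f z) * u z) \<le> norm (2 * C * cmod (u z))"
        using b[of N] N C(1) by (auto simp: norm_mult elim!: eventually_mono intro!: mult_right_mono)
    qed (use u in auto)
    have igt: "integrable circ (\<lambda>z. g z - t z)" using g ti by simp
    have "(LINT z|circ. (f z - fejer N f z) * g z) =
      (LINT z|circ. (f z - fejer N f z) * t z) + (LINT z|circ. (f z - fejer N f z) * (g z - t z))"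
      using ie[OF ti] ie[OF igt] by (subst Bochner_Integration.integral_add[symmetric]) (auto simp: algebra_simps)
    moreover have "cmod (LINT z|circ. (f z - fejer N f z) * (g z - t z)) \<le> e / 2"
    proof -
      have "cmod (LINT z|circ. (f z - fejer N f z) * (g z - t z)) \<le> (LINT z|circ. cmod ((f z - fejer N f z) * (g z - t z)))"
        by (rule integral_norm_bound)
      also have "\<dots> \<le> (LINT z|circ. 2 * C * cmod (g z - t z))"
      proof (rule integral_mono_AE)
        show "AE z in circ. cmod ((f z - fejer N f z) * (g z - t z)) \<le> 2 * C * cmod (g z - t z)"
          using b[of N] N by (auto simp: norm_mult elim!: eventually_mono intro!: mult_right_mono)
      qed (use ie[OF igt] igt in auto)
      also have "\<dots> = 2 * C * (LINT z|circ. cmod (g z - t z))" by simp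
      also have "\<dots> \<le> 2 * C * (e / (4 * C))" using t(2) C(1) by (intro mult_left_mono) auto
      also have "\<dots> = e / 2" using C(1) by (simp add: field_simps)
      finally show ?thesis .
    qed
    moreover have "cmod (LINT z|circ. (f z - fejer N f z) * t z) < e / 2" using N0 N by auto
    ultimately show "norm ((LINT z|circ. (f z - fejer N f z) * g z) - 0) < e"
      by (smt (verit) norm_triangle_ineq field_sum_of_halves diff_zero)
  qed
qed

text \<open>Multiplication by \<open>z^(2n)\<close> moves every frequency of \<open>a\<close> past
  the missing frequency \<open>n\<close>. The Fejer means of \<open>a\<close>, so multiplied, lie in
  the span, and they converge weak-star because the factor can be absorbed into the test
  function.\<close>

lemma Hinf1_zn_shift:
  assumes n: "n \<ge> 1" and a: "a \<in> HA (nn n)"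
  shows "(\<lambda>z. z ^ (2 * n) * a z) \<in> Hinf1_zn n"
proof -
  have H: "(\<lambda>z. z ^ (2 * n) * a z) \<in> Hinf"
    using HA_mult[OF HA_powi[of "int (2*n)" "{0..}"] a, of "{0..}"] unfolding power_int_of_nat
    by (auto simp: Hinf_eq_HA nn_def)
  have sp: "(\<lambda>z. z ^ (2 * n) * t z) \<in> span_1_z2n n" if "t \<in> trigp (nn n)" for t
    using that
  proof (induction rule: trigp.induct)
    case zero
    show ?case unfolding span_1_z2n_def by (intro CollectI exI[of _ "\<lambda>_. 0"]) auto
  next
    case (mono k c)
    then obtain j where j: "k = int n * int j" using n by (auto simp: nn_def dvd_def zero_le_mult_iff) (metis nonneg_int_cases)
    \<comment> \<open>A monomial of frequency \<open>n * j\<close> becomes the term with index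
      \<open>j + 2\<close>, which is also the upper limit of the sum; the other coefficients,
      including the constant one, are 0.\<close>
    have "z ^ (2 * n) * (c * z powi k) = (\<Sum>i\<in>{2..j+2}. (if i = j + 2 then c else 0) * z ^ (i * n))" for z :: complex
    proof -
      have "(\<Sum>i\<in>{2..j+2}. (if i = j + 2 then c else 0) * z ^ (i * n)) = c * z ^ ((j + 2) * n)"
        by (subst sum.cong[OF refl, of _ _ "\<lambda>i. if i = j + 2 then c * z ^ (i * n) else 0"]) auto
      moreover have "z powi k = z ^ (n * j)" unfolding j by (metis of_nat_mult power_int_of_nat)
      moreover have "z ^ ((j + 2) * n) = z ^ (2 * n) * z ^ (n * j)"
        unfolding power_add[symmetric] by (rule arg_cong[where f = "power z"]) (simp add: algebra_simps)
      ultimately show ?thesis by simp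
    qed
    then show ?case unfolding span_1_z2n_def
      by (intro CollectI exI[of _ "\<lambda>i. if i = j + 2 then c else 0"] exI[of _ "j + 2"]) auto
  next
    case (add t u)
    then obtain c d N K where t: "(\<lambda>z. z ^ (2 * n) * t z) = (\<lambda>z. c 0 + (\<Sum>j\<in>{2..N}. c j * z ^ (j * n)))"
      and u: "(\<lambda>z. z ^ (2 * n) * u z) = (\<lambda>z. d 0 + (\<Sum>j\<in>{2..K}. d j * z ^ (j * n)))"
      unfolding span_1_z2n_def by auto
    let ?c = "\<lambda>j. (if j \<le> N then c j else 0) + (if j \<le> K then d j else 0)"
    have ext: "(\<Sum>j\<in>{2..N}. c j * z ^ (j * n)) = (\<Sum>j\<in>{2..max N K}. (if j \<le> N then c j else 0) * z ^ (j * n))"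
      for c :: "nat \<Rightarrow> complex" and N K z
      by (intro sum.mono_neutral_cong_left) auto
    have "z ^ (2 * n) * (t z + u z) = ?c 0 + (\<Sum>j\<in>{2..max N K}. ?c j * z ^ (j * n))" for z
      using fun_cong[OF t, of z] fun_cong[OF u, of z] ext[of c z N K] ext[of d z K N]
      by (simp add: distrib_left distrib_right sum.distrib max.commute)
    then show ?case unfolding span_1_z2n_def by (intro CollectI exI[of _ ?c] exI[of _ "max N K"]) auto
  qed
  have "\<exists>s\<in>span_1_z2n n. \<forall>g\<in>G. cmod (LINT z|circ. (z ^ (2 * n) * a z - s z) * g z) < e"
    if G: "finite G" "G \<subseteq> L1" and e: "e > 0" for G e
  proof -
    have ev: "\<forall>\<^sub>F N in sequentially. cmod (LINT z|circ. (a z - fejer N a z) * (z ^ (2 * n) * g z)) < e" if "g \<in> G" for g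
    proof -
      have "integrable circ (\<lambda>z. z ^ (2 * n) * g z)"
        using integrable_mult_powi[of g "int (2 * n)"] that G(2) unfolding power_int_of_nat
        by (auto simp: L1_def mult.commute)
      from tendsto_norm[OF fejer_weak_tendsto[OF HA_Linf[OF a] this]]
      show ?thesis using e by (simp add: order_tendstoD(2))
    qed
    have "\<forall>\<^sub>F N in sequentially. \<forall>g\<in>G. cmod (LINT z|circ. (a z - fejer N a z) * (z ^ (2 * n) * g z)) < e"
      using ev G(1) by (simp add: eventually_ball_finite)
    then obtain N where N: "\<forall>g\<in>G. cmod (LINT z|circ. (a z - fejer N a z) * (z ^ (2 * n) * g z)) < e"
      by (auto simp: eventually_sequentially)
    have "(\<lambda>z. z ^ (2 * n) * fejer N a z) \<in> span_1_z2n n" by (intro sp fejer_trigp HA_fc[OF a])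
    moreover have "(z ^ (2 * n) * a z - z ^ (2 * n) * fejer N a z) * g = (a z - fejer N a z) * (z ^ (2 * n) * g)" for z g
      by (simp add: algebra_simps)
    ultimately show ?thesis using N by (intro bexI[of _ "\<lambda>z. z ^ (2 * n) * fejer N a z"]) (simp_all only: simp_thms)
  qed
  then show ?thesis using H unfolding Hinf1_zn_def wstar_closure_Hinf_def by auto
qed

section \<open>Rotationally symmetric norms\<close>

locale rsn =
  fixes \<alpha> :: "(complex \<Rightarrow> complex) \<Rightarrow> real"
  assumes rs: "rot_sym_norm \<alpha>" and ct: "cont_norm \<alpha>"
begin

abbreviation ext :: "(complex \<Rightarrow> complex) \<Rightarrow> ennreal" where "ext \<equiv> alpha_ext \<alpha>"

lemma a_cong: "f \<in> Linf \<Longrightarrow> g \<in> Linf \<Longrightarrow> AE z in circ. f z = g z \<Longrightarrow> \<alpha> f = \<alpha> g"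
  and a_zero_iff: "f \<in> Linf \<Longrightarrow> \<alpha> f = 0 \<longleftrightarrow> (AE z in circ. f z = 0)"
  and a_tri: "f \<in> Linf \<Longrightarrow> g \<in> Linf \<Longrightarrow> \<alpha> (\<lambda>z. f z + g z) \<le> \<alpha> f + \<alpha> g"
  and a_scale: "f \<in> Linf \<Longrightarrow> \<alpha> (\<lambda>z. c * f z) = cmod c * \<alpha> f"
  and a_one: "\<alpha> (\<lambda>z. 1) = 1"
  and a_abs: "f \<in> Linf \<Longrightarrow> \<alpha> (\<lambda>z. complex_of_real (cmod (f z))) = \<alpha> f"
  and a_rot: "f \<in> Linf \<Longrightarrow> cmod w = 1 \<Longrightarrow> \<alpha> (rot w f) = \<alpha> f"
  using rs unfolding rot_sym_norm_def by blast+

lemma a_zero: "\<alpha> (\<lambda>z. 0) = 0" using a_zero_iff[of "\<lambda>z. 0"] by simp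

lemma a_const: "\<alpha> (\<lambda>z. c) = cmod c" using a_scale[of "\<lambda>z. 1" c] a_one by simp

lemma a_uminus: "f \<in> Linf \<Longrightarrow> \<alpha> (\<lambda>z. - f z) = \<alpha> f" using a_scale[of f "-1"] by simp

lemma a_nonneg: "f \<in> Linf \<Longrightarrow> 0 \<le> \<alpha> f"
proof -
  assume f: "f \<in> Linf"
  have "\<alpha> (\<lambda>z. f z + - f z) \<le> \<alpha> f + \<alpha> (\<lambda>z. - f z)" by (intro a_tri f Linf_uminus)
  moreover have "\<alpha> (\<lambda>z. f z + - f z) = 0" using a_zero by simp
  ultimately show ?thesis using a_uminus[OF f] by linarith
qed

lemma Linf_abs: "f \<in> Linf \<Longrightarrow> (\<lambda>z. complex_of_real (cmod (f z))) \<in> Linf"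
  using LinfD(1)[of f] by (rule_tac Linf_bound[of f]) auto

lemma a_mult_unimod:
  assumes "f \<in> Linf" "u \<in> Linf" "\<And>z. cmod (u z) = 1"
  shows "\<alpha> (\<lambda>z. u z * f z) = \<alpha> f"
  using a_abs[OF Linf_mult[OF assms(2,1)]] a_abs[OF assms(1)] assms(3) by (simp add: norm_mult)

text \<open>A number in \<open>[0,1]\<close> is the mean of two conjugate unimodular numbers.\<close>
lemma a_mono:
  assumes f: "f \<in> Linf" and g: "g \<in> Linf" and le: "AE z in circ. cmod (f z) \<le> cmod (g z)"
  shows "\<alpha> f \<le> \<alpha> g"
proof -
  note [measurable] = LinfD(1)[OF f] LinfD(1)[OF g]
  define t where "t z = min 1 (cmod (f z) / cmod (g z))" for z
  define u where "u z = complex_of_real (t z) + \<i> * complex_of_real (sqrt (1 - (t z)\<^sup>2))" for z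
  have [measurable]: "t \<in> borel_measurable circ" unfolding t_def by measurable
  have um [measurable]: "u \<in> borel_measurable circ" unfolding u_def by measurable
  have t01: "0 \<le> t z" "t z \<le> 1" for z by (auto simp: t_def)
  have un: "cmod (u z) = 1" for z
  proof -
    have "(t z)\<^sup>2 \<le> 1" using t01[of z] by (simp add: power_le_one)
    then show ?thesis by (simp add: u_def cmod_def)
  qed
  have uL: "u \<in> Linf" using um un unfolding Linf_def by auto
  let ?g = "\<lambda>z. complex_of_real (cmod (g z))"
  have gL: "?g \<in> Linf" by (rule Linf_abs[OF g])
  have *: "AE z in circ. complex_of_real (cmod (f z)) = (1/2) * (u z * ?g z + cnj (u z) * ?g z)"
    using le
  proof eventually_elim
    case (elim z)
    have "u z + cnj (u z) = 2 * complex_of_real (t z)" by (simp add: u_def complex_eq_iff)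
    then have "(1/2) * (u z * ?g z + cnj (u z) * ?g z) = complex_of_real (t z * cmod (g z))"
      by (simp add: distrib_right[symmetric])
    moreover have "t z * cmod (g z) = cmod (f z)"
      using elim by (cases "g z = 0") (auto simp: t_def min_def divide_simps)
    ultimately show ?case by simp
  qed
  have uL': "(\<lambda>z. cnj (u z)) \<in> Linf" by (rule Linf_cnj[OF uL])
  have L1: "(\<lambda>z. u z * ?g z) \<in> Linf" and L2: "(\<lambda>z. cnj (u z) * ?g z) \<in> Linf"
    by (intro Linf_mult uL uL' gL)+
  have "\<alpha> f = \<alpha> (\<lambda>z. complex_of_real (cmod (f z)))" using a_abs[OF f] by simp
  also have "\<dots> = \<alpha> (\<lambda>z. (1/2) * (u z * ?g z + cnj (u z) * ?g z))"
    by (intro a_cong Linf_abs f Linf_scale Linf_add L1 L2 *)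
  also have "\<dots> = (1/2) * \<alpha> (\<lambda>z. u z * ?g z + cnj (u z) * ?g z)"
    using a_scale[OF Linf_add[OF L1 L2], of "1/2"] by simp
  also have "\<dots> \<le> (1/2) * (\<alpha> (\<lambda>z. u z * ?g z) + \<alpha> (\<lambda>z. cnj (u z) * ?g z))"
    using a_tri[OF L1 L2] by simp
  also have "\<dots> = \<alpha> g"
    using a_mult_unimod[OF gL uL un] a_mult_unimod[OF gL uL'] un a_abs[OF g] by simp
  finally show ?thesis .
qed

lemma a_le_bound: "f \<in> Linf \<Longrightarrow> AE z in circ. cmod (f z) \<le> C \<Longrightarrow> C \<ge> 0 \<Longrightarrow> \<alpha> f \<le> C"
  using a_mono[of f "\<lambda>z. complex_of_real C"] a_const[of "complex_of_real C"] by simp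

lemma a_sum: "finite I \<Longrightarrow> (\<And>i. i \<in> I \<Longrightarrow> f i \<in> Linf) \<Longrightarrow> \<alpha> (\<lambda>z. \<Sum>i\<in>I. f i z) \<le> (\<Sum>i\<in>I. \<alpha> (f i))"
proof (induction I rule: finite_induct)
  case (insert x F)
  then show ?case using a_tri[of "f x" "\<lambda>z. \<Sum>i\<in>F. f i z"] Linf_sum[of F f] by force
qed (simp add: a_zero)

section \<open>The extended norm on measurable functions\<close>

lemma ext_le_ext:
  assumes "\<And>s. s \<in> borel_measurable circ \<Longrightarrow> finite (range s) \<Longrightarrow> AE z in circ. 0 \<le> s z \<and> s z \<le> cmod (f z) \<Longrightarrow>
    ennreal (\<alpha> (\<lambda>z. complex_of_real (s z))) \<le> B"
  shows "ext f \<le> B"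
  unfolding alpha_ext_def using assms by (intro SUP_least) auto

lemma le_ext:
  "s \<in> borel_measurable circ \<Longrightarrow> finite (range s) \<Longrightarrow> AE z in circ. 0 \<le> s z \<and> s z \<le> cmod (f z) \<Longrightarrow>
    ennreal (\<alpha> (\<lambda>z. complex_of_real (s z))) \<le> ext f"
  unfolding alpha_ext_def by (intro SUP_upper) auto

lemma simple_Linf:
  fixes s :: "complex \<Rightarrow> real"
  assumes [measurable]: "s \<in> borel_measurable circ" and "finite (range s)"
  shows "(\<lambda>z. complex_of_real (s z)) \<in> Linf"
proof -
  have "\<bar>s z\<bar> \<le> Max (range (\<lambda>z. \<bar>s z\<bar>))" for z
    using finite_imageI[OF assms(2), of abs] by (intro Max_ge) (auto simp: image_image)
  then have "AE z in circ. cmod (complex_of_real (s z)) \<le> Max (range (\<lambda>z. \<bar>s z\<bar>))" by simp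
  moreover have "(\<lambda>z. complex_of_real (s z)) \<in> borel_measurable circ" by measurable
  ultimately show ?thesis unfolding Linf_def by blast
qed

text \<open>Rounding \<open>|f|\<close> down to multiples of \<open>e\<close> loses at most
  \<open>e\<close> in the uniform norm, hence in \<alpha>, so the supremum over simple functions
  gives back \<alpha>.\<close>

lemma ext_Linf:
  assumes f: "f \<in> Linf" shows "ext f = ennreal (\<alpha> f)"
proof (rule antisym)
  show "ext f \<le> ennreal (\<alpha> f)"
  proof (rule ext_le_ext)
    fix s :: "complex \<Rightarrow> real"
    assume s: "s \<in> borel_measurable circ" "finite (range s)" "AE z in circ. 0 \<le> s z \<and> s z \<le> cmod (f z)"
    have "\<alpha> (\<lambda>z. complex_of_real (s z)) \<le> \<alpha> f"
      using s(3) by (intro a_mono simple_Linf s(1,2) f) (auto elim: eventually_mono)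
    then show "ennreal (\<alpha> (\<lambda>z. complex_of_real (s z))) \<le> ennreal (\<alpha> f)" by (rule ennreal_leI)
  qed
  show "ennreal (\<alpha> f) \<le> ext f"
  proof (rule ennreal_le_epsilon)
    fix e :: real assume e: "e > 0"
    note [measurable] = LinfD(1)[OF f]
    obtain C where C: "C > 0" "AE z in circ. cmod (f z) \<le> C" using LinfE[OF f] by blast
    \<comment> \<open>The cut-off at \<open>C\<close> makes the range finite everywhere, although
      the bound on \<open>|f|\<close> holds only almost everywhere.\<close>
    define s where "s z = e * real_of_int \<lfloor>min (cmod (f z)) C / e\<rfloor>" for z
    have sm [measurable]: "s \<in> borel_measurable circ" unfolding s_def by measurable
    have "range s \<subseteq> (\<lambda>k. e * real_of_int k) ` {0..\<lfloor>C / e\<rfloor>}"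
      using e C(1) by (auto simp: s_def intro!: imageI floor_mono divide_right_mono)
    then have sf: "finite (range s)" by (rule finite_subset) auto
    have s0: "0 \<le> s z" for z using e C(1) by (auto simp: s_def)
    have s1: "s z \<le> min (cmod (f z)) C" for z
    proof -
      have "real_of_int \<lfloor>min (cmod (f z)) C / e\<rfloor> \<le> min (cmod (f z)) C / e" by (rule of_int_floor_le)
      then have "real_of_int \<lfloor>min (cmod (f z)) C / e\<rfloor> * e \<le> min (cmod (f z)) C"
        using e by (simp only: pos_le_divide_eq)
      then show ?thesis by (simp only: s_def mult.commute)
    qed
    have s2: "min (cmod (f z)) C \<le> s z + e" for z
    proof -
      have "min (cmod (f z)) C / e \<le> real_of_int \<lfloor>min (cmod (f z)) C / e\<rfloor> + 1" by linarith
      then have "min (cmod (f z)) C \<le> (real_of_int \<lfloor>min (cmod (f z)) C / e\<rfloor> + 1) * e"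
        using e by (simp only: pos_divide_le_eq)
      then show ?thesis by (simp only: s_def mult.commute distrib_left mult_1_right)
    qed
    let ?s = "\<lambda>z. complex_of_real (s z)" and ?f = "\<lambda>z. complex_of_real (cmod (f z))"
    have sL: "?s \<in> Linf" by (rule simple_Linf[OF sm sf])
    have "\<alpha> f = \<alpha> (\<lambda>z. ?s z + (?f z - ?s z))" using a_abs[OF f] by simp
    also have "\<dots> \<le> \<alpha> ?s + \<alpha> (\<lambda>z. ?f z - ?s z)"
      by (intro a_tri sL Linf_diff Linf_abs f)
    also have "\<alpha> (\<lambda>z. ?f z - ?s z) \<le> e"
    proof (rule a_le_bound)
      show "AE z in circ. cmod (?f z - ?s z) \<le> e"
        using C(2)
      proof eventually_elim
        case (elim z)
        then show ?case using s1[of z] s2[of z] by (simp flip: of_real_diff)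
      qed
    qed (use e in \<open>auto intro!: sL Linf_diff Linf_abs f\<close>)
    finally have "ennreal (\<alpha> f) \<le> ennreal (\<alpha> ?s + e)" by (simp add: ennreal_leI)
    also have "\<dots> = ennreal (\<alpha> ?s) + ennreal e" using a_nonneg[OF sL] e by simp
    also have "ennreal (\<alpha> ?s) \<le> ext f" using s0 s1 by (intro le_ext sm sf) auto
    finally show "ennreal (\<alpha> f) \<le> ext f + ennreal e" by (simp add: add_right_mono)
  qed
qed

lemma ext_mono:
  assumes "AE z in circ. cmod (f z) \<le> cmod (g z)" shows "ext f \<le> ext g"
proof (rule ext_le_ext)
  fix s :: "complex \<Rightarrow> real"
  assume s: "s \<in> borel_measurable circ" "finite (range s)" "AE z in circ. 0 \<le> s z \<and> s z \<le> cmod (f z)"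
  show "ennreal (\<alpha> (\<lambda>z. complex_of_real (s z))) \<le> ext g"
    by (rule le_ext[OF s(1,2)]) (use s(3) assms in eventually_elim, auto)
qed

lemma ext_cong: "AE z in circ. f z = g z \<Longrightarrow> ext f = ext g"
  by (intro antisym ext_mono) (auto elim: eventually_mono)

lemma ext_scale:
  assumes "AE z in circ. cmod (g z) \<le> C * cmod (f z)" "C > 0" shows "ext g \<le> ennreal C * ext f"
proof (rule ext_le_ext)
  fix s :: "complex \<Rightarrow> real"
  assume s [measurable]: "s \<in> borel_measurable circ" and sf: "finite (range s)"
    and sg: "AE z in circ. 0 \<le> s z \<and> s z \<le> cmod (g z)"
  have "finite ((\<lambda>x. x / C) ` range s)" using sf by simp
  then have f: "finite (range (\<lambda>z. s z / C))" by (simp add: image_image)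
  have "AE z in circ. 0 \<le> s z / C \<and> s z / C \<le> cmod (f z)"
    using sg assms(1)
  proof eventually_elim
    case (elim z)
    then have "s z \<le> C * cmod (f z)" by linarith
    then show ?case using elim assms(2) by (simp add: pos_divide_le_eq mult.commute)
  qed
  then have "ennreal (\<alpha> (\<lambda>z. complex_of_real (s z / C))) \<le> ext f"
    using f by (intro le_ext) auto
  then have "ennreal C * ennreal (\<alpha> (\<lambda>z. complex_of_real (s z / C))) \<le> ennreal C * ext f"
    by (rule mult_left_mono) simp
  moreover have "\<alpha> (\<lambda>z. complex_of_real C * complex_of_real (s z / C)) = C * \<alpha> (\<lambda>z. complex_of_real (s z / C))"
    using a_scale[OF simple_Linf[OF _ f], of "complex_of_real C"] assms(2) by (simp only: norm_of_real abs_of_pos) measurable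
  moreover have "(\<lambda>z. complex_of_real C * complex_of_real (s z / C)) = (\<lambda>z. complex_of_real (s z))"
    using assms(2) by auto
  ultimately show "ennreal (\<alpha> (\<lambda>z. complex_of_real (s z))) \<le> ennreal C * ext f"
    using assms(2) by (simp add: ennreal_mult'[symmetric])
qed

lemma ext_minus_commute: "ext (\<lambda>z. f z - g z) = ext (\<lambda>z. g z - f z)"
  by (intro antisym ext_mono) (auto simp: norm_minus_commute)

text \<open>Riesz decomposition: a simple \<open>s\<close> below \<open>|f + g|\<close> splits into
  the minimum of \<open>s\<close> and \<open>|f|\<close> and a remainder at most \<open>|g|\<close>.
  The two parts are bounded but in general not simple, so \<open>ext_Linf\<close> is applied to
  them.\<close>

lemma ext_add:
  assumes [measurable]: "f \<in> borel_measurable circ" "g \<in> borel_measurable circ"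
  shows "ext (\<lambda>z. f z + g z) \<le> ext f + ext g"
proof (rule ext_le_ext)
  fix s :: "complex \<Rightarrow> real"
  assume s [measurable]: "s \<in> borel_measurable circ" and sf: "finite (range s)"
    and sg: "AE z in circ. 0 \<le> s z \<and> s z \<le> cmod (f z + g z)"
  have sL: "(\<lambda>z. complex_of_real (s z)) \<in> Linf" by (rule simple_Linf[OF s sf])
  let ?a = "\<lambda>z. complex_of_real (min (s z) (cmod (f z)))"
  let ?b = "\<lambda>z. complex_of_real (s z) - ?a z"
  have aL: "?a \<in> Linf"
  proof (rule Linf_bound[OF sL])
    show "AE z in circ. cmod (?a z) \<le> cmod (complex_of_real (s z))" using sg by eventually_elim auto
  qed measurable
  have bL: "?b \<in> Linf" by (intro Linf_diff sL aL)
  have "\<alpha> (\<lambda>z. complex_of_real (s z)) \<le> \<alpha> ?a + \<alpha> ?b" using a_tri[OF aL bL] by simp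
  then have "ennreal (\<alpha> (\<lambda>z. complex_of_real (s z))) \<le> ennreal (\<alpha> ?a) + ennreal (\<alpha> ?b)"
    using a_nonneg[OF aL] a_nonneg[OF bL] by (simp flip: ennreal_plus add: ennreal_leI)
  also have "\<dots> = ext ?a + ext ?b" by (simp only: ext_Linf[OF aL] ext_Linf[OF bL])
  also have "\<dots> \<le> ext f + ext g"
  proof (intro add_mono ext_mono)
    show "AE z in circ. cmod (?a z) \<le> cmod (f z)" using sg by eventually_elim auto
    show "AE z in circ. cmod (?b z) \<le> cmod (g z)" using sg
    proof eventually_elim
      case (elim z)
      then have "0 \<le> s z - min (s z) (cmod (f z))" "s z - min (s z) (cmod (f z)) \<le> cmod (g z)"
        using norm_triangle_ineq[of "f z" "g z"] by (auto simp: min_def)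
      then show ?case by (simp flip: of_real_diff)
    qed
  qed
  finally show "ennreal (\<alpha> (\<lambda>z. complex_of_real (s z))) \<le> ext f + ext g" .
qed

lemma ext_sum:
  "finite I \<Longrightarrow> (\<And>i. i \<in> I \<Longrightarrow> f i \<in> borel_measurable circ) \<Longrightarrow> ext (\<lambda>z. \<Sum>i\<in>I. f i z) \<le> (\<Sum>i\<in>I. ext (f i))"
proof (induction I rule: finite_induct)
  case empty show ?case by (simp add: ext_Linf a_zero)
next
  case (insert x F)
  have "ext (\<lambda>z. \<Sum>i\<in>insert x F. f i z) \<le> ext (f x) + ext (\<lambda>z. \<Sum>i\<in>F. f i z)"
    using ext_add[of "f x" "\<lambda>z. \<Sum>i\<in>F. f i z"] insert by (simp add: borel_measurable_sum)
  also have "\<dots> \<le> ext (f x) + (\<Sum>i\<in>F. ext (f i))" using insert by (intro add_left_mono) auto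
  finally show ?case using insert by simp
qed

lemma ext_rot:
  assumes w: "cmod w = 1" shows "ext (\<lambda>z. f (w * z)) \<le> ext f"
proof (rule ext_le_ext)
  fix s :: "complex \<Rightarrow> real"
  assume s [measurable]: "s \<in> borel_measurable circ" and sf: "finite (range s)"
    and sg: "AE z in circ. 0 \<le> s z \<and> s z \<le> cmod (f (w * z))"
  have w': "cmod (cnj w) = 1" "w * cnj w = 1" using w by (simp_all add: complex_norm_square[symmetric])
  have "AE z in circ. 0 \<le> s (cnj w * z) \<and> s (cnj w * z) \<le> cmod (f (w * (cnj w * z)))"
    by (rule AE_circ_rot[OF w'(1) sg])
  then have "AE z in circ. 0 \<le> s (cnj w * z) \<and> s (cnj w * z) \<le> cmod (f z)"
    using w'(2) by (simp add: mult.assoc[symmetric])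
  moreover have "finite (range (\<lambda>z. s (cnj w * z)))" by (rule finite_subset[OF _ sf]) auto
  ultimately have "ennreal (\<alpha> (\<lambda>z. complex_of_real (s (cnj w * z)))) \<le> ext f"
    by (intro le_ext measurable_rot s)
  moreover have "(\<lambda>z. complex_of_real (s (cnj w * z))) = rot w (\<lambda>z. complex_of_real (s z))" by (simp add: rot_def)
  ultimately show "ennreal (\<alpha> (\<lambda>z. complex_of_real (s z))) \<le> ext f"
    using a_rot[OF simple_Linf[OF s sf] w] by simp
qed

text \<open>Bounded convergence for \<alpha>. Off the set \<open>E i\<close> where
  \<open>|g i|\<close> exceeds \<open>e / 2\<close> the function is small, and on it bounded by
  \<open>C'\<close>. The measure of \<open>E i\<close> tends to 0, so the indicator becomes small in
  \<alpha>: this is where continuity of \<alpha> enters.\<close>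

lemma a_tendsto_0:
  assumes m [measurable]: "\<And>i. g i \<in> borel_measurable circ" and b: "\<And>i. AE z in circ. cmod (g i z) \<le> C"
    and l: "AE z in circ. (\<lambda>i. g i z) \<longlonglongrightarrow> 0"
  shows "(\<lambda>i. \<alpha> (g i)) \<longlonglongrightarrow> 0"
proof (rule LIMSEQ_I)
  fix e :: real assume e: "e > 0"
  have gL: "g i \<in> Linf" for i using m b unfolding Linf_def by blast
  define C' where "C' = max C 1"
  have C': "C' > 0" by (simp add: C'_def)
  have C'2: "AE z in circ. cmod (g i z) \<le> C'" for i
    using b[of i] by eventually_elim (simp add: C'_def)
  have "e / (2 * C') > 0" using e C' by simp
  then obtain d where d: "d > 0" "\<And>E. E \<in> sets circ \<Longrightarrow> measure circ E < d \<Longrightarrow> \<alpha> (\<lambda>z. complex_of_real (indicator E z)) < e / (2 * C')"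
    using ct unfolding cont_norm_def by blast
  define E where "E i = {z. cmod (g i z) > e / 2}" for i
  have Em [measurable]: "E i \<in> sets circ" for i
  proof -
    have "{z \<in> space circ. cmod (g i z) > e / 2} \<in> sets circ" by measurable
    then show ?thesis by (simp add: E_def)
  qed
  have "(\<lambda>i. LINT z|circ. indicator (E i) z) \<longlonglongrightarrow> (LINT z|circ. (0::real))"
  proof (rule integral_dominated_convergence[where w = "\<lambda>_. 1"])
    show "AE z in circ. (\<lambda>i. indicator (E i) z :: real) \<longlonglongrightarrow> 0"
      using l
    proof eventually_elim
      case (elim z)
      have "\<forall>\<^sub>F i in sequentially. cmod (g i z) < e / 2"
        using order_tendstoD(2)[OF tendsto_norm[OF elim], of "e/2"] e by simp
      then have "\<forall>\<^sub>F i in sequentially. (indicator (E i) z :: real) = 0"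
        by eventually_elim (auto simp: E_def)
      then show ?case by (rule tendsto_eventually)
    qed
  qed auto
  then have "(\<lambda>i. measure circ (E i)) \<longlonglongrightarrow> 0" by simp
  from LIMSEQ_D[OF this d(1)] obtain N where N: "\<And>i. i \<ge> N \<Longrightarrow> measure circ (E i) < d" by auto
  show "\<exists>no. \<forall>i\<ge>no. norm (\<alpha> (g i) - 0) < e"
  proof (intro exI allI impI)
    fix i assume i: "i \<ge> N"
    have iL: "(\<lambda>z. complex_of_real (indicator (E i) z)) \<in> Linf"
    proof (rule Linf_bound[of "\<lambda>z. 1"])
      show "AE z in circ. cmod (complex_of_real (indicator (E i) z)) \<le> cmod 1"
        by (intro AE_I2) (auto simp: indicator_def)
    qed auto
    have "\<alpha> (g i) \<le> \<alpha> (\<lambda>z. complex_of_real (e/2) + complex_of_real C' * complex_of_real (indicator (E i) z))"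
    proof (rule a_mono[OF gL])
      show "AE z in circ. cmod (g i z) \<le> cmod (complex_of_real (e/2) + complex_of_real C' * complex_of_real (indicator (E i) z))"
        using C'2[of i]
      proof eventually_elim
        case (elim z)
        have "cmod (complex_of_real (e/2) + complex_of_real C' * complex_of_real (indicator (E i) z)) = e/2 + C' * indicator (E i) z"
        proof -
          have "complex_of_real (e/2) + complex_of_real C' * complex_of_real (indicator (E i) z) =
            complex_of_real (e/2 + C' * indicator (E i) z)" by simp
          then show ?thesis using e C' by (simp only: norm_of_real) simp
        qed
        then show ?case using elim e C' by (auto simp: E_def indicator_def)
      qed
    qed (intro Linf_add Linf_scale iL Linf_const)
    also have "\<dots> \<le> \<alpha> (\<lambda>z. complex_of_real (e/2)) + \<alpha> (\<lambda>z. complex_of_real C' * complex_of_real (indicator (E i) z))"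
      by (intro a_tri Linf_scale iL Linf_const)
    also have "\<dots> = e/2 + C' * \<alpha> (\<lambda>z. complex_of_real (indicator (E i) z))"
      using a_scale[OF iL, of "complex_of_real C'"] a_const[of "complex_of_real (e/2)"] e C' by simp
    also have "\<dots> < e/2 + C' * (e / (2 * C'))"
      using mult_strict_left_mono[OF d(2)[OF Em N[OF i]] C'] by linarith
    also have "\<dots> = e" using C' by (simp add: field_simps)
    finally show "norm (\<alpha> (g i) - 0) < e" using a_nonneg[OF gL] by simp
  qed
qed

section \<open>Domination of the L1 norm\<close>

lemma trigp_avg:
  assumes "t \<in> trigp UNIV"
  shows "\<exists>N0\<ge>1. \<forall>N\<ge>N0. \<forall>z. avg N t z = fc t 0"
  using assms
proof (induction rule: trigp.induct)
  case zero
  show ?case by (intro exI[of _ 1]) (auto simp: avg_def)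
next
  case (mono k c)
  show ?case
  proof (intro exI[of _ "Suc (nat \<bar>k\<bar>)"] conjI allI impI)
    fix N z assume N: "N \<ge> Suc (nat \<bar>k\<bar>)"
    then have N1: "N \<ge> 1" by simp
    have "(\<Sum>j<N. c * (om N ^ j * z) powi k) = (\<Sum>j<N. (om N powi k) ^ j * (c * z powi k))"
    proof (rule sum.cong[OF refl])
      fix j
      have "(om N ^ j) powi k = (om N powi k) ^ j" by (metis mult.commute power_int_mult power_int_of_nat)
      then show "c * (om N ^ j * z) powi k = (om N powi k) ^ j * (c * z powi k)" by (simp add: power_int_mult_distrib)
    qed
    also have "\<dots> = (if int N dvd k then of_nat N else 0) * (c * z powi k)"
      unfolding sum_distrib_right[symmetric] om_sum[OF N1] ..
    finally have "avg N (\<lambda>z. c * z powi k) z = (if int N dvd k then 1 else 0) * (c * z powi k)"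
      using N1 by (simp add: avg_def)
    moreover have "int N dvd k \<longleftrightarrow> k = 0"
    proof
      assume "int N dvd k"
      then show "k = 0" using N zdvd_imp_le[of "int N" "\<bar>k\<bar>"] by (cases "k = 0") auto
    qed simp
    ultimately show "avg N (\<lambda>z. c * z powi k) z = fc (\<lambda>z. c * z powi k) 0" by (auto simp: fc_scale fc_powi)
  qed simp
next
  case (add f g)
  then obtain N1 N2 where N: "N1 \<ge> 1" "\<forall>N\<ge>N1. \<forall>z. avg N f z = fc f 0" "\<forall>N\<ge>N2. \<forall>z. avg N g z = fc g 0" by blast
  have "avg N (\<lambda>z. f z + g z) z = avg N f z + avg N g z" for N z by (simp add: avg_def sum.distrib add_divide_distrib)
  then show ?case using N fc_add[OF circ.L2m_integrable[OF trigp_L2m[OF add(1)]] circ.L2m_integrable[OF trigp_L2m[OF add(2)]]]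
    by (intro exI[of _ "max N1 N2"]) auto
qed

lemma avg_L1_le:
  assumes g: "integrable circ g" shows "(LINT z|circ. cmod (avg N g z)) \<le> (LINT z|circ. cmod (g z))"
proof (cases "N = 0")
  case True then show ?thesis by (simp add: avg_def)
next
  case False
  have [measurable]: "g \<in> borel_measurable circ" using g by auto
  have i: "integrable circ (\<lambda>z. cmod (g (om N ^ j * z)))" for j
    by (intro integrable_norm integrable_circ_rot g) simp
  have "(LINT z|circ. cmod (avg N g z)) \<le> (LINT z|circ. (\<Sum>j<N. cmod (g (om N ^ j * z))) / real N)"
  proof (rule integral_mono)
    show "integrable circ (\<lambda>z. cmod (avg N g z))" by (intro integrable_norm avg_integrable g)
    show "integrable circ (\<lambda>z. (\<Sum>j<N. cmod (g (om N ^ j * z))) / real N)"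
      by (intro integrable_divide Bochner_Integration.integrable_sum i)
    fix z show "cmod (avg N g z) \<le> (\<Sum>j<N. cmod (g (om N ^ j * z))) / real N"
      by (simp add: avg_def norm_divide divide_right_mono norm_sum)
  qed
  also have "\<dots> = (\<Sum>j<N. (LINT z|circ. cmod (g (om N ^ j * z)))) / real N"
    using i by (simp add: Bochner_Integration.integral_sum)
  also have "\<dots> = (\<Sum>j<N. (LINT z|circ. cmod (g z))) / real N"
    by (subst integral_circ_rot[of _ "\<lambda>z. cmod (g z)"]) auto
  finally show ?thesis using False by simp
qed

text \<open>For a trigonometric polynomial the averages equal the mean value as soon as
  \<open>N\<close> exceeds all its frequencies. Averaging is an L1 contraction, so L1 approximation
  extends this to integrable functions.\<close>

lemma avg_tendsto_L1:
  assumes g: "integrable circ g"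
  shows "(\<lambda>N. LINT z|circ. cmod (avg N g z - fc g 0)) \<longlonglongrightarrow> 0"
proof (rule LIMSEQ_I)
  fix e :: real assume e: "e > 0"
  obtain t where t: "t \<in> trigp UNIV" "(LINT z|circ. cmod (g z - t z)) < e / 2"
    using trigp_dense_L1[OF g, of "e/2"] e by auto
  have ti: "integrable circ t" by (rule circ.L2m_integrable[OF trigp_L2m[OF t(1)]])
  have d: "integrable circ (\<lambda>z. g z - t z)" using g ti by simp
  obtain N0 where N0: "\<And>N z. N \<ge> N0 \<Longrightarrow> avg N t z = fc t 0" using trigp_avg[OF t(1)] by blast
  show "\<exists>no. \<forall>N\<ge>no. norm ((LINT z|circ. cmod (avg N g z - fc g 0)) - 0) < e"
  proof (intro exI allI impI)
    fix N assume N: "N \<ge> N0"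
    have *: "avg N g z - fc g 0 = avg N (\<lambda>z. g z - t z) z - fc (\<lambda>z. g z - t z) 0" for z
    proof -
      have "avg N (\<lambda>z. g z - t z) z = avg N g z - avg N t z" by (simp add: avg_def sum_subtractf diff_divide_distrib)
      then show ?thesis using N0[OF N] fc_diff[OF g ti] by simp
    qed
    have "(LINT z|circ. cmod (avg N g z - fc g 0)) \<le> (LINT z|circ. cmod (avg N (\<lambda>z. g z - t z) z) + cmod (fc (\<lambda>z. g z - t z) 0))"
      unfolding * by (intro integral_mono) (auto intro!: norm_triangle_ineq4 avg_integrable d integrable_norm Bochner_Integration.integrable_add Bochner_Integration.integrable_diff)
    also have "\<dots> = (LINT z|circ. cmod (avg N (\<lambda>z. g z - t z) z)) + cmod (fc (\<lambda>z. g z - t z) 0)"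
      using avg_integrable[OF d, of N] by simp
    also have "\<dots> \<le> (LINT z|circ. cmod (g z - t z)) + (LINT z|circ. cmod (g z - t z))"
      by (intro add_mono avg_L1_le fc_norm_le d)
    also have "\<dots> < e" using t(2) by simp
    finally show "norm ((LINT z|circ. cmod (avg N g z - fc g 0)) - 0) < e" by simp
  qed
qed

text \<open>Averages over the \<open>N\<close>-th roots of unity do not increase \<open>\<alpha>\<close> and tend to the mean value.\<close>
lemma a_ge_L1:
  assumes f: "f \<in> Linf" shows "(LINT z|circ. cmod (f z)) \<le> \<alpha> f"
proof -
  note [measurable] = LinfD(1)[OF f]
  define u where "u z = complex_of_real (cmod (f z))" for z
  define c where "c = (LINT z|circ. cmod (f z))"
  have uL: "u \<in> Linf" unfolding u_def by (rule Linf_abs[OF f])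
  have ui: "integrable circ u" by (rule Linf_integrable[OF uL])
  have uc: "fc u 0 = complex_of_real c" unfolding fc_def u_def c_def by (simp add: integral_complex_of_real)
  have c0: "c \<ge> 0" by (simp add: c_def)
  obtain C where C: "C > 0" "AE z in circ. cmod (u z) \<le> C" using LinfE[OF uL] by blast
  let ?d = "\<lambda>N z. avg (Suc N) u z - complex_of_real c"
  have "(\<lambda>N. LINT z|circ. norm (?d N z)) \<longlonglongrightarrow> 0"
    using LIMSEQ_Suc[OF avg_tendsto_L1[OF ui]] unfolding uc .
  then obtain r where r: "strict_mono r" "AE z in circ. (\<lambda>i. ?d (r i) z) \<longlonglongrightarrow> 0"
    using tendsto_L1_AE_subseq[of circ ?d] avg_integrable[OF ui] by auto
  have lim: "(\<lambda>i. \<alpha> (?d (r i))) \<longlonglongrightarrow> 0"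
  proof (rule a_tendsto_0[OF _ _ r(2)])
    have [measurable]: "u \<in> borel_measurable circ" using ui by auto
    show "?d (r i) \<in> borel_measurable circ" for i by measurable
    show "AE z in circ. cmod (?d (r i) z) \<le> C + c" for i
    proof -
      have "AE z in circ. cmod (avg (Suc (r i)) u z) \<le> C" by (rule avg_bound[OF _ C(2)]) simp
      then show ?thesis
      proof eventually_elim
        case (elim z)
        then show ?case using norm_triangle_ineq4[of "avg (Suc (r i)) u z" "complex_of_real c"] c0 by auto
      qed
    qed
  qed
  have le: "c \<le> \<alpha> f + \<alpha> (?d N)" for N
  proof -
    have aL: "avg (Suc N) u \<in> Linf" by (rule avg_Linf[OF _ uL]) simp
    have dL: "?d N \<in> Linf" by (intro Linf_diff aL Linf_const)
    have rL: "(\<lambda>z. u (om (Suc N) ^ j * z)) \<in> Linf" for j by (rule Linf_rot[OF _ uL]) simp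
    have rr: "\<alpha> (\<lambda>z. u (om (Suc N) ^ j * z)) = \<alpha> f" for j
    proof -
      have "(\<lambda>z. u (om (Suc N) ^ j * z)) = rot (cnj (om (Suc N) ^ j)) u" by (simp add: rot_def)
      then have "\<alpha> (\<lambda>z. u (om (Suc N) ^ j * z)) = \<alpha> u"
        using a_rot[OF uL, of "cnj (om (Suc N) ^ j)"] by (simp del: complex_cnj_power)
      also have "\<dots> = \<alpha> f" unfolding u_def by (rule a_abs[OF f])
      finally show ?thesis .
    qed
    have "\<alpha> (avg (Suc N) u) = \<alpha> (\<lambda>z. (1 / of_nat (Suc N)) * (\<Sum>j<Suc N. u (om (Suc N) ^ j * z)))"
      unfolding avg_def by simp
    also have "\<dots> = 1 / real (Suc N) * \<alpha> (\<lambda>z. \<Sum>j<Suc N. u (om (Suc N) ^ j * z))"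
    proof -
      have "(\<lambda>z. \<Sum>j<Suc N. u (om (Suc N) ^ j * z)) \<in> Linf" by (rule Linf_sum) (rule rL)
      from a_scale[OF this, of "1 / of_nat (Suc N)"] show ?thesis by (simp only: norm_divide norm_one norm_of_nat)
    qed
    also have "\<dots> \<le> 1 / real (Suc N) * (\<Sum>j<Suc N. \<alpha> (\<lambda>z. u (om (Suc N) ^ j * z)))"
      by (intro mult_left_mono a_sum rL) auto
    also have "\<dots> = \<alpha> f" unfolding rr by simp
    finally have 1: "\<alpha> (avg (Suc N) u) \<le> \<alpha> f" .
    have "c = \<alpha> (\<lambda>z. avg (Suc N) u z + - ?d N z)" using a_const[of "complex_of_real c"] c0 by simp
    also have "\<dots> \<le> \<alpha> (avg (Suc N) u) + \<alpha> (\<lambda>z. - ?d N z)" by (intro a_tri aL Linf_uminus dL)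
    finally show ?thesis using 1 a_uminus[OF dL] by simp
  qed
  have "(\<lambda>i. \<alpha> f + \<alpha> (?d (r i))) \<longlonglongrightarrow> \<alpha> f + 0" by (intro tendsto_intros lim)
  then show ?thesis using LIMSEQ_le_const[of _ "\<alpha> f" c] le unfolding c_def by auto
qed

text \<open>Truncations at level \<open>m\<close> are bounded, so \<open>a_ge_L1\<close> applies to
  them, and Fatou's lemma removes the truncation. Through this bound \<alpha>-limits inherit
  integrability and Fourier coefficients.\<close>

lemma ext_ge_L1:
  assumes [measurable]: "f \<in> borel_measurable circ"
  shows "(\<integral>\<^sup>+ z. ennreal (cmod (f z)) \<partial>circ) \<le> ext f"
proof -
  have "(\<integral>\<^sup>+ z. ennreal (cmod (f z)) \<partial>circ) = (\<integral>\<^sup>+ z. liminf (\<lambda>m. ennreal (min (cmod (f z)) (real m))) \<partial>circ)"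
  proof (rule nn_integral_cong)
    fix z
    obtain m0 where m0: "cmod (f z) \<le> real m0" using real_arch_simple by blast
    have "\<forall>\<^sub>F m in sequentially. ennreal (min (cmod (f z)) (real m)) = ennreal (cmod (f z))"
      using eventually_ge_at_top[of m0]
    proof eventually_elim
      case (elim m)
      then have "cmod (f z) \<le> real m" using m0 by linarith
      then show ?case by (simp add: min_def)
    qed
    then have "(\<lambda>m. ennreal (min (cmod (f z)) (real m))) \<longlonglongrightarrow> ennreal (cmod (f z))" by (rule tendsto_eventually)
    from lim_imp_Liminf[OF _ this] show "ennreal (cmod (f z)) = liminf (\<lambda>m. ennreal (min (cmod (f z)) (real m)))" by simp
  qed
  also have "\<dots> \<le> liminf (\<lambda>m. \<integral>\<^sup>+ z. ennreal (min (cmod (f z)) (real m)) \<partial>circ)"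
    by (rule nn_integral_liminf) measurable
  also have "\<dots> \<le> liminf (\<lambda>m. ext f)"
  proof (rule Liminf_mono, intro always_eventually allI)
    fix m
    let ?g = "\<lambda>z. complex_of_real (min (cmod (f z)) (real m))"
    have gL: "?g \<in> Linf" by (rule Linf_bound[of "\<lambda>z. of_nat m"]) (auto intro!: AE_I2)
    have "(\<integral>\<^sup>+ z. ennreal (min (cmod (f z)) (real m)) \<partial>circ) = (\<integral>\<^sup>+ z. ennreal (cmod (?g z)) \<partial>circ)"
      by (rule nn_integral_cong) auto
    also have "\<dots> = ennreal (LINT z|circ. cmod (?g z))"
      using integrable_norm[OF Linf_integrable[OF gL]] by (intro nn_integral_eq_integral) auto
    also have "\<dots> \<le> ext ?g" unfolding ext_Linf[OF gL] by (intro ennreal_leI a_ge_L1 gL)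
    also have "\<dots> \<le> ext f" by (intro ext_mono) auto
    finally show "(\<integral>\<^sup>+ z. ennreal (min (cmod (f z)) (real m)) \<partial>circ) \<le> ext f" .
  qed
  also have "\<dots> = ext f" by (simp add: Liminf_const)
  finally show ?thesis .
qed

end

section \<open>Extremal multipliers and closures\<close>

lemma fc_real_uminus:
  fixes u :: "complex \<Rightarrow> real"
  assumes [measurable]: "u \<in> borel_measurable circ"
  shows "fc (\<lambda>z. complex_of_real (u z)) (- k) = cnj (fc (\<lambda>z. complex_of_real (u z)) k)"
proof -
  have "fc (\<lambda>z. complex_of_real (u z)) (- k) = (LINT z|circ. cnj (complex_of_real (u z) * z powi - k))"
    unfolding fc_def
  proof (rule integral_cong_AE)
    show "AE z in circ. complex_of_real (u z) * z powi - (- k) = cnj (complex_of_real (u z) * z powi - k)"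
      using AE_circ by eventually_elim (simp add: cnj_powi del: complex_cnj_power_int)
  qed measurable
  also have "\<dots> = cnj (fc (\<lambda>z. complex_of_real (u z)) k)" unfolding fc_def by (rule Bochner_Integration.integral_cnj)
  finally show ?thesis .
qed

text \<open>The minimizer \<open>K\<close> of \<open>\<integral>|K|\<^sup>2(1+dF)\<close> among functions in \<open>H\<^sup>2(z\<^sup>n)\<close> with mean value 1
  has \<open>|K|\<^sup>2(1+dF)\<close> constant: all its other Fourier coefficients vanish by orthogonality.\<close>
lemma weighted_extremal:
  fixes F :: "complex \<Rightarrow> real"
  assumes n: "n \<ge> 1" and F: "integrable circ F" "\<And>z. F z \<ge> 0" "\<And>z. F (om n * z) = F z" and d: "d > 0"
  obtains K where "K \<in> HA (nn n)" "AE z in circ. (cmod (K z))\<^sup>2 * (1 + d * F z) \<le> 1 + d * (LINT z|circ. F z)"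
    "sqn circ (\<lambda>z. K z - 1) \<le> d * (LINT z|circ. F z)"
proof -
  have Fm [measurable]: "F \<in> borel_measurable circ" using F(1) by auto
  define W where "W z = 1 + d * F z" for z
  have Wm [measurable]: "W \<in> borel_measurable circ" unfolding W_def by measurable
  have W1: "W z \<ge> 1" for z using F(2)[of z] d by (simp add: W_def)
  have Wi: "integrable circ W" unfolding W_def using F(1) by simp
  \<comment> \<open>In the weighted measure the general minimizer lemmas apply. Since
    \<open>W\<close> is at least 1, convergence in its norm implies convergence in
    \<open>L2m circ\<close>, so coefficient conditions define a closed set.\<close>
  define M where "M = density circ (\<lambda>z. ennreal (W z))"
  have sM [measurable_cong]: "sets M = sets circ" by (simp add: M_def)
  interpret M: finite_measure M
    unfolding M_def using W1 Wi
    by (intro finite_measureI) (simp add: emeasure_density nn_integral_eq_integral order_trans[OF zero_le_one])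
  have W0: "AE z in circ. 0 \<le> W z" using W1 order_trans[OF zero_le_one] by auto
  have LM: "K \<in> L2m M \<longleftrightarrow> K \<in> borel_measurable circ \<and> integrable circ (\<lambda>z. W z * (cmod (K z))\<^sup>2)" for K
  proof -
    have "K \<in> borel_measurable M \<longleftrightarrow> K \<in> borel_measurable circ" by (simp add: M_def)
    moreover have "integrable M (\<lambda>z. (cmod (K z))\<^sup>2) \<longleftrightarrow> integrable circ (\<lambda>z. W z * (cmod (K z))\<^sup>2)"
      if [measurable]: "K \<in> borel_measurable circ"
      unfolding M_def by (subst integrable_density) (use W0 in auto)
    ultimately show ?thesis by (auto simp: L2m_def)
  qed
  have intM: "(LINT z|M. g z) = (LINT z|circ. W z *\<^sub>R g z)" if [measurable]: "g \<in> borel_measurable circ"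
    for g :: "complex \<Rightarrow> complex"
    unfolding M_def by (subst integral_density) (use W0 in auto)
  have sqM: "sqn M K = (LINT z|circ. W z * (cmod (K z))\<^sup>2)" if [measurable]: "K \<in> borel_measurable circ" for K
    unfolding sqn_def M_def by (subst integral_density) (use W0 in auto)
  have le: "(cmod (K z))\<^sup>2 \<le> W z * (cmod (K z))\<^sup>2" for K :: "complex \<Rightarrow> complex" and z
    using mult_right_mono[OF W1[of z], of "(cmod (K z))\<^sup>2"] by simp
  have L2: "K \<in> L2m circ" "sqn circ K \<le> sqn M K" if K: "K \<in> L2m M" for K
  proof -
    have Km [measurable]: "K \<in> borel_measurable circ" and i: "integrable circ (\<lambda>z. W z * (cmod (K z))\<^sup>2)" using K LM by auto
    have i': "integrable circ (\<lambda>z. (cmod (K z))\<^sup>2)"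
      by (rule Bochner_Integration.integrable_bound[OF i])
        (use le[of K] in \<open>auto intro!: AE_I2 order_trans[OF _ abs_ge_self]\<close>)
    then show "K \<in> L2m circ" by (simp add: L2m_def)
    show "sqn circ K \<le> sqn M K" unfolding sqM[OF Km] using i i' le[of K] unfolding sqn_def by (intro integral_mono)
  qed
  define S where "S = {K \<in> L2m M. (\<forall>k. k \<notin> nn n \<longrightarrow> fc K k = 0) \<and> fc K 0 = 1}"
  have one: "(\<lambda>z. 1) \<in> S"
    using Wi fc_powi[of 0] by (auto simp: S_def LM)
  obtain K where K: "K \<in> S" "\<And>g. g \<in> S \<Longrightarrow> sqn M K \<le> sqn M g"
  proof (rule M.L2m_minimizer_exists[of S])
    show "S \<subseteq> L2m M" by (auto simp: S_def)
    show "S \<noteq> {}" using one by auto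
    show "(\<lambda>z. (f z + g z) / 2) \<in> S" if f: "f \<in> S" and g: "g \<in> S" for f g
    proof -
      have "(\<lambda>z. (1/2) * (f z + g z)) \<in> L2m M" using f g by (intro L2m_scale L2m_add) (auto simp: S_def)
      moreover have fcm: "fc (\<lambda>z. (f z + g z) / 2) k = (fc f k + fc g k) / 2" for k
        using f g by (subst fc_divide, subst fc_add) (auto simp: S_def intro: circ.L2m_integrable L2(1))
      ultimately show ?thesis using f g unfolding S_def mem_Collect_eq fcm by simp
    qed
    show "closed2 M S" unfolding closed2_def
    proof (intro allI impI, elim conjE)
      fix s f assume s: "\<forall>i. s i \<in> S" and f: "f \<in> L2m M" and c: "conv2 M s f"
      have sL: "s i \<in> L2m M" for i using s by (auto simp: S_def)
      have "conv2 circ s f" unfolding conv2_def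
      proof (rule real_tendsto_sandwich[OF _ _ tendsto_const c[unfolded conv2_def]])
        show "\<forall>\<^sub>F n in sequentially. sqn circ (\<lambda>z. s n z - f z) \<le> sqn M (\<lambda>z. s n z - f z)"
          by (intro always_eventually allI L2(2) L2m_diff sL f)
      qed (simp add: sqn_nonneg)
      then have lim: "(\<lambda>i. fc (s i) k) \<longlonglongrightarrow> fc f k" for k
        by (intro fc_conv2 L2(1) sL f)
      have "fc f k = 0" if "k \<notin> nn n" for k
        using lim[of k] s that LIMSEQ_unique[OF _ tendsto_const[of 0 sequentially]] by (simp add: S_def)
      moreover have "fc f 0 = 1"
        using lim[of 0] s LIMSEQ_unique[OF _ tendsto_const[of 1 sequentially]] by (simp add: S_def)
      ultimately show "f \<in> S" using f by (simp add: S_def)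
    qed
  qed (rule that, assumption, blast)
  have KM: "K \<in> L2m M" and Knn: "\<And>k. k \<notin> nn n \<Longrightarrow> fc K k = 0" and K0: "fc K 0 = 1" using K(1) by (auto simp: S_def)
  have Kc: "K \<in> L2m circ" by (rule L2(1)[OF KM])
  have Km [measurable]: "K \<in> borel_measurable circ" using Kc by (rule L2m_meas)
  define u where "u z = W z * (cmod (K z))\<^sup>2" for z
  have um [measurable]: "u \<in> borel_measurable circ" unfolding u_def by measurable
  have ui: "integrable circ u" using KM LM unfolding u_def by blast
  define c where "c = sqn M K"
  \<comment> \<open>Adding a multiple of \<open>z powi k * K\<close> leaves the mean value at 1.
    Orthogonality of \<open>K\<close> to this function says that the \<open>k\<close>-th coefficient
    of \<open>W |K|^2\<close> vanishes.\<close>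
  have pos: "fc (\<lambda>z. complex_of_real (u z)) k = 0" if k: "k \<in> nn n" "k \<noteq> 0" for k
  proof -
    have hM: "(\<lambda>z. z powi k * K z) \<in> L2m M"
    proof (rule L2m_bounded_mult(1)[OF KM])
      show "AE z in M. cmod (z powi k) \<le> 1"
        unfolding M_def by (subst AE_density) (use powi_bounded[of k] in auto)
    qed measurable
    have hfc: "fc (\<lambda>z. z powi k * K z) j = fc K (j - k)" for j by (rule fc_shift) simp
    have "(LINT z|M. K z * cnj (z powi k * K z)) = 0"
    proof (rule L2m_minimizer_orthogonal[OF KM hM])
      fix b
      have bM: "(\<lambda>z. b * (z powi k * K z)) \<in> L2m M" by (rule L2m_scale[OF hM])
      have "fc (\<lambda>z. K z + b * (z powi k * K z)) j = fc K j + b * fc K (j - k)" for j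
        using fc_add[OF circ.L2m_integrable[OF Kc] circ.L2m_integrable[OF L2(1)[OF bM]], of j]
        unfolding fc_scale hfc .
      moreover have "fc K (j - k) = 0" if "j \<notin> nn n" for j
        using that nn_add[of "j - k" n k] k by (intro Knn) auto
      moreover have "fc K (0 - k) = 0" using k by (intro Knn) (auto simp: nn_def)
      ultimately have "(\<lambda>z. K z + b * (z powi k * K z)) \<in> S"
        using Knn K0 L2m_add[OF KM bM] unfolding S_def by simp
      then show "sqn M K \<le> sqn M (\<lambda>z. K z + b * (z powi k * K z))" by (rule K(2))
    qed
    moreover have "(LINT z|M. K z * cnj (z powi k * K z)) = fc (\<lambda>z. complex_of_real (u z)) k"
    proof -
      have "(LINT z|M. K z * cnj (z powi k * K z)) = (LINT z|circ. W z *\<^sub>R (K z * cnj (z powi k * K z)))"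
        by (rule intM) measurable
      also have "\<dots> = fc (\<lambda>z. complex_of_real (u z)) k" unfolding fc_def
      proof (rule integral_cong_AE)
        show "AE z in circ. W z *\<^sub>R (K z * cnj (z powi k * K z)) = complex_of_real (u z) * z powi - k"
          using AE_circ
        proof eventually_elim
          case (elim z)
          have "K z * cnj (K z) = complex_of_real ((cmod (K z))\<^sup>2)" by (simp add: complex_norm_square[symmetric])
          then show ?case using cnj_powi[OF elim, of k]
            by (simp add: u_def scaleR_conv_of_real mult_ac del: complex_cnj_power_int)
        qed
      qed measurable
      finally show ?thesis .
    qed
    ultimately show ?thesis by simp
  qed
  have Kinv: "AE z in circ. K (om n * z) = K z"
    by (rule supp_inv[OF n circ.L2m_integrable[OF Kc]]) (auto intro: Knn simp: nn_def)
  have "AE z in circ. complex_of_real (u z) - complex_of_real c = 0"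
  proof (rule fc_unique)
    show "integrable circ (\<lambda>z. complex_of_real (u z) - complex_of_real c)" using ui by simp
    fix k
    have *: "fc (\<lambda>z. complex_of_real (u z) - complex_of_real c) k = fc (\<lambda>z. complex_of_real (u z)) k - complex_of_real c * (if k = 0 then 1 else 0)"
      using fc_diff[of "\<lambda>z. complex_of_real (u z)" "\<lambda>z. complex_of_real c" k] ui fc_scale[of "complex_of_real c" "\<lambda>z. z powi 0" k] fc_powi[of 0 k]
      by auto
    \<comment> \<open>Coefficients at frequencies not divisible by \<open>n\<close> vanish by
      invariance, those at negative ones by conjugation, since \<open>u\<close> is real.\<close>
    have "fc (\<lambda>z. complex_of_real (u z)) k = complex_of_real c * (if k = 0 then 1 else 0)"
    proof (cases "int n dvd k")
      case False
      have "AE z in circ. complex_of_real (u (om n * z)) = complex_of_real (u z)"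
        using Kinv by eventually_elim (simp add: u_def W_def F(3))
      from inv_fc[OF n _ this False] False show ?thesis by auto
    next
      case True
      consider "k = 0" | "k > 0" | "k < 0" by linarith
      then show ?thesis
      proof cases
        case 1 then show ?thesis by (simp add: fc_def c_def sqM[OF Km] u_def[symmetric] integral_complex_of_real)
      next
        case 2 then show ?thesis using True pos[of k] by (auto simp: nn_def)
      next
        case 3 then show ?thesis using True pos[of "-k"] fc_real_uminus[OF um, of "-k"] by (auto simp: nn_def)
      qed
    qed
    with * show "fc (\<lambda>z. complex_of_real (u z) - complex_of_real c) k = 0" by simp
  qed
  then have uc: "AE z in circ. u z = c" by (auto elim!: eventually_mono simp flip: of_real_diff)
  \<comment> \<open>The constant function 1 competes, and its weighted norm is the integral of the
    weight.\<close>
  have cle: "c \<le> 1 + d * (LINT z|circ. F z)"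
  proof -
    have "c \<le> sqn M (\<lambda>z. 1)" unfolding c_def by (rule K(2)[OF one])
    also have "\<dots> = (LINT z|circ. W z)" by (subst sqM) auto
    also have "\<dots> = 1 + d * (LINT z|circ. F z)" unfolding W_def using F(1) by simp
    finally show ?thesis .
  qed
  have bnd: "AE z in circ. (cmod (K z))\<^sup>2 * (1 + d * F z) \<le> 1 + d * (LINT z|circ. F z)"
    using uc by eventually_elim (use cle in \<open>simp add: u_def W_def mult.commute\<close>)
  have "AE z in circ. cmod (K z) \<le> sqrt (1 + d * (LINT z|circ. F z))"
    using uc
  proof eventually_elim
    case (elim z)
    have "(cmod (K z))\<^sup>2 \<le> 1 + d * (LINT z|circ. F z)" using le[of K z] elim cle by (simp add: u_def)
    then show ?case by (rule real_le_rsqrt)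
  qed
  then have "K \<in> Linf" unfolding Linf_def using Km by blast
  then have "K \<in> HA (nn n)" using Knn by (simp add: HA_def)
  moreover have "sqn circ (\<lambda>z. K z - 1) \<le> d * (LINT z|circ. F z)"
  proof -
    \<comment> \<open>Because \<open>K\<close> has mean value 1, its squared distance to 1 is
      \<open>sqn circ K - 1\<close>.\<close>
    have "sqn circ (\<lambda>z. K z + (-1)) = sqn circ K + sqn circ (\<lambda>z. -1) + 2 * Re (LINT z|circ. K z * cnj (-1))"
      by (rule sqn_add[OF Kc circ.L2m_const])
    also have "(LINT z|circ. K z * cnj (-1)) = - 1" using K0 by (simp add: fc_def)
    also have "sqn circ (\<lambda>z. -1) = 1" by (simp add: sqn_def)
    finally show ?thesis using L2(2)[OF KM] cle by (simp add: c_def)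
  qed
  ultimately show thesis using bnd that by blast
qed

text \<open>\<open>F\<close> is invariant under the roots of unity and dominates
  \<open>|f| / n\<close>, so the extremal problem with weight \<open>1 + F / (m + 1)\<close>
  applies. Its solution \<open>K\<close> has \<open>|K|^2 F\<close> bounded for each
  \<open>m\<close> and tends to 1 in mean square. The multiplier is \<open>K^2\<close> because the
  bound controls the square of \<open>|K|\<close>.\<close>

lemma bounded_multipliers:
  assumes n: "n \<ge> 1" and f: "integrable circ f"
  obtains h C where "\<And>m. h m \<in> HA (nn n)" "\<And>m. AE z in circ. cmod (h m z) \<le> C"
    "AE z in circ. (\<lambda>m. h m z) \<longlonglongrightarrow> 1" "\<And>m. \<exists>B. AE z in circ. cmod (h m z) * cmod (f z) \<le> B"
proof -
  define G where "G = avg n (\<lambda>z. complex_of_real (cmod (f z)))"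
  define F where "F z = cmod (G z)" for z
  define I where "I = (LINT z|circ. F z)"
  have Gi: "integrable circ G" unfolding G_def by (intro avg_integrable) (use f in simp)
  have Fi: "integrable circ F" unfolding F_def using Gi by simp
  have F0: "F z \<ge> 0" for z by (simp add: F_def)
  have I0: "I \<ge> 0" unfolding I_def by (simp add: F0)
  have Finv: "F (om n * z) = F z" for z by (simp add: F_def G_def avg_inv[OF n])
  have fF: "cmod (f z) \<le> real n * F z" for z
  proof -
    have "real n * F z = (\<Sum>j<n. cmod (f (om n ^ j * z)))"
    proof -
      have "G z = complex_of_real ((\<Sum>j<n. cmod (f (om n ^ j * z))) / real n)" by (simp add: G_def avg_def)
      then have "F z = (\<Sum>j<n. cmod (f (om n ^ j * z))) / real n"
        unfolding F_def by (simp only: norm_of_real) (simp add: sum_nonneg)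
      then show ?thesis using n by simp
    qed
    moreover have "cmod (f (om n ^ 0 * z)) \<le> (\<Sum>j<n. cmod (f (om n ^ j * z)))"
      using n by (intro member_le_sum) auto
    ultimately show ?thesis by simp
  qed
  have "\<exists>K. K \<in> HA (nn n) \<and> (AE z in circ. (cmod (K z))\<^sup>2 * (1 + 1 / real (Suc m) * F z) \<le> 1 + 1 / real (Suc m) * I) \<and>
    sqn circ (\<lambda>z. K z - 1) \<le> 1 / real (Suc m) * I" for m
  proof -
    have "1 / real (Suc m) > 0" by simp
    from weighted_extremal[OF n Fi F0 Finv this] show ?thesis unfolding I_def[symmetric] by blast
  qed
  then have "\<forall>m. \<exists>K. K \<in> HA (nn n) \<and> (AE z in circ. (cmod (K z))\<^sup>2 * (1 + 1 / real (Suc m) * F z) \<le> 1 + 1 / real (Suc m) * I) \<and>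
    sqn circ (\<lambda>z. K z - 1) \<le> 1 / real (Suc m) * I" by (rule allI)
  from choice[OF this] obtain K where K': "\<forall>m. K m \<in> HA (nn n) \<and>
    (AE z in circ. (cmod (K m z))\<^sup>2 * (1 + 1 / real (Suc m) * F z) \<le> 1 + 1 / real (Suc m) * I) \<and>
    sqn circ (\<lambda>z. K m z - 1) \<le> 1 / real (Suc m) * I" by (elim exE)
  have K: "K m \<in> HA (nn n)" "AE z in circ. (cmod (K m z))\<^sup>2 * (1 + 1 / real (Suc m) * F z) \<le> 1 + 1 / real (Suc m) * I"
    "sqn circ (\<lambda>z. K m z - 1) \<le> 1 / real (Suc m) * I" for m using spec[OF K', of m] by simp_all
  have KL: "K m \<in> L2m circ" for m by (rule Linf_L2m[OF HA_Linf[OF K(1)]])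
  have "conv2 circ K (\<lambda>z. 1)" unfolding conv2_def
  proof (rule real_tendsto_sandwich[OF _ _ tendsto_const])
    show "\<forall>\<^sub>F m in sequentially. sqn circ (\<lambda>z. K m z - 1) \<le> 1 / real (Suc m) * I" using K(3) by auto
    have "(\<lambda>m. 1 / real (Suc m) * I) \<longlonglongrightarrow> 0 * I" by (intro tendsto_intros LIMSEQ_Suc[OF lim_1_over_n])
    then show "(\<lambda>m. 1 / real (Suc m) * I) \<longlonglongrightarrow> 0" by simp
  qed (simp add: sqn_nonneg)
  from conv2_AE_subseq[OF KL circ.L2m_const this] obtain \<phi> :: "nat \<Rightarrow> nat"
    where \<phi>: "AE z in circ. (\<lambda>m. K (\<phi> m) z) \<longlonglongrightarrow> 1" by metis
  have frac: "1 + 1 / real (Suc m) * I \<le> 1 + I" for m using I0 by (simp add: divide_le_eq mult_le_cancel_left1 algebra_simps)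
  show thesis
  proof (rule that[of "\<lambda>m z. K (\<phi> m) z * K (\<phi> m) z" "1 + I"])
    fix m
    show "(\<lambda>z. K (\<phi> m) z * K (\<phi> m) z) \<in> HA (nn n)" by (rule HA_mult[OF K(1) K(1)]) (rule nn_add)
    show "AE z in circ. cmod (K (\<phi> m) z * K (\<phi> m) z) \<le> 1 + I"
      using K(2)[of "\<phi> m"]
    proof eventually_elim
      case (elim z)
      have "(cmod (K (\<phi> m) z))\<^sup>2 * 1 \<le> (cmod (K (\<phi> m) z))\<^sup>2 * (1 + 1 / real (Suc (\<phi> m)) * F z)"
        using F0[of z] by (intro mult_left_mono) auto
      then show ?case using elim frac[of "\<phi> m"] by (simp add: norm_mult power2_eq_square)
    qed
    show "\<exists>B. AE z in circ. cmod (K (\<phi> m) z * K (\<phi> m) z) * cmod (f z) \<le> B"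
    proof (intro exI)
      show "AE z in circ. cmod (K (\<phi> m) z * K (\<phi> m) z) * cmod (f z) \<le> real n * real (Suc (\<phi> m)) * (1 + I)"
        using K(2)[of "\<phi> m"]
      proof eventually_elim
        case (elim z)
        let ?k = "(cmod (K (\<phi> m) z))\<^sup>2" and ?m = "real (Suc (\<phi> m))"
        have "?k * cmod (f z) \<le> ?k * (real n * F z)" by (intro mult_left_mono fF) auto
        also have "\<dots> = real n * ?m * (?k * (1 / ?m * F z))" by simp
        also have "\<dots> \<le> real n * ?m * (?k * (1 + 1 / ?m * F z))" by (intro mult_left_mono) auto
        also have "\<dots> \<le> real n * ?m * (1 + I)" using elim frac[of "\<phi> m"] by (intro mult_left_mono) auto
        finally show ?case by (simp add: norm_mult power2_eq_square)
      qed
    qed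
  next
    show "AE z in circ. (\<lambda>m. K (\<phi> m) z * K (\<phi> m) z) \<longlonglongrightarrow> 1"
      using \<phi> by eventually_elim (use tendsto_mult in fastforce)
  qed
qed

section \<open>Closures in the extended norm\<close>

lemma ennreal_tendsto_0_iff:
  fixes X :: "nat \<Rightarrow> ennreal"
  shows "X \<longlonglongrightarrow> 0 \<longleftrightarrow> (\<forall>e>0. \<forall>\<^sub>F i in sequentially. X i \<le> ennreal e)"
proof (intro iffI allI impI)
  fix e :: real assume "X \<longlonglongrightarrow> 0" "e > 0"
  then have "\<forall>\<^sub>F i in sequentially. X i < ennreal e" by (intro order_tendstoD(2)) auto
  then show "\<forall>\<^sub>F i in sequentially. X i \<le> ennreal e" by eventually_elim simp
next
  assume *: "\<forall>e>0. \<forall>\<^sub>F i in sequentially. X i \<le> ennreal e"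
  show "X \<longlonglongrightarrow> 0"
  proof (rule order_tendstoI)
    fix y :: ennreal assume "0 < y"
    then obtain e where e: "e > 0" "ennreal e < y"
    proof (cases y)
      case (real r)
      then show thesis using \<open>0 < y\<close> that[of "r/2"] by (auto simp: ennreal_less_iff)
    next
      case top then show thesis using that[of 1] by auto
    qed
    from *[rule_format, OF e(1)] show "\<forall>\<^sub>F i in sequentially. X i < y"
      by eventually_elim (use e(2) in auto)
  qed auto
qed

context rsn
begin

lemma acl_meas: "f \<in> acl \<alpha> S \<Longrightarrow> f \<in> borel_measurable circ" by (simp add: acl_def)

lemma aclI:
  assumes "f \<in> borel_measurable circ" "\<And>e. e > 0 \<Longrightarrow> \<exists>s\<in>S. ext (\<lambda>z. s z - f z) \<le> ennreal e"
  shows "f \<in> acl \<alpha> S"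
proof -
  have "\<exists>s\<in>S. ext (\<lambda>z. s z - f z) \<le> ennreal (1 / real (Suc i))" for i using assms(2)[of "1 / real (Suc i)"] by simp
  then obtain s where s: "\<And>i. s i \<in> S" "\<And>i. ext (\<lambda>z. s i z - f z) \<le> ennreal (1 / real (Suc i))" by metis
  have "(\<lambda>i. ext (\<lambda>z. s i z - f z)) \<longlonglongrightarrow> 0" unfolding ennreal_tendsto_0_iff
  proof (intro allI impI)
    fix e :: real assume e: "e > 0"
    have "\<forall>\<^sub>F i in sequentially. 1 / real (Suc i) < e"
      using order_tendstoD(2)[OF LIMSEQ_Suc[OF lim_1_over_n] e] .
    then show "\<forall>\<^sub>F i in sequentially. ext (\<lambda>z. s i z - f z) \<le> ennreal e"
    proof eventually_elim
      case (elim i)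
      show ?case by (rule order_trans[OF s(2)]) (use elim in \<open>intro ennreal_leI, simp\<close>)
    qed
  qed
  then show ?thesis using assms(1) s(1) unfolding acl_def by blast
qed

lemma aclD:
  assumes "f \<in> acl \<alpha> S" "e > 0" shows "\<exists>s\<in>S. ext (\<lambda>z. s z - f z) \<le> ennreal e"
proof -
  obtain s where s: "\<And>i. s i \<in> S" "(\<lambda>i. ext (\<lambda>z. s i z - f z)) \<longlonglongrightarrow> 0"
    using assms(1) unfolding acl_def by blast
  from s(2) assms(2) have "\<forall>\<^sub>F i in sequentially. ext (\<lambda>z. s i z - f z) \<le> ennreal e"
    unfolding ennreal_tendsto_0_iff by blast
  then obtain i where "ext (\<lambda>z. s i z - f z) \<le> ennreal e" by (auto simp: eventually_sequentially)
  with s(1) show ?thesis by blast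
qed

lemma aclI_seq:
  "f \<in> borel_measurable circ \<Longrightarrow> (\<And>i. s i \<in> S) \<Longrightarrow> (\<lambda>i. ext (\<lambda>z. s i z - f z)) \<longlonglongrightarrow> 0 \<Longrightarrow> f \<in> acl \<alpha> S"
  unfolding acl_def by blast

lemma ext_0: "ext (\<lambda>z. 0) = 0" by (simp add: ext_Linf a_zero)

text \<open>Closures see the approximating set only up to null sets; this exchanges
  \<open>HA (nn n)\<close> for \<open>Hinf_zn n\<close>.\<close>

lemma acl_AE_approx:
  assumes S: "\<And>s. s \<in> S \<Longrightarrow> \<exists>t\<in>T. AE z in circ. t z = s z" and f: "f \<in> acl \<alpha> S"
    and g: "g \<in> borel_measurable circ" "AE z in circ. f z = g z"
  shows "g \<in> acl \<alpha> T"
proof (rule aclI[OF g(1)])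
  fix e :: real assume "e > 0"
  then obtain s where s: "s \<in> S" "ext (\<lambda>z. s z - f z) \<le> ennreal e" using aclD[OF f] by blast
  obtain t where t: "t \<in> T" "AE z in circ. t z = s z" using S[OF s(1)] by blast
  have "ext (\<lambda>z. t z - g z) = ext (\<lambda>z. s z - f z)"
    by (rule ext_cong) (use t(2) g(2) in eventually_elim, simp)
  then show "\<exists>s\<in>T. ext (\<lambda>z. s z - g z) \<le> ennreal e" using s(2) t(1)
    by (intro bexI[of _ t]) simp_all
qed

lemma acl_cong: "f \<in> acl \<alpha> S \<Longrightarrow> g \<in> borel_measurable circ \<Longrightarrow> AE z in circ. f z = g z \<Longrightarrow> g \<in> acl \<alpha> S"
  by (rule acl_AE_approx[of S S]) auto

lemma acl_mono: "S \<subseteq> T \<Longrightarrow> f \<in> acl \<alpha> S \<Longrightarrow> f \<in> acl \<alpha> T"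
  unfolding acl_def by blast

lemma acl_sup: "f \<in> S \<Longrightarrow> f \<in> borel_measurable circ \<Longrightarrow> f \<in> acl \<alpha> S"
  by (rule aclI) (auto intro!: bexI[of _ f] simp: ext_0)

lemma ext_triangle:
  assumes [measurable]: "f \<in> borel_measurable circ" "g \<in> borel_measurable circ" "h \<in> borel_measurable circ"
  shows "ext (\<lambda>z. f z - h z) \<le> ext (\<lambda>z. f z - g z) + ext (\<lambda>z. g z - h z)"
proof -
  have "ext (\<lambda>z. (f z - g z) + (g z - h z)) \<le> ext (\<lambda>z. f z - g z) + ext (\<lambda>z. g z - h z)"
    by (rule ext_add) measurable
  then show ?thesis by simp
qed

lemma acl_acl:
  assumes S: "S \<subseteq> borel_measurable circ" and f: "f \<in> acl \<alpha> (acl \<alpha> S)" shows "f \<in> acl \<alpha> S"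
proof (rule aclI[OF acl_meas[OF f]])
  fix e :: real assume e: "e > 0"
  obtain g where g: "g \<in> acl \<alpha> S" "ext (\<lambda>z. g z - f z) \<le> ennreal (e/2)" using aclD[OF f, of "e/2"] e by auto
  obtain s where s: "s \<in> S" "ext (\<lambda>z. s z - g z) \<le> ennreal (e/2)" using aclD[OF g(1), of "e/2"] e by auto
  have "ext (\<lambda>z. s z - f z) \<le> ext (\<lambda>z. s z - g z) + ext (\<lambda>z. g z - f z)"
    using s(1) S acl_meas[OF g(1)] acl_meas[OF f] by (intro ext_triangle) auto
  also have "\<dots> \<le> ennreal (e/2) + ennreal (e/2)" by (intro add_mono s g)
  also have "\<dots> = ennreal e" using e by (simp flip: ennreal_plus)
  finally show "\<exists>s\<in>S. ext (\<lambda>z. s z - f z) \<le> ennreal e" using s(1) by blast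
qed

lemma acl_add:
  assumes S: "S \<subseteq> borel_measurable circ" and T: "T \<subseteq> borel_measurable circ"
    and a: "\<And>s t. s \<in> S \<Longrightarrow> t \<in> T \<Longrightarrow> (\<lambda>z. s z + t z) \<in> U"
    and f: "f \<in> acl \<alpha> S" and g: "g \<in> acl \<alpha> T"
  shows "(\<lambda>z. f z + g z) \<in> acl \<alpha> U"
proof (rule aclI)
  note [measurable] = acl_meas[OF f] acl_meas[OF g]
  show "(\<lambda>z. f z + g z) \<in> borel_measurable circ" by measurable
  fix e :: real assume e: "e > 0"
  obtain s where s: "s \<in> S" "ext (\<lambda>z. s z - f z) \<le> ennreal (e/2)" using aclD[OF f, of "e/2"] e by auto
  obtain t where t: "t \<in> T" "ext (\<lambda>z. t z - g z) \<le> ennreal (e/2)" using aclD[OF g, of "e/2"] e by auto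
  have [measurable]: "s \<in> borel_measurable circ" "t \<in> borel_measurable circ" using s(1) t(1) S T by auto
  have "ext (\<lambda>z. (s z - f z) + (t z - g z)) \<le> ext (\<lambda>z. s z - f z) + ext (\<lambda>z. t z - g z)" by (rule ext_add) measurable
  also have "\<dots> \<le> ennreal (e/2) + ennreal (e/2)" by (intro add_mono s t)
  also have "\<dots> = ennreal e" using e by (simp flip: ennreal_plus)
  finally have "ext (\<lambda>z. (s z + t z) - (f z + g z)) \<le> ennreal e" by (simp add: algebra_simps)
  then show "\<exists>s\<in>U. ext (\<lambda>z. s z - (f z + g z)) \<le> ennreal e" using a[OF s(1) t(1)] by (intro bexI[of _ "\<lambda>z. s z + t z"])
qed

lemma ext_mult_le:
  assumes "AE z in circ. cmod (h z) \<le> C" "C > 0" shows "ext (\<lambda>z. h z * f z) \<le> ennreal C * ext f"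
  by (rule ext_scale[OF _ assms(2)]) (use assms(1) in \<open>eventually_elim, simp add: norm_mult mult_right_mono\<close>)

lemma acl_mult:
  assumes h: "h \<in> Linf" and m: "\<And>s. s \<in> S \<Longrightarrow> (\<lambda>z. h z * s z) \<in> T" and f: "f \<in> acl \<alpha> S"
  shows "(\<lambda>z. h z * f z) \<in> acl \<alpha> T"
proof (rule aclI)
  note [measurable] = acl_meas[OF f] LinfD(1)[OF h]
  show "(\<lambda>z. h z * f z) \<in> borel_measurable circ" by measurable
  fix e :: real assume e: "e > 0"
  obtain C where C: "C > 0" "AE z in circ. cmod (h z) \<le> C" using LinfE[OF h] by blast
  obtain s where s: "s \<in> S" "ext (\<lambda>z. s z - f z) \<le> ennreal (e/C)" using aclD[OF f, of "e/C"] e C by auto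
  have "ext (\<lambda>z. h z * (s z - f z)) \<le> ennreal C * ext (\<lambda>z. s z - f z)" by (rule ext_mult_le[OF C(2,1)])
  also have "\<dots> \<le> ennreal C * ennreal (e/C)" by (intro mult_left_mono s) auto
  also have "\<dots> = ennreal e" using e C(1) by (simp flip: ennreal_mult')
  finally have "ext (\<lambda>z. h z * s z - h z * f z) \<le> ennreal e" by (simp add: right_diff_distrib)
  then show "\<exists>s\<in>T. ext (\<lambda>z. s z - h z * f z) \<le> ennreal e" using m[OF s(1)] by (intro bexI[of _ "\<lambda>z. h z * s z"])
qed

lemma acl_integrable:
  assumes f: "f \<in> acl \<alpha> Linf" shows "integrable circ f"
proof -
  note [measurable] = acl_meas[OF f]
  obtain s where s: "s \<in> Linf" "ext (\<lambda>z. s z - f z) \<le> ennreal 1" using aclD[OF f, of 1] by auto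
  note [measurable] = LinfD(1)[OF s(1)]
  have "(\<integral>\<^sup>+ z. ennreal (cmod (s z - f z)) \<partial>circ) \<le> ext (\<lambda>z. s z - f z)" by (rule ext_ge_L1) measurable
  also have "\<dots> \<le> ennreal 1" by fact
  finally have "integrable circ (\<lambda>z. s z - f z)" by (intro integrableI_bounded) (auto intro: le_less_trans)
  from Bochner_Integration.integrable_diff[OF Linf_integrable[OF s(1)] this] show ?thesis by simp
qed

lemma fc_diff_le_ext:
  assumes "integrable circ f" "integrable circ g"
  shows "ennreal (cmod (fc f k - fc g k)) \<le> ext (\<lambda>z. f z - g z)"
proof -
  have i: "integrable circ (\<lambda>z. f z - g z)" using assms by simp
  have "cmod (fc f k - fc g k) \<le> (LINT z|circ. cmod (f z - g z))" using fc_norm_le[OF i, of k] fc_diff[OF assms] by simp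
  then have "ennreal (cmod (fc f k - fc g k)) \<le> ennreal (LINT z|circ. cmod (f z - g z))" by (rule ennreal_leI)
  also have "\<dots> = (\<integral>\<^sup>+ z. ennreal (cmod (f z - g z)) \<partial>circ)"
    using i by (subst nn_integral_eq_integral) auto
  also have "\<dots> \<le> ext (\<lambda>z. f z - g z)" using i by (intro ext_ge_L1) auto
  finally show ?thesis .
qed

text \<open>By \<open>fc_diff_le_ext\<close> each Fourier coefficient is continuous for \<alpha>, so
  the vanishing of coefficients outside \<open>A\<close> survives \<alpha>-limits.\<close>

lemma acl_fc:
  assumes S: "S \<subseteq> HA A" and f: "f \<in> acl \<alpha> S" and k: "k \<notin> A" shows "fc f k = 0"
proof -
  have "S \<subseteq> Linf" using S HA_Linf by auto
  then have fi: "integrable circ f" using acl_integrable acl_mono f by blast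
  have "cmod (fc f k) \<le> 0 + e" if e: "e > 0" for e
  proof -
    obtain s where s: "s \<in> S" "ext (\<lambda>z. s z - f z) \<le> ennreal e" using aclD[OF f e] by blast
    have "integrable circ s" using s(1) S by (auto intro: Linf_integrable HA_Linf)
    from order_trans[OF fc_diff_le_ext[OF this fi, of k] s(2)]
    have "cmod (fc s k - fc f k) \<le> e" using e by (simp add: ennreal_le_iff)
    moreover have "fc s k = 0" using s(1) S k by (auto intro: HA_fc)
    ultimately show ?thesis by simp
  qed
  then have "cmod (fc f k) \<le> 0" by (rule field_le_epsilon)
  then show ?thesis by simp
qed

text \<open>Dominated convergence for unbounded \<open>f\<close>: replace \<open>f\<close> by a
  bounded \<open>s\<close> close in \<alpha>, at a cost controlled by the uniform bound on the
  multipliers, and apply \<open>a_tendsto_0\<close> to the products with \<open>s\<close>.\<close>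

lemma ext_dominated:
  assumes f: "f \<in> acl \<alpha> Linf" and h [measurable]: "\<And>i. h i \<in> borel_measurable circ"
    and b: "\<And>i. AE z in circ. cmod (h i z) \<le> C" and l: "AE z in circ. (\<lambda>i. h i z) \<longlonglongrightarrow> c"
  shows "(\<lambda>i. ext (\<lambda>z. h i z * f z - c * f z)) \<longlonglongrightarrow> 0"
  unfolding ennreal_tendsto_0_iff
proof (intro allI impI)
  fix e :: real assume e: "e > 0"
  note [measurable] = acl_meas[OF f]
  define B where "B = max 1 (\<bar>C\<bar> + cmod c)"
  have B: "B > 0" by (simp add: B_def)
  have hb: "AE z in circ. cmod (h i z - c) \<le> B" for i
    using b[of i]
  proof eventually_elim
    case (elim z)
    then show ?case using norm_triangle_ineq4[of "h i z" c] unfolding B_def by linarith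
  qed
  obtain s where s: "s \<in> Linf" "ext (\<lambda>z. s z - f z) \<le> ennreal (e / (2 * B))" using aclD[OF f, of "e / (2 * B)"] e B by auto
  note [measurable] = LinfD(1)[OF s(1)]
  obtain D where D: "D > 0" "AE z in circ. cmod (s z) \<le> D" using LinfE[OF s(1)] by blast
  have "(\<lambda>i. \<alpha> (\<lambda>z. (h i z - c) * s z)) \<longlonglongrightarrow> 0"
  proof (rule a_tendsto_0)
    show "AE z in circ. cmod ((h i z - c) * s z) \<le> B * D" for i
      using hb[of i] D(2) by eventually_elim (use B in \<open>auto simp: norm_mult intro!: mult_mono\<close>)
    show "AE z in circ. (\<lambda>i. (h i z - c) * s z) \<longlonglongrightarrow> 0"
      using l
    proof eventually_elim
      case (elim z)
      have "(\<lambda>i. (h i z - c) * s z) \<longlonglongrightarrow> (c - c) * s z" by (intro tendsto_intros elim)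
      then show ?case by simp
    qed
  qed measurable
  from order_tendstoD(2)[OF this half_gt_zero[OF e]]
  have "\<forall>\<^sub>F i in sequentially. \<alpha> (\<lambda>z. (h i z - c) * s z) < e / 2" .
  then show "\<forall>\<^sub>F i in sequentially. ext (\<lambda>z. h i z * f z - c * f z) \<le> ennreal e"
  proof eventually_elim
    case (elim i)
    have L: "(\<lambda>z. (h i z - c) * s z) \<in> Linf"
    proof (rule Linf_mult[OF _ s(1)])
      show "(\<lambda>z. h i z - c) \<in> Linf" unfolding Linf_def using hb[of i] by auto
    qed
    have "ext (\<lambda>z. h i z * f z - c * f z) = ext (\<lambda>z. (h i z - c) * s z + (h i z - c) * (f z - s z))"
      by (simp add: algebra_simps)
    also have "\<dots> \<le> ext (\<lambda>z. (h i z - c) * s z) + ext (\<lambda>z. (h i z - c) * (f z - s z))" by (rule ext_add) measurable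
    also have "\<dots> \<le> ennreal (e/2) + ennreal (e/2)"
    proof (rule add_mono)
      show "ext (\<lambda>z. (h i z - c) * s z) \<le> ennreal (e/2)" unfolding ext_Linf[OF L] using elim by (intro ennreal_leI) simp
      have "ext (\<lambda>z. (h i z - c) * (f z - s z)) \<le> ennreal B * ext (\<lambda>z. f z - s z)" by (rule ext_mult_le[OF hb B])
      also have "\<dots> \<le> ennreal B * ennreal (e / (2 * B))" using s(2) by (intro mult_left_mono) (auto simp: ext_minus_commute[of f s])
      also have "\<dots> = ennreal (e/2)" using e B by (simp flip: ennreal_mult')
      finally show "ext (\<lambda>z. (h i z - c) * (f z - s z)) \<le> ennreal (e/2)" .
    qed
    also have "\<dots> = ennreal e" using e by (simp flip: ennreal_plus)
    finally show ?case .
  qed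
qed

end

section \<open>Wandering functions in invariant subspaces\<close>

lemma AE_circ_exists: "AE z in circ. P z \<Longrightarrow> \<exists>z. P z"
proof -
  assume "AE z in circ. P z"
  moreover have "ae_filter circ \<noteq> bot" by (simp add: ae_filter_eq_bot_iff emeasure_circ_UNIV)
  ultimately show ?thesis using eventually_happens' by blast
qed

text \<open>Each column of \<open>r\<close> orthogonal rows of squared length \<open>n\<close> has
  squared length at most \<open>n\<close> (Bessel); adding up all entries by rows and by columns
  gives \<open>r n <= n^2\<close>.\<close>

lemma orthogonal_rows_le:
  fixes a :: "nat \<Rightarrow> nat \<Rightarrow> complex"
  assumes o: "\<And>i j. i < r \<Longrightarrow> j < r \<Longrightarrow> (\<Sum>l<n. a i l * cnj (a j l)) = (if i = j then of_nat n else 0)"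
    and n: "n \<ge> 1"
  shows "r \<le> n"
proof -
  have col: "(\<Sum>i<r. (cmod (a i l))\<^sup>2) \<le> real n" if l: "l < n" for l
  proof -
    define t where "t = (\<Sum>i<r. (cmod (a i l))\<^sup>2)"
    \<comment> \<open>\<open>x\<close> is \<open>n\<close> times the orthogonal projection of the
      \<open>l\<close>-th unit vector onto the span of the rows. Its \<open>l\<close>-th entry is
      \<open>t\<close> and its squared length \<open>n t\<close>, whence
      \<open>t^2 <= n t\<close>.\<close>
    define x where "x m = (\<Sum>i<r. cnj (a i l) * a i m)" for m
    have xl: "x l = complex_of_real t"
      by (simp add: x_def t_def complex_norm_square mult.commute del: of_real_power)
    have "(\<Sum>m<n. x m * cnj (x m)) = (\<Sum>m<n. \<Sum>i<r. \<Sum>j<r. (cnj (a i l) * a j l) * (a i m * cnj (a j m)))"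
      by (simp add: x_def sum_product mult_ac)
    also have "\<dots> = (\<Sum>i<r. \<Sum>j<r. \<Sum>m<n. (cnj (a i l) * a j l) * (a i m * cnj (a j m)))"
      by (subst sum.swap) (intro sum.cong refl sum.swap)
    also have "\<dots> = (\<Sum>i<r. \<Sum>j<r. (cnj (a i l) * a j l) * (if i = j then of_nat n else 0))"
      unfolding sum_distrib_left[symmetric] by (intro sum.cong refl) (simp add: o)
    also have "\<dots> = (\<Sum>i<r. (cnj (a i l) * a i l) * of_nat n)"
      by (simp add: if_distrib[of "\<lambda>x. _ * x"] cong: if_cong)
    also have "\<dots> = of_nat n * complex_of_real t"
      by (simp add: t_def sum_distrib_left complex_norm_square mult_ac del: of_real_power)
    finally have "complex_of_real (\<Sum>m<n. (cmod (x m))\<^sup>2) = complex_of_real (real n * t)"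
      by (simp add: complex_norm_square del: of_real_power)
    then have "(\<Sum>m<n. (cmod (x m))\<^sup>2) = real n * t" unfolding of_real_eq_iff .
    moreover have "(cmod (x l))\<^sup>2 \<le> (\<Sum>m<n. (cmod (x m))\<^sup>2)" using l by (intro member_le_sum) auto
    ultimately have "t * t \<le> real n * t" using xl by (simp add: power2_eq_square)
    moreover have "t \<ge> 0" by (simp add: t_def sum_nonneg)
    ultimately show ?thesis unfolding t_def[symmetric] by (cases "t = 0") (auto simp: mult_le_cancel_right)
  qed
  have "real r * real n = (\<Sum>i<r. \<Sum>l<n. (cmod (a i l))\<^sup>2)"
  proof -
    have "(\<Sum>l<n. (cmod (a i l))\<^sup>2) = real n" if "i < r" for i
    proof -
      have "complex_of_real (\<Sum>l<n. (cmod (a i l))\<^sup>2) = complex_of_real (real n)"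
        using o[OF that that] by (simp add: complex_norm_square del: of_real_power)
      then show ?thesis unfolding of_real_eq_iff .
    qed
    then show ?thesis by simp
  qed
  also have "\<dots> = (\<Sum>l<n. \<Sum>i<r. (cmod (a i l))\<^sup>2)" by (rule sum.swap)
  also have "\<dots> \<le> (\<Sum>l<n. real n)" by (intro sum_mono col) simp
  finally have "real r * real n \<le> real n * real n" by simp
  then show ?thesis using n by simp
qed

section \<open>Averages of square-integrable functions\<close>

lemma L2m_rot: "cmod w = 1 \<Longrightarrow> f \<in> L2m circ \<Longrightarrow> (\<lambda>z. f (w * z)) \<in> L2m circ"
  using integrable_circ_rot[of w "\<lambda>z. (cmod (f z))\<^sup>2"] measurable_rot[of f w] by (auto simp: L2m_def)

lemma avg_L2m: "f \<in> L2m circ \<Longrightarrow> avg n f \<in> L2m circ"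
proof -
  assume f: "f \<in> L2m circ"
  have "(\<lambda>z. \<Sum>j<n. f (om n ^ j * z)) \<in> L2m circ" by (rule L2m_sum, rule L2m_rot) (simp_all add: f)
  from L2m_scale[OF this, of "inverse (of_nat n)"] show ?thesis by (simp add: avg_def[abs_def] field_simps)
qed

lemma Linf_mult_L2m: "f \<in> Linf \<Longrightarrow> g \<in> L2m circ \<Longrightarrow> (\<lambda>z. f z * g z) \<in> L2m circ"
proof -
  assume f: "f \<in> Linf" and g: "g \<in> L2m circ"
  obtain C where "AE z in circ. cmod (f z) \<le> C" using LinfD(2)[OF f] by blast
  from L2m_bounded_mult(1)[OF g LinfD(1)[OF f] this] show ?thesis .
qed

lemma closed2D: "closed2 M S \<Longrightarrow> (\<And>i. s i \<in> S) \<Longrightarrow> f \<in> L2m M \<Longrightarrow> conv2 M s f \<Longrightarrow> f \<in> S"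
  unfolding closed2_def by (drule spec[of _ s], drule spec[of _ f]) simp

lemma powi_mult_Suc: "(z::complex) powi (int n * int (Suc m)) = z powi int n * z powi (int n * int m)"
proof -
  have "z powi int (n * Suc m) = z powi int n * z powi int (n * m)" unfolding power_int_of_nat by (simp add: power_add)
  then show ?thesis by (simp only: of_nat_mult)
qed

lemma integral_avg: "n \<ge> 1 \<Longrightarrow> integrable circ f \<Longrightarrow> (LINT z|circ. avg n f z) = (LINT z|circ. f z)"
  using fc_avg[of n f 0] by (simp add: fc_def)

text \<open>Translates a pointwise identity for the function-valued inner product into conditions on
  coefficients at multiples of \<open>n\<close>, which orthogonality arguments can reach.\<close>

lemma avg_eq_const_iff:
  assumes n: "n \<ge> 1" and h: "integrable circ h"
  shows "(AE z in circ. avg n h z = c) \<longleftrightarrow> (\<forall>k. int n dvd k \<longrightarrow> fc h k = (if k = 0 then c else 0))"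
proof -
  have cfc: "fc (\<lambda>z. c) k = (if k = 0 then c else 0)" for k
    using fc_scale[of c "\<lambda>z. z powi 0" k] fc_powi[of 0 k] by auto
  have ai: "integrable circ (avg n h)" by (rule avg_integrable[OF h])
  show ?thesis
  proof (intro iffI allI impI)
    fix k assume "AE z in circ. avg n h z = c" and k: "int n dvd k"
    then have "fc (avg n h) k = fc (\<lambda>z. c) k" by (intro fc_cong_AE) (use ai in auto)
    then show "fc h k = (if k = 0 then c else 0)" using fc_avg[OF n h, of k] k cfc by simp
  next
    assume *: "\<forall>k. int n dvd k \<longrightarrow> fc h k = (if k = 0 then c else 0)"
    have "AE z in circ. avg n h z - c = 0"
    proof (rule fc_unique)
      show "integrable circ (\<lambda>z. avg n h z - c)" using ai by simp
      fix k
      have "fc (\<lambda>z. avg n h z - c) k = fc (avg n h) k - fc (\<lambda>z. c) k" by (rule fc_diff[OF ai]) simp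
      then show "fc (\<lambda>z. avg n h z - c) k = 0" using * fc_avg[OF n h, of k] cfc by auto
    qed
    then show "AE z in circ. avg n h z = c" by auto
  qed
qed

text \<open>\<open>|K|^2\<close> is one of \<open>n\<close> nonnegative terms whose sum over the
  orbit is \<open>n c\<close>.\<close>

lemma avg_square_bounded:
  assumes n: "n \<ge> 1" and Km: "K \<in> borel_measurable circ"
    and a: "AE z in circ. avg n (\<lambda>z. K z * cnj (K z)) z = complex_of_real c"
  shows "K \<in> Linf"
proof -
  have "AE z in circ. cmod (K z) \<le> sqrt (real n * c)"
    using a
  proof eventually_elim
    case (elim z)
    have "complex_of_real (\<Sum>j<n. (cmod (K (om n ^ j * z)))\<^sup>2) = complex_of_real (real n * c)"
      using elim n by (simp add: avg_def complex_norm_square field_simps del: of_real_power)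
    then have "(\<Sum>j<n. (cmod (K (om n ^ j * z)))\<^sup>2) = real n * c" unfolding of_real_eq_iff .
    moreover have "(cmod (K (om n ^ 0 * z)))\<^sup>2 \<le> (\<Sum>j<n. (cmod (K (om n ^ j * z)))\<^sup>2)"
      using n by (intro member_le_sum) auto
    ultimately show ?case by (intro real_le_rsqrt) simp
  qed
  then show ?thesis using Km unfolding Linf_def by blast
qed

section \<open>Shift-invariant closed subspaces of H2\<close>

locale zn_invariant =
  fixes n :: nat and N :: "(complex \<Rightarrow> complex) set"
  assumes n: "n \<ge> 1" and NL: "N \<subseteq> L2m circ" and Ncl: "closed2 circ N"
    and Nadd: "\<And>f g. f \<in> N \<Longrightarrow> g \<in> N \<Longrightarrow> (\<lambda>z. f z + g z) \<in> N"
    and Nsc: "\<And>f c. f \<in> N \<Longrightarrow> (\<lambda>z. c * f z) \<in> N"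
    and Nsh: "\<And>f. f \<in> N \<Longrightarrow> (\<lambda>z. z powi int n * f z) \<in> N"
    and Npos: "\<And>f k. f \<in> N \<Longrightarrow> k < 0 \<Longrightarrow> fc f k = 0"
    and N0: "(\<lambda>z. 0) \<in> N"
begin

lemma NL': "f \<in> N \<Longrightarrow> f \<in> L2m circ" using NL by auto

lemma Nsum: "finite I \<Longrightarrow> (\<And>i. i \<in> I \<Longrightarrow> f i \<in> N) \<Longrightarrow> (\<lambda>z. \<Sum>i\<in>I. f i z) \<in> N"
  by (induction I rule: finite_induct) (auto intro: N0 Nadd)

lemma Nshift: "f \<in> N \<Longrightarrow> (\<lambda>z. z powi (int n * int m) * f z) \<in> N"
proof (induction m)
  case (Suc m)
  have "(\<lambda>z. z powi int n * (z powi (int n * int m) * f z)) \<in> N" using Nsh Suc by blast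
  then show ?case by (simp only: powi_mult_Suc mult.assoc)
qed simp

text \<open>Polynomials in \<open>z^n\<close> times \<open>J\<close> stay in \<open>N\<close> by
  shifts and sums. Boundedness of \<open>J\<close> makes multiplication by it mean-square
  continuous, so closedness of \<open>N\<close> admits square-integrable factors
  \<open>g\<close>.\<close>

lemma Nmult:
  assumes J: "J \<in> N" "J \<in> Linf" and g: "g \<in> L2m circ" "\<And>k. k \<notin> nn n \<Longrightarrow> fc g k = 0"
  shows "(\<lambda>z. J z * g z) \<in> N"
proof -
  obtain t where t: "\<And>i. t i \<in> trigp (nn n)" "conv2 circ t g"
    using cl2_seq[OF trigp_dense[OF g]] by metis
  have "(\<lambda>z. J z * u z) \<in> N" if "u \<in> trigp (nn n)" for u
    using that
  proof (induction rule: trigp.induct)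
    case zero show ?case using N0 by simp
  next
    case (mono k c)
    then obtain m where m: "k = int n * int m" using n by (auto simp: nn_def dvd_def zero_le_mult_iff) (metis nonneg_int_cases)
    have "(\<lambda>z. c * (z powi (int n * int m) * J z)) \<in> N" by (intro Nsc Nshift J)
    then show ?case by (simp add: m mult_ac)
  next
    case (add u v)
    from Nadd[OF add.IH] show ?case by (simp add: distrib_left)
  qed
  from this[OF t(1)] have JN: "(\<lambda>z. J z * t i z) \<in> N" for i .
  obtain C where C: "AE z in circ. cmod (J z) \<le> C" using LinfD(2)[OF J(2)] by blast
  have "conv2 circ (\<lambda>i z. J z * t i z) (\<lambda>z. J z * g z)" unfolding conv2_def
  proof (rule real_tendsto_sandwich[OF _ _ tendsto_const])
    have "sqn circ (\<lambda>z. J z * t i z - J z * g z) \<le> C\<^sup>2 * sqn circ (\<lambda>z. t i z - g z)" for i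
      using L2m_bounded_mult(2)[OF L2m_diff[OF trigp_L2m[OF t(1)[of i]] g(1)] LinfD(1)[OF J(2)] C]
      by (simp add: right_diff_distrib)
    then show "\<forall>\<^sub>F i in sequentially. sqn circ (\<lambda>z. J z * t i z - J z * g z) \<le> C\<^sup>2 * sqn circ (\<lambda>z. t i z - g z)" by auto
    have "(\<lambda>i. C\<^sup>2 * sqn circ (\<lambda>z. t i z - g z)) \<longlonglongrightarrow> C\<^sup>2 * 0"
      using t(2) unfolding conv2_def by (intro tendsto_intros)
    then show "(\<lambda>i. C\<^sup>2 * sqn circ (\<lambda>z. t i z - g z)) \<longlonglongrightarrow> 0" by simp
  qed (simp add: sqn_nonneg)
  from closed2D[OF Ncl JN Linf_mult_L2m[OF J(2) g(1)] this] show ?thesis .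
qed

text \<open>The second condition says that at almost every point the vectors of values on the orbit
  are orthonormal up to scaling by \<open>n\<close>. The third puts each \<open>J j\<close> in the
  wandering subspace, the orthogonal complement of \<open>z^n N\<close> in \<open>N\<close>.\<close>

definition fam :: "nat \<Rightarrow> (nat \<Rightarrow> complex \<Rightarrow> complex) \<Rightarrow> bool" where
  "fam r J \<longleftrightarrow> (\<forall>j<r. J j \<in> N) \<and>
    (\<forall>i<r. \<forall>j<r. AE z in circ. avg n (\<lambda>z. J i z * cnj (J j z)) z = (if i = j then 1 else 0)) \<and>
    (\<forall>j<r. \<forall>f\<in>N. (LINT z|circ. z powi int n * f z * cnj (J j z)) = 0)"

definition cf :: "(complex \<Rightarrow> complex) \<Rightarrow> (complex \<Rightarrow> complex) \<Rightarrow> complex \<Rightarrow> complex" where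
  "cf f K = avg n (\<lambda>z. f z * cnj (K z))"

lemma fam_N: "fam r J \<Longrightarrow> j < r \<Longrightarrow> J j \<in> N" unfolding fam_def by blast

lemma fam_avg:
  assumes "fam r J" "i < r" "j < r"
  shows "AE z in circ. avg n (\<lambda>z. J i z * cnj (J j z)) z = (if i = j then 1 else 0)"
  using assms unfolding fam_def by blast

lemma fam_orth: "fam r J \<Longrightarrow> j < r \<Longrightarrow> f \<in> N \<Longrightarrow> (LINT z|circ. z powi int n * f z * cnj (J j z)) = 0"
  unfolding fam_def by blast

lemma fam_Linf:
  assumes "fam r J" "j < r" shows "J j \<in> Linf"
proof (rule avg_square_bounded[OF n, of _ 1])
  show "J j \<in> borel_measurable circ" by (rule L2m_meas[OF NL'[OF fam_N[OF assms]]])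
  show "AE z in circ. avg n (\<lambda>z. J j z * cnj (J j z)) z = complex_of_real 1" using fam_avg[OF assms assms(2)] by simp
qed

lemma fam_le: "fam r J \<Longrightarrow> r \<le> n"
proof -
  assume J: "fam r J"
  have "AE z in circ. \<forall>i\<in>{..<r}. \<forall>j\<in>{..<r}. avg n (\<lambda>z. J i z * cnj (J j z)) z = (if i = j then 1 else 0)"
    by (intro AE_finite_allI fam_avg[OF J]) auto
  from AE_circ_exists[OF this] obtain z where z: "\<And>i j. i < r \<Longrightarrow> j < r \<Longrightarrow> avg n (\<lambda>z. J i z * cnj (J j z)) z = (if i = j then 1 else 0)"
    by auto
  show ?thesis
  proof (rule orthogonal_rows_le[OF _ n])
    fix i j assume "i < r" "j < r"
    from z[OF this] n show "(\<Sum>l<n. J i (om n ^ l * z) * cnj (J j (om n ^ l * z))) = (if i = j then of_nat n else 0)"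
      by (auto simp: avg_def split: if_splits)
  qed
qed

lemma cf_L2m: "f \<in> L2m circ \<Longrightarrow> K \<in> Linf \<Longrightarrow> cf f K \<in> L2m circ"
  unfolding cf_def using Linf_mult_L2m[OF Linf_cnj, of K f] by (intro avg_L2m) (simp add: mult.commute)

lemma cf_inv: "cf f K (om n * z) = cf f K z"
  unfolding cf_def by (rule avg_inv[OF n])

text \<open>Being an average, the coefficient function has only frequencies divisible by
  \<open>n\<close>. Its coefficient at \<open>- n (m + 1)\<close> is the scalar product of
  \<open>z^n (z^(n m) f)\<close> with \<open>J j\<close>, and vanishes by the third condition in
  \<open>fam\<close>.\<close>

lemma cf_supp:
  assumes J: "fam r J" "j < r" and f: "f \<in> N" and k: "k \<notin> nn n"
  shows "fc (cf f (J j)) k = 0"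
proof -
  have i: "integrable circ (\<lambda>z. f z * cnj (J j z))"
    by (intro L2m_mult_integrable L2m_cnj NL' f fam_N[OF J])
  have JL [measurable]: "J j \<in> borel_measurable circ" using fam_Linf[OF J] by (rule LinfD)
  have [measurable]: "f \<in> borel_measurable circ" using NL'[OF f] by (rule L2m_meas)
  show ?thesis
  proof (cases "int n dvd k")
    case False then show ?thesis unfolding cf_def using fc_avg[OF n i, of k] by simp
  next
    case True
    then have "k < 0" using k by (auto simp: nn_def)
    with True obtain m where m: "k = - (int n * int (Suc m))"
    proof -
      obtain q where q: "k = int n * q" using True by (auto simp: dvd_def)
      then have "q < 0" using \<open>k < 0\<close> n by (auto simp: mult_less_0_iff)
      then have "q = - int (Suc (nat (- q - 1)))" by simp
      then show thesis using q that[of "nat (- q - 1)"] by (metis mult_minus_right)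
    qed
    have "fc (\<lambda>z. f z * cnj (J j z)) k = (LINT z|circ. z powi int n * (z powi (int n * int m) * f z) * cnj (J j z))"
      unfolding fc_def
    proof (rule Bochner_Integration.integral_cong[OF refl])
      fix z
      show "f z * cnj (J j z) * z powi - k = z powi int n * (z powi (int n * int m) * f z) * cnj (J j z)"
        unfolding m by (simp only: minus_minus powi_mult_Suc mult_ac)
    qed
    also have "\<dots> = 0" by (rule fam_orth[OF J Nshift[OF f]])
    finally show ?thesis unfolding cf_def using fc_avg[OF n i, of k] by simp
  qed
qed

lemma fam_part:
  assumes J: "fam r J" and f: "f \<in> N" and j: "j < r"
  shows "(\<lambda>z. J j z * cf f (J j) z) \<in> N"
  by (intro Nmult cf_L2m NL'[OF f] fam_Linf[OF J j] cf_supp[OF J j f] fam_N[OF J j])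

definition res :: "nat \<Rightarrow> (nat \<Rightarrow> complex \<Rightarrow> complex) \<Rightarrow> (complex \<Rightarrow> complex) \<Rightarrow> complex \<Rightarrow> complex" where
  "res r J f z = f z + (-1) * (\<Sum>j<r. J j z * cf f (J j) z)"

text \<open>The orthogonal complement of the family for the function-valued inner product. Written
  with coefficients, its conditions are mean-square continuous, which gives closedness.\<close>

definition N' :: "nat \<Rightarrow> (nat \<Rightarrow> complex \<Rightarrow> complex) \<Rightarrow> (complex \<Rightarrow> complex) set" where
  "N' r J = {f \<in> N. \<forall>j<r. \<forall>k. int n dvd k \<longrightarrow> fc (\<lambda>z. f z * cnj (J j z)) k = 0}"

lemma mult_cnj_integrable:
  assumes "fam r J" "j < r" "f \<in> N" shows "integrable circ (\<lambda>z. f z * cnj (J j z))"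
  by (intro L2m_mult_integrable L2m_cnj NL' assms(3) fam_N[OF assms(1,2)])

lemma N'_avg:
  assumes "fam r J" "j < r" "f \<in> N' r J" shows "AE z in circ. avg n (\<lambda>z. f z * cnj (J j z)) z = 0"
  using assms mult_cnj_integrable[OF assms(1,2), of f] by (subst avg_eq_const_iff[OF n]) (auto simp: N'_def)

text \<open>Gram-Schmidt with functions as scalars: the coefficients \<open>cf f (J j)\<close> are
  constant along orbits and leave the average, where orthonormality of the family removes all but
  one.\<close>

lemma res_N':
  assumes J: "fam r J" and f: "f \<in> N" shows "res r J f \<in> N' r J"
proof -
  have rN: "res r J f \<in> N" unfolding res_def[abs_def]
    by (intro Nadd f Nsc Nsum fam_part[OF J f]) auto
  have "\<forall>k. int n dvd k \<longrightarrow> fc (\<lambda>z. res r J f z * cnj (J i z)) k = (if k = 0 then 0 else 0)" if i: "i < r" for i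
  proof (subst avg_eq_const_iff[OF n mult_cnj_integrable[OF J i rN], symmetric])
    have "AE z in circ. \<forall>j\<in>{..<r}. avg n (\<lambda>z. J j z * cnj (J i z)) z = (if j = i then 1 else 0)"
      using i by (intro AE_finite_allI fam_avg[OF J]) auto
    then show "AE z in circ. avg n (\<lambda>z. res r J f z * cnj (J i z)) z = 0"
    proof eventually_elim
      case (elim z)
      have inv: "cf f (J j) (om n ^ l * z) = cf f (J j) z" for l j
      proof (induction l)
        case (Suc l) then show ?case using cf_inv[of f "J j" "om n ^ l * z"] by (simp add: mult.assoc)
      qed simp
      have "avg n (\<lambda>z. res r J f z * cnj (J i z)) z
          = cf f (J i) z - (\<Sum>j<r. cf f (J j) z * avg n (\<lambda>z. J j z * cnj (J i z)) z)"
      proof -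
        have "(\<Sum>l<n. res r J f (om n ^ l * z) * cnj (J i (om n ^ l * z))) =
          (\<Sum>l<n. f (om n ^ l * z) * cnj (J i (om n ^ l * z)))
          - (\<Sum>l<n. \<Sum>j<r. cf f (J j) z * (J j (om n ^ l * z) * cnj (J i (om n ^ l * z))))"
          unfolding sum_subtractf[symmetric]
        proof (rule sum.cong[OF refl])
          fix l
          have "(\<Sum>j<r. J j (om n ^ l * z) * cf f (J j) z) * cnj (J i (om n ^ l * z)) =
            (\<Sum>j<r. cf f (J j) z * (J j (om n ^ l * z) * cnj (J i (om n ^ l * z))))"
            unfolding sum_distrib_right by (intro sum.cong refl) (simp only: mult_ac)
          then show "res r J f (om n ^ l * z) * cnj (J i (om n ^ l * z)) =
            f (om n ^ l * z) * cnj (J i (om n ^ l * z)) - (\<Sum>j<r. cf f (J j) z * (J j (om n ^ l * z) * cnj (J i (om n ^ l * z))))"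
            by (simp only: res_def inv distrib_right mult_minus_left mult_1_left diff_conv_add_uminus)
        qed
        also have "(\<Sum>l<n. \<Sum>j<r. cf f (J j) z * (J j (om n ^ l * z) * cnj (J i (om n ^ l * z))))
          = (\<Sum>j<r. cf f (J j) z * (\<Sum>l<n. J j (om n ^ l * z) * cnj (J i (om n ^ l * z))))"
          by (subst sum.swap) (simp add: sum_distrib_left)
        finally show ?thesis unfolding avg_def cf_def[of f "J i"]
          by (simp only: diff_divide_distrib times_divide_eq_right)
            (subst sum_divide_distrib[of "\<lambda>j. cf f (J j) z * _ j"], rule refl)
      qed
      also have "(\<Sum>j<r. cf f (J j) z * avg n (\<lambda>z. J j z * cnj (J i z)) z) = (\<Sum>j<r. if j = i then cf f (J j) z else 0)"
        using elim by (intro sum.cong refl) auto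
      also have "\<dots> = cf f (J i) z" using i by simp
      finally show ?case by simp
    qed
  qed
  then show ?thesis using rN by (simp add: N'_def)
qed

lemma N'_lin:
  assumes J: "fam r J" and f: "f \<in> N' r J" and g: "g \<in> N' r J"
  shows "(\<lambda>z. f z + c * g z) \<in> N' r J"
proof -
  have fN: "f \<in> N" "g \<in> N" using f g by (auto simp: N'_def)
  have "fc (\<lambda>z. (f z + c * g z) * cnj (J j z)) k = 0" if j: "j < r" and k: "int n dvd k" for j k
  proof -
    have "fc (\<lambda>z. f z * cnj (J j z) + c * (g z * cnj (J j z))) k = fc (\<lambda>z. f z * cnj (J j z)) k + c * fc (\<lambda>z. g z * cnj (J j z)) k"
      using mult_cnj_integrable[OF J j fN(1)] mult_cnj_integrable[OF J j fN(2)] by (subst fc_add) (auto simp: fc_scale)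
    then show ?thesis using f g j k by (simp add: N'_def algebra_simps)
  qed
  then show ?thesis using Nadd[OF fN(1) Nsc[OF fN(2)]] by (simp add: N'_def)
qed

lemma N'_shift:
  assumes J: "fam r J" and f: "f \<in> N' r J" shows "(\<lambda>z. z powi (int n * int m) * f z) \<in> N' r J"
proof -
  have fN: "f \<in> N" using f by (auto simp: N'_def)
  have "fc (\<lambda>z. z powi (int n * int m) * f z * cnj (J j z)) k = 0" if j: "j < r" and k: "int n dvd k" for j k
  proof -
    have "fc (\<lambda>z. z powi (int n * int m) * (f z * cnj (J j z))) k = fc (\<lambda>z. f z * cnj (J j z)) (k - int n * int m)"
      using mult_cnj_integrable[OF J j fN] by (intro fc_shift) auto
    then show ?thesis using f j k by (simp add: N'_def mult.assoc)
  qed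
  then show ?thesis using Nshift[OF fN] by (simp add: N'_def)
qed

lemma N'_closed:
  assumes J: "fam r J" shows "closed2 circ (N' r J)"
  unfolding closed2_def
proof (intro allI impI, elim conjE)
  fix s f assume s: "\<forall>i. s i \<in> N' r J" and f: "f \<in> L2m circ" and c: "conv2 circ s f"
  have sN: "s i \<in> N" for i using s by (auto simp: N'_def)
  have fN: "f \<in> N" by (rule closed2D[OF Ncl sN f c])
  have "fc (\<lambda>z. f z * cnj (J j z)) k = 0" if j: "j < r" and k: "int n dvd k" for j k
  proof -
    have "J j \<in> L2m circ" by (rule NL'[OF fam_N[OF J j]])
    from L2m_powi_mult[OF L2m_cnj[OF this], of "-k"]
    have "(\<lambda>i. LINT z|circ. s i z * (z powi - k * cnj (J j z))) \<longlonglongrightarrow> (LINT z|circ. f z * (z powi - k * cnj (J j z)))"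
      by (intro conv2_tendsto_integral_mult[OF _ f c] NL'[OF sN])
    moreover have "(LINT z|circ. g z * (z powi - k * cnj (J j z))) = fc (\<lambda>z. g z * cnj (J j z)) k" for g
      unfolding fc_def by (rule Bochner_Integration.integral_cong[OF refl]) (simp only: mult_ac)
    moreover have "fc (\<lambda>z. s i z * cnj (J j z)) k = 0" for i using s j k by (auto simp: N'_def)
    ultimately have "(\<lambda>i. 0) \<longlonglongrightarrow> fc (\<lambda>z. f z * cnj (J j z)) k" by simp
    then show ?thesis using LIMSEQ_unique tendsto_const by blast
  qed
  then show "f \<in> N' r J" using fN by (simp add: N'_def)
qed

text \<open>The next member solves an extremal problem. With \<open>m\<close> the lowest frequency
  occurring in \<open>N' r J\<close>, let \<open>K\<close> have least norm among the elements with
  coefficient 1 at \<open>m\<close>. It is orthogonal to all elements without frequency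
  \<open>m\<close>, in particular to \<open>z^(n (l + 1)) h\<close> for \<open>h\<close> in
  \<open>N' r J\<close>; with \<open>h = K\<close> this makes the average of \<open>|K|^2\<close>
  constant.\<close>

lemma fam_extend:
  assumes J: "fam r J" and f: "f \<in> N' r J" and nz: "\<not> (AE z in circ. f z = 0)"
  shows "\<exists>J'. fam (Suc r) J'"
proof -
  have N'N: "g \<in> N" if "g \<in> N' r J" for g using that by (simp add: N'_def)
  have N'L: "g \<in> L2m circ" if "g \<in> N' r J" for g using N'N[OF that] by (rule NL')
  have ex: "\<exists>m::nat. \<exists>f\<in>N' r J. fc f (int m) \<noteq> 0"
  proof -
    obtain k where k: "fc f k \<noteq> 0" using fc_unique[OF circ.L2m_integrable[OF N'L[OF f]]] nz by blast
    then have "k \<ge> 0" using Npos[OF N'N[OF f]] by force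
    then show ?thesis using k f by (intro exI[of _ "nat k"] bexI[of _ f]) auto
  qed
  define m where "m = (LEAST m::nat. \<exists>f\<in>N' r J. fc f (int m) \<noteq> 0)"
  obtain p where p: "p \<in> N' r J" "fc p (int m) \<noteq> 0" using LeastI_ex[OF ex] unfolding m_def by blast
  have small: "fc g k = 0" if g: "g \<in> N' r J" and k: "k < int m" for g k
  proof (cases "k < 0")
    case True then show ?thesis using Npos[OF N'N[OF g]] by blast
  next
    case False
    then have "nat k < m" using k by simp
    from not_less_Least[OF this[unfolded m_def]] g False show ?thesis by auto
  qed
  define S where "S = {g \<in> N' r J. fc g (int m) = 1}"
  have zero: "(\<lambda>z. 0) \<in> N' r J" using N0 by (simp add: N'_def)
  have sc: "(\<lambda>z. c * g z) \<in> N' r J" if "g \<in> N' r J" for g c using N'_lin[OF J zero that, of c] by simp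
  have SL: "S \<subseteq> L2m circ" using N'L by (auto simp: S_def)
  obtain K where K: "K \<in> S" "\<And>g. g \<in> S \<Longrightarrow> sqn circ K \<le> sqn circ g"
  proof (rule circ.L2m_minimizer_exists[OF SL])
    have "(\<lambda>z. (1 / fc p (int m)) * p z) \<in> S" unfolding S_def mem_Collect_eq fc_scale using p by (simp only: sc) simp
    then show "S \<noteq> {}" by auto
    show "(\<lambda>z. (g z + h z) / 2) \<in> S" if g: "g \<in> S" and h: "h \<in> S" for g h
    proof -
      have gh: "g \<in> N' r J" "h \<in> N' r J" using g h by (auto simp: S_def)
      have "(\<lambda>z. (1/2) * (g z + 1 * h z)) \<in> N' r J" by (intro sc N'_lin[OF J] gh)
      moreover have "fc (\<lambda>z. (g z + h z) / 2) (int m) = (fc g (int m) + fc h (int m)) / 2"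
        using gh by (subst fc_divide, subst fc_add) (auto intro: circ.L2m_integrable N'L)
      ultimately show ?thesis using g h by (simp add: S_def)
    qed
    show "closed2 circ S" unfolding closed2_def
    proof (intro allI impI, elim conjE)
      fix s g assume s: "\<forall>i. s i \<in> S" and g: "g \<in> L2m circ" and c: "conv2 circ s g"
      have sN: "s i \<in> N' r J" "fc (s i) (int m) = 1" for i using s by (auto simp: S_def)
      have "g \<in> N' r J" by (rule closed2D[OF N'_closed[OF J] sN(1) g c])
      moreover have "(\<lambda>i. fc (s i) (int m)) \<longlonglongrightarrow> fc g (int m)" by (intro fc_conv2 g c N'L sN)
      then have "fc g (int m) = 1" unfolding sN(2) using LIMSEQ_unique tendsto_const by blast
      ultimately show "g \<in> S" by (simp add: S_def)
    qed
  qed (rule that, assumption, blast)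
  have KN': "K \<in> N' r J" and Km: "fc K (int m) = 1" using K(1) by (auto simp: S_def)
  have KN: "K \<in> N" and KL: "K \<in> L2m circ" using KN' N'N N'L by auto
  have Kmeas [measurable]: "K \<in> borel_measurable circ" using KL by (rule L2m_meas)
  have orth: "(LINT z|circ. K z * cnj (h z)) = 0" if h: "h \<in> N' r J" "fc h (int m) = 0" for h
  proof (rule L2m_minimizer_orthogonal[OF KL N'L[OF h(1)]])
    fix c
    have "fc (\<lambda>z. K z + c * h z) (int m) = fc K (int m) + c * fc h (int m)"
      using KN' h(1) by (subst fc_add) (auto simp: fc_scale intro!: circ.L2m_integrable N'L integrable_mult_right)
    then have "(\<lambda>z. K z + c * h z) \<in> S" using N'_lin[OF J KN' h(1), of c] Km h(2) by (simp add: S_def)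
    then show "sqn circ K \<le> sqn circ (\<lambda>z. K z + c * h z)" by (rule K(2))
  qed
  \<comment> \<open>A positive power of \<open>z^n\<close> pushes all frequencies of
    \<open>h\<close> above \<open>m\<close>, so the coefficient at \<open>m\<close>
    disappears.\<close>
  have orth': "(LINT z|circ. K z * cnj (z powi (int n * int (Suc l)) * h z)) = 0" if h: "h \<in> N' r J" for h l
  proof (rule orth[OF N'_shift[OF J h]])
    have "fc (\<lambda>z. z powi (int n * int (Suc l)) * h z) (int m) = fc h (int m - int n * int (Suc l))"
      using L2m_meas[OF N'L[OF h]] by (rule fc_shift)
    also have "\<dots> = 0"
    proof (rule small[OF h])
      have "int n * int (Suc l) > 0" using n by simp
      then show "int m - int n * int (Suc l) < int m" by linarith
    qed
    finally show "fc (\<lambda>z. z powi (int n * int (Suc l)) * h z) (int m) = 0" .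
  qed
  define c where "c = sqn circ K"
  have c0: "c > 0"
  proof -
    have "c \<noteq> 0"
    proof
      assume "c = 0"
      then have "AE z in circ. K z = 0" using sqn_eq_0_iff[OF KL] by (simp add: c_def)
      then have "fc K (int m) = fc (\<lambda>z. 0) (int m)" by (intro fc_cong_AE) auto
      then show False using Km by simp
    qed
    then show ?thesis using sqn_nonneg[of circ K] by (simp add: c_def)
  qed
  have KKi: "integrable circ (\<lambda>z. K z * cnj (K z))" by (intro L2m_mult_integrable KL L2m_cnj)
  have KK: "AE z in circ. avg n (\<lambda>z. K z * cnj (K z)) z = complex_of_real c"
    unfolding avg_eq_const_iff[OF n KKi]
  proof (intro allI impI)
    fix k assume k: "int n dvd k"
    have real: "(\<lambda>z. K z * cnj (K z)) = (\<lambda>z. complex_of_real ((cmod (K z))\<^sup>2))"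
      by (rule ext) (rule complex_norm_square[symmetric])
    have pos: "fc (\<lambda>z. K z * cnj (K z)) k = 0" if k: "int n dvd k" "k > 0" for k
    proof -
      obtain l where l: "k = int n * int (Suc l)"
      proof -
        obtain q where q: "k = int n * q" using k by (auto simp: dvd_def)
        then have "q > 0" using \<open>k > 0\<close> n by (auto simp: zero_less_mult_iff)
        then have "q = int (Suc (nat (q - 1)))" by simp
        then show thesis using q that[of "nat (q - 1)"] by metis
      qed
      have "fc (\<lambda>z. K z * cnj (K z)) k = (LINT z|circ. K z * cnj (z powi (int n * int (Suc l)) * K z))"
        unfolding fc_def
      proof (rule integral_cong_AE)
        show "AE z in circ. K z * cnj (K z) * z powi - k = K z * cnj (z powi (int n * int (Suc l)) * K z)"
          using AE_circ
        proof eventually_elim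
          case (elim z)
          show ?case unfolding l complex_cnj_mult cnj_powi[OF elim] by (simp only: mult_ac)
        qed
      qed measurable
      also have "\<dots> = 0" by (rule orth'[OF KN'])
      finally show ?thesis .
    qed
    consider "k = 0" | "k > 0" | "k < 0" by linarith
    then show "fc (\<lambda>z. K z * cnj (K z)) k = (if k = 0 then complex_of_real c else 0)"
    proof cases
      case 1 then show ?thesis using sqn_eq_inner[OF KL] by (simp add: fc_def c_def)
    next
      case 2 then show ?thesis using pos[OF k] by simp
    next
      case 3
      have "fc (\<lambda>z. K z * cnj (K z)) (- (- k)) = cnj (fc (\<lambda>z. K z * cnj (K z)) (- k))"
        unfolding real by (rule fc_real_uminus) measurable
      then show ?thesis using 3 pos[of "-k"] k by simp
    qed
  qed
  have KLinf: "K \<in> Linf" by (rule avg_square_bounded[OF n Kmeas KK])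
  define b where "b = complex_of_real (1 / sqrt c)"
  have bb: "b * b * complex_of_real c = 1" and bcnj: "cnj b = b"
    using c0 by (simp_all add: b_def flip: of_real_mult)
  define J' where "J' = J (r := (\<lambda>z. b * K z))"
  have J'r: "J' r = (\<lambda>z. b * K z)" and J'j: "\<And>j. j < r \<Longrightarrow> J' j = J j" by (auto simp: J'_def)
  have cross: "AE z in circ. avg n (\<lambda>z. K z * cnj (J j z)) z = 0" if "j < r" for j
    by (rule N'_avg[OF J that KN'])
  have avgsc: "avg n (\<lambda>z. a * g z) z = a * avg n g z" for a g z by (simp add: avg_def sum_distrib_left)
  have "fam (Suc r) J'" unfolding fam_def
  proof (intro conjI allI impI ballI)
    fix j assume j: "j < Suc r"
    show "J' j \<in> N" using j fam_N[OF J, of j] Nsc[OF KN] by (cases "j = r") (auto simp: J'r J'j)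
  next
    fix i j assume ij: "i < Suc r" "j < Suc r"
    consider "i = r" "j = r" | "i = r" "j < r" | "i < r" "j = r" | "i < r" "j < r" using ij by linarith
    then show "AE z in circ. avg n (\<lambda>z. J' i z * cnj (J' j z)) z = (if i = j then 1 else 0)"
    proof cases
      case 1
      have "(\<lambda>z. J' i z * cnj (J' j z)) = (\<lambda>z. (b * b) * (K z * cnj (K z)))" using 1 bcnj by (simp add: J'r mult_ac)
      then show ?thesis using KK 1 bb by (auto simp: avgsc elim!: eventually_mono)
    next
      case 2
      have "(\<lambda>z. J' i z * cnj (J' j z)) = (\<lambda>z. b * (K z * cnj (J j z)))" using 2 by (simp add: J'r J'j mult_ac)
      then show ?thesis using cross[of j] 2 by (auto simp: avgsc elim!: eventually_mono)
    next
      case 3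
      have eq: "(\<lambda>z. J' i z * cnj (J' j z)) = (\<lambda>z. b * cnj (K z * cnj (J i z)))" using 3 bcnj by (simp add: J'r J'j mult_ac)
      have cn: "avg n (\<lambda>z. cnj (g z)) z = cnj (avg n g z)" for g z by (simp add: avg_def)
      have "AE z in circ. avg n (\<lambda>z. J' i z * cnj (J' j z)) z = 0"
        using cross[of i, OF 3(1)] unfolding eq avgsc cn by (auto elim!: eventually_mono)
      then show ?thesis using 3 by simp
    next
      case 4 then show ?thesis unfolding J'j[OF 4(1)] J'j[OF 4(2)] by (intro fam_avg[OF J])
    qed
  next
    fix j f assume j: "j < Suc r" and f: "f \<in> N"
    show "(LINT z|circ. z powi int n * f z * cnj (J' j z)) = 0"
    proof (cases "j < r")
      case True then show ?thesis unfolding J'j[OF True] by (intro fam_orth[OF J _ f])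
    next
      case False
      then have jr: "j = r" using j by simp
      \<comment> \<open>Orthogonality of \<open>K\<close> to shifts is known on
        \<open>N' r J\<close> only, so \<open>f\<close> is split into its residue there and a
        combination of the \<open>J i\<close>. The latter contributes nothing: \<open>z^n\<close>
        times its coefficient is invariant, and the average of \<open>J i\<close> against the
        conjugate of \<open>K\<close> vanishes.\<close>
      define d where "d = res r J f"
      have dN: "d \<in> N' r J" unfolding d_def by (rule res_N'[OF J f])
      have fd: "f z = d z + (\<Sum>i<r. J i z * cf f (J i) z)" for z by (simp add: d_def res_def)
      note [measurable] = L2m_meas[OF N'L[OF dN]]
      have i1: "integrable circ (\<lambda>z. z powi int n * d z * cnj (K z))"
        by (intro L2m_mult_integrable L2m_powi_mult N'L[OF dN] L2m_cnj KL)
      have gL: "cf f (J i) \<in> L2m circ" if "i < r" for i by (intro cf_L2m NL'[OF f] fam_Linf[OF J that])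
      have i2: "integrable circ (\<lambda>z. (z powi int n * cf f (J i) z) * (J i z * cnj (K z)))" if "i < r" for i
        by (intro L2m_mult_integrable L2m_powi_mult gL that Linf_L2m Linf_mult fam_Linf[OF J that] Linf_cnj KLinf)
      have 1: "(LINT z|circ. z powi int n * d z * cnj (K z)) = 0"
      proof -
        have "(LINT z|circ. z powi int n * d z * cnj (K z)) = (LINT z|circ. cnj (K z * cnj (z powi (int n * int (Suc 0)) * d z)))"
          by (simp add: mult_ac)
        also have "\<dots> = cnj 0" unfolding Bochner_Integration.integral_cnj orth'[OF dN, of 0] ..
        finally show ?thesis by simp
      qed
      have 2: "(LINT z|circ. (z powi int n * cf f (J i) z) * (J i z * cnj (K z))) = 0" if i: "i < r" for i
      proof -
        have inv: "AE z in circ. (om n * z) powi int n * cf f (J i) (om n * z) = z powi int n * cf f (J i) z"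
          using om_power_n[OF n] by (simp add: cf_inv power_mult_distrib)
        have c0: "AE z in circ. avg n (\<lambda>z. J i z * cnj (K z)) z = 0"
          using cross[OF i]
        proof eventually_elim
          case (elim z)
          have "avg n (\<lambda>z. J i z * cnj (K z)) z = cnj (avg n (\<lambda>z. K z * cnj (J i z)) z)" by (simp add: avg_def mult.commute)
          then show ?case using elim by simp
        qed
        have "(LINT z|circ. (z powi int n * cf f (J i) z) * (J i z * cnj (K z))) =
          (LINT z|circ. avg n (\<lambda>z. (z powi int n * cf f (J i) z) * (J i z * cnj (K z))) z)"
          by (rule integral_avg[OF n i2[OF i], symmetric])
        also have "\<dots> = (LINT z|circ. 0)"
        proof (rule integral_cong_AE)
          show "AE z in circ. avg n (\<lambda>z. (z powi int n * cf f (J i) z) * (J i z * cnj (K z))) z = 0"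
            using avg_mult_inv[OF inv, of "\<lambda>z. J i z * cnj (K z)"] c0 by eventually_elim simp
        qed (use avg_integrable[OF i2[OF i], of n] in auto)
        finally show ?thesis by simp
      qed
      have "(LINT z|circ. z powi int n * f z * cnj (J' j z)) =
        (LINT z|circ. b * (z powi int n * d z * cnj (K z) + (\<Sum>i<r. (z powi int n * cf f (J i) z) * (J i z * cnj (K z)))))"
      proof (rule Bochner_Integration.integral_cong[OF refl])
        fix z
        have sm: "z powi int n * (\<Sum>i<r. J i z * cf f (J i) z) * cnj (K z) =
          (\<Sum>i<r. (z powi int n * cf f (J i) z) * (J i z * cnj (K z)))"
          unfolding sum_distrib_left sum_distrib_right by (rule sum.cong[OF refl]) (simp add: mult_ac)
        have gen: "x * (u + s) * (b * k) = b * (x * u * k + x * s * k)" for x u s k :: complex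
          by (simp add: algebra_simps)
        have "z powi int n * f z * cnj (J' j z) = z powi int n * (d z + (\<Sum>i<r. J i z * cf f (J i) z)) * (b * cnj (K z))"
          by (simp only: fd[of z] jr J'r complex_cnj_mult bcnj)
        then show "z powi int n * f z * cnj (J' j z) =
          b * (z powi int n * d z * cnj (K z) + (\<Sum>i<r. (z powi int n * cf f (J i) z) * (J i z * cnj (K z))))"
          unfolding gen sm .
      qed
      also have "\<dots> = b * ((LINT z|circ. z powi int n * d z * cnj (K z)) + (\<Sum>i<r. (LINT z|circ. (z powi int n * cf f (J i) z) * (J i z * cnj (K z)))))"
      proof -
        have s: "integrable circ (\<lambda>z. \<Sum>i<r. (z powi int n * cf f (J i) z) * (J i z * cnj (K z)))"
          by (rule Bochner_Integration.integrable_sum) (rule i2, simp)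
        have "(LINT z|circ. (\<Sum>i<r. (z powi int n * cf f (J i) z) * (J i z * cnj (K z)))) =
          (\<Sum>i<r. (LINT z|circ. (z powi int n * cf f (J i) z) * (J i z * cnj (K z))))"
          by (rule Bochner_Integration.integral_sum) (rule i2, simp)
        then show ?thesis using Bochner_Integration.integral_add[OF i1 s] by (simp only: integral_mult_right_zero)
      qed
      also have "\<dots> = 0" unfolding 1 using 2 by simp
      finally show ?thesis .
    qed
  qed
  then show ?thesis by blast
qed

text \<open>\<open>fam_le\<close> bounds the size of a family, so a largest one exists; a residue
  that did not vanish would enlarge it by \<open>fam_extend\<close>.\<close>

theorem wandering_basis:
  obtains r J where "r \<le> n" "fam r J" "\<And>f. f \<in> N \<Longrightarrow> AE z in circ. f z = (\<Sum>j<r. J j z * cf f (J j) z)"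
proof -
  define r where "r = (GREATEST r. \<exists>J. fam r J)"
  have "fam 0 (\<lambda>_ _. 0)" by (simp add: fam_def)
  then have ex: "\<exists>J. fam 0 J" by blast
  have bd: "\<forall>r. (\<exists>J. fam r J) \<longrightarrow> r \<le> n" using fam_le by blast
  have "\<exists>J. fam r J" unfolding r_def
    by (rule GreatestI_nat[of "\<lambda>r. \<exists>J. fam r J" 0 n]) (use ex bd in simp_all)
  then obtain J where J: "fam r J" by blast
  have not: "\<not> (\<exists>J. fam (Suc r) J)"
  proof
    assume "\<exists>J. fam (Suc r) J"
    then have "Suc r \<le> r" unfolding r_def
      by (rule Greatest_le_nat[of "\<lambda>r. \<exists>J. fam r J" _ n]) (use bd in simp)
    then show False by simp
  qed
  show thesis
  proof (rule that[OF fam_le[OF J] J])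
    fix f assume f: "f \<in> N"
    have "AE z in circ. res r J f z = 0"
    proof (rule ccontr)
      assume "\<not> (AE z in circ. res r J f z = 0)"
      from fam_extend[OF J res_N'[OF J f] this] not show False by (rule notE[rotated])
    qed
    then show "AE z in circ. f z = (\<Sum>j<r. J j z * cf f (J j) z)" by eventually_elim (simp add: res_def)
  qed
qed

end

section \<open>Splitting off low frequencies\<close>

text \<open>A basis in echelon form, by induction on the last coordinate: either it vanishes on
  \<open>W\<close>, or one vector \<open>q\<close> with last coordinate 1 is added to a basis of its
  kernel. The final clause is what rules out \<open>k = d\<close> for a proper subspace.\<close>

lemma coefficient_basis:
  fixes W :: "(nat \<Rightarrow> complex) set"
  assumes "(\<lambda>_. 0) \<in> W" "\<And>f g c. f \<in> W \<Longrightarrow> g \<in> W \<Longrightarrow> (\<lambda>x. f x + c * g x) \<in> W"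
    and "\<And>f i. f \<in> W \<Longrightarrow> i \<ge> d \<Longrightarrow> f i = 0"
  shows "\<exists>k b. k \<le> d \<and> (\<forall>i<k. b i \<in> W) \<and> (\<forall>f\<in>W. \<exists>c. f = (\<lambda>x. \<Sum>i<k. c i * b i x)) \<and>
    (\<forall>c. (\<forall>x. (\<Sum>i<k. c i * b i x) = 0) \<longrightarrow> (\<forall>i<k. c i = 0)) \<and>
    (k = d \<longrightarrow> (\<forall>f. (\<forall>i\<ge>d. f i = 0) \<longrightarrow> f \<in> W))"
  using assms
proof (induction d arbitrary: W)
  case 0
  have "f = (\<lambda>_. 0)" if "f \<in> W" for f using 0(3)[OF that] by auto
  moreover have "f \<in> W" if "\<forall>i\<ge>0. f i = 0" for f
  proof -
    have "f = (\<lambda>_. 0)" using that by auto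
    then show ?thesis using 0(1) by simp
  qed
  ultimately show ?case by (intro exI[of _ 0] exI[of _ "\<lambda>_ _. 0"]) auto
next
  case (Suc d)
  define W0 where "W0 = {f \<in> W. f d = 0}"
  have "f i = 0" if "f \<in> W0" "i \<ge> d" for f i
    using that Suc.prems(3)[of f i] by (cases "i = d") (auto simp: W0_def)
  moreover have "(\<lambda>_. 0) \<in> W0" using Suc.prems(1) by (simp add: W0_def)
  moreover have "(\<lambda>x. f x + c * g x) \<in> W0" if "f \<in> W0" "g \<in> W0" for f g c
    using that Suc.prems(2) by (simp add: W0_def)
  ultimately obtain k b where kb: "k \<le> d" "\<And>i. i < k \<Longrightarrow> b i \<in> W0"
    "\<And>f. f \<in> W0 \<Longrightarrow> \<exists>c. f = (\<lambda>x. \<Sum>i<k. c i * b i x)"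
    "\<And>c. (\<forall>x. (\<Sum>i<k. c i * b i x) = 0) \<Longrightarrow> \<forall>i<k. c i = 0"
    "k = d \<Longrightarrow> \<forall>f. (\<forall>i\<ge>d. f i = 0) \<longrightarrow> f \<in> W0"
  proof -
    assume W0: "\<And>f i. f \<in> W0 \<Longrightarrow> i \<ge> d \<Longrightarrow> f i = 0" "(\<lambda>_. 0) \<in> W0"
      "\<And>f g c. f \<in> W0 \<Longrightarrow> g \<in> W0 \<Longrightarrow> (\<lambda>x. f x + c * g x) \<in> W0"
    have "\<exists>k b. k \<le> d \<and> (\<forall>i<k. b i \<in> W0) \<and> (\<forall>f\<in>W0. \<exists>c. f = (\<lambda>x. \<Sum>i<k. c i * b i x)) \<and>
      (\<forall>c. (\<forall>x. (\<Sum>i<k. c i * b i x) = 0) \<longrightarrow> (\<forall>i<k. c i = 0)) \<and>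
      (k = d \<longrightarrow> (\<forall>f. (\<forall>i\<ge>d. f i = 0) \<longrightarrow> f \<in> W0))"
      by (rule Suc.IH[of W0]) (rule W0(2), erule (1) W0(3), erule (1) W0(1))
    then obtain k b where *: "k \<le> d \<and> (\<forall>i<k. b i \<in> W0) \<and> (\<forall>f\<in>W0. \<exists>c. f = (\<lambda>x. \<Sum>i<k. c i * b i x)) \<and>
      (\<forall>c. (\<forall>x. (\<Sum>i<k. c i * b i x) = 0) \<longrightarrow> (\<forall>i<k. c i = 0)) \<and>
      (k = d \<longrightarrow> (\<forall>f. (\<forall>i\<ge>d. f i = 0) \<longrightarrow> f \<in> W0))" by (elim exE)
    show thesis by (rule that[of k b]) (use * in simp_all)
  qed
  show ?case
  proof (cases "W \<subseteq> W0")
    case True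
    have "b i \<in> W" if "i < k" for i using kb(2)[OF that] by (simp add: W0_def)
    moreover have "\<exists>c. f = (\<lambda>x. \<Sum>i<k. c i * b i x)" if "f \<in> W" for f using kb(3) True that by blast
    ultimately show ?thesis using kb(1,4) by (intro exI[of _ k] exI[of _ b]) auto
  next
    case False
    then obtain p where p: "p \<in> W" "p d \<noteq> 0" by (auto simp: W0_def)
    \<comment> \<open>The summand 0 makes the scaled vector an instance of the closure property of
      \<open>W\<close>.\<close>
    define q where "q x = 0 + (1 / p d) * p x" for x
    have q: "q \<in> W" "q d = 1" using Suc.prems(2)[OF Suc.prems(1) p(1), of "1 / p d"] p(2) by (auto simp: q_def[abs_def])
    define b' where "b' = b (k := q)"
    have b': "b' k = q" "\<And>i. i < k \<Longrightarrow> b' i = b i" by (auto simp: b'_def)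
    have b0: "b i d = 0" if "i < k" for i using kb(2)[OF that] by (simp add: W0_def)
    have sm: "(\<Sum>i<Suc k. c i * b' i x) = (\<Sum>i<k. c i * b i x) + c k * q x" for c x
      by (simp add: b')
    have red: "(\<lambda>x. f x + (- f d) * q x) \<in> W0" if "f \<in> W" for f
      using Suc.prems(2)[OF that q(1), of "- f d"] q(2) by (simp add: W0_def)
    have 1: "b' i \<in> W" if "i < Suc k" for i
      using that kb(2)[of i] q(1) b' by (cases "i = k") (auto simp: W0_def)
    have 2: "\<exists>c. f = (\<lambda>x. \<Sum>i<Suc k. c i * b' i x)" if fW: "f \<in> W" for f
    proof -
      obtain c where c: "(\<lambda>x. f x + (- f d) * q x) = (\<lambda>x. \<Sum>i<k. c i * b i x)" using kb(3)[OF red[OF fW]] by blast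
      have "f x = (\<Sum>i<Suc k. (c (k := f d)) i * b' i x)" for x
        using fun_cong[OF c, of x] unfolding sm by (simp add: diff_eq_eq)
      then show ?thesis by blast
    qed
    have 3: "\<forall>i<Suc k. c i = 0" if c: "\<forall>x. (\<Sum>i<Suc k. c i * b' i x) = 0" for c
    proof -
      have "(\<Sum>i<k. c i * b i d) + c k * q d = 0" using c unfolding sm by blast
      then have ck: "c k = 0" using b0 q(2) by simp
      then have "\<forall>x. (\<Sum>i<k. c i * b i x) = 0" using c unfolding sm by simp
      from kb(4)[OF this] ck show ?thesis by (auto simp: less_Suc_eq)
    qed
    have 4: "f \<in> W" if "Suc k = Suc d" "\<forall>i\<ge>Suc d. f i = 0" for f
    proof -
      have q0: "q i = 0" if "i \<ge> Suc d" for i using Suc.prems(3)[OF q(1) that] .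
      have "(\<lambda>x. f x + (- f d) * q x) i = 0" if i: "i \<ge> d" for i
      proof (cases "i = d")
        case True then show ?thesis by (simp add: q(2))
      next
        case False
        then have "i \<ge> Suc d" using i by simp
        then show ?thesis using \<open>\<forall>i\<ge>Suc d. f i = 0\<close> q0 by simp
      qed
      then have z: "\<forall>i\<ge>d. (\<lambda>x. f x + (- f d) * q x) i = 0" by blast
      have kd: "k = d" using that(1) by simp
      from mp[OF spec[OF kb(5)[OF kd], of "\<lambda>x. f x + (- f d) * q x"] z]
      have "(\<lambda>x. f x + (- f d) * q x) \<in> W0" .
      then have "(\<lambda>x. f x + (- f d) * q x) \<in> W" by (simp add: W0_def)
      from Suc.prems(2)[OF this q(1), of "f d"] show ?thesis by simp
    qed
    show ?thesis
    proof (rule exI[of _ "Suc k"], rule exI[of _ b'], intro conjI)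
      show "Suc k \<le> Suc d" using kb(1) by simp
      show "\<forall>i<Suc k. b' i \<in> W" using 1 by blast
      show "\<forall>f\<in>W. \<exists>c. f = (\<lambda>x. \<Sum>i<Suc k. c i * b' i x)" by (rule ballI) (rule 2)
      show "\<forall>c. (\<forall>x. (\<Sum>i<Suc k. c i * b' i x) = 0) \<longrightarrow> (\<forall>i<Suc k. c i = 0)" by (rule allI, rule impI) (rule 3)
      show "Suc k = Suc d \<longrightarrow> (\<forall>f. (\<forall>i\<ge>Suc d. f i = 0) \<longrightarrow> f \<in> W)" by (intro impI allI) (rule 4)
    qed
  qed
qed

section \<open>Coefficient functions and their low frequencies\<close>

context rsn
begin

lemma Linf_sub_acl: "f \<in> Linf \<Longrightarrow> f \<in> acl \<alpha> Linf"
  by (rule acl_sup[OF _ LinfD(1)])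

lemma HA_acl_Linf: "f \<in> acl \<alpha> (HA A) \<Longrightarrow> f \<in> acl \<alpha> Linf"
  by (rule acl_mono[of "HA A"]) (auto intro: HA_Linf)

lemma ext_tendsto_scale:
  assumes X: "X \<longlonglongrightarrow> 0" and K: "K > 0" and Y: "\<And>i. Y i \<le> ennreal K * X i"
  shows "Y \<longlonglongrightarrow> 0"
  unfolding ennreal_tendsto_0_iff
proof (intro allI impI)
  fix e :: real assume e: "e > 0"
  then have "e / K > 0" using K by simp
  then have "\<forall>\<^sub>F i in sequentially. X i \<le> ennreal (e / K)" using X unfolding ennreal_tendsto_0_iff by blast
  then show "\<forall>\<^sub>F i in sequentially. Y i \<le> ennreal e"
  proof eventually_elim
    case (elim i)
    have "Y i \<le> ennreal K * ennreal (e / K)" by (rule order_trans[OF Y]) (intro mult_left_mono elim, simp)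
    also have "\<dots> = ennreal e" using e K by (simp flip: ennreal_mult')
    finally show ?case .
  qed
qed

lemma ext_avg:
  assumes n: "n \<ge> 1" and g [measurable]: "g \<in> borel_measurable circ" shows "ext (avg n g) \<le> ennreal (real n) * ext g"
proof -
  have "ext (avg n g) \<le> ext (\<lambda>z. \<Sum>j<n. g (om n ^ j * z))"
  proof (rule ext_mono, rule AE_I2)
    fix z
    have "cmod (avg n g z) = cmod (\<Sum>j<n. g (om n ^ j * z)) / real n" by (simp add: avg_def norm_divide)
    also have "\<dots> \<le> cmod (\<Sum>j<n. g (om n ^ j * z)) / 1" using n by (intro divide_left_mono) auto
    finally show "cmod (avg n g z) \<le> cmod (\<Sum>j<n. g (om n ^ j * z))" by simp
  qed
  also have "\<dots> \<le> (\<Sum>j<n. ext (\<lambda>z. g (om n ^ j * z)))" by (rule ext_sum) (auto intro: measurable_rot)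
  also have "\<dots> \<le> (\<Sum>j<n. ext g)" by (rule sum_mono) (rule ext_rot, simp)
  finally show ?thesis by (simp add: ennreal_of_nat_eq_real_of_nat)
qed

lemma Malpha_zn_iff:
  assumes n: "n \<ge> 1" shows "g \<in> Malpha_zn \<alpha> n \<longleftrightarrow> g \<in> acl \<alpha> (HA (nn n))"
proof
  assume "g \<in> Malpha_zn \<alpha> n"
  then show "g \<in> acl \<alpha> (HA (nn n))" unfolding Malpha_zn_def by (rule acl_mono[rotated]) (auto intro: Hinf_zn_HA[OF n])
next
  assume g: "g \<in> acl \<alpha> (HA (nn n))"
  show "g \<in> Malpha_zn \<alpha> n" unfolding Malpha_zn_def
    by (rule acl_AE_approx[OF HA_nn_Hinf_zn[OF n] g acl_meas[OF g]]) auto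
qed

text \<open>What is left of \<open>g\<close> after taking out the frequencies 0 and
  \<open>n\<close>, divided by \<open>z^(2n)\<close>; \<open>tailz_split\<close> puts
  \<open>g\<close> together again off 0.\<close>

definition tailz :: "nat \<Rightarrow> (complex \<Rightarrow> complex) \<Rightarrow> complex \<Rightarrow> complex" where
  "tailz n g z = z powi (- (2 * int n)) * (g z + (- fc g 0) + (- fc g (int n)) * z powi int n)"

lemma tailz_HA:
  assumes n: "n \<ge> 1" and a: "a \<in> HA (nn n)" shows "tailz n a \<in> HA (nn n)"
proof -
  let ?b = "\<lambda>z. a z + (- fc a 0) + (- fc a (int n)) * z powi int n"
  have aL: "a \<in> Linf" by (rule HA_Linf[OF a])
  have bL: "?b \<in> Linf" by (intro Linf_add aL Linf_const Linf_scale Linf_powi)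
  have cfc: "fc (\<lambda>z. c) k = (if k = 0 then c else 0)" for c k
    using fc_scale[of c "\<lambda>z. z powi 0" k] fc_powi[of 0 k] by auto
  have bfc: "fc ?b k = fc a k + (if k = 0 then - fc a 0 else 0) + (- fc a (int n)) * (if int n = k then 1 else 0)" for k
    by (subst fc_add, (intro Linf_integrable Linf_add aL Linf_const Linf_scale Linf_powi)+,
        subst fc_add, (intro Linf_integrable aL Linf_const)+) (simp only: fc_scale fc_powi cfc)
  have "fc (tailz n a) k = 0" if k: "k \<notin> nn n" for k
  proof -
    have "fc (tailz n a) k = fc ?b (k - (- (2 * int n)))" unfolding tailz_def[abs_def] by (rule fc_shift[OF LinfD(1)[OF bL]])
    also have "\<dots> = fc ?b (k + 2 * int n)" by simp
    also have "\<dots> = 0"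
    proof (cases "k + 2 * int n = 0 \<or> k + 2 * int n = int n")
      case True
      then consider "k + 2 * int n = 0" | "k + 2 * int n = int n" by blast
      then show ?thesis
      proof cases
        case 1 show ?thesis unfolding bfc 1 using n by simp
      next
        case 2 show ?thesis unfolding bfc 2 using n by simp
      qed
    next
      case False
      \<comment> \<open>A frequency \<open>k\<close> outside \<open>nn n\<close> with
        \<open>k + 2 n\<close> inside would be \<open>- n\<close> or \<open>- 2 n\<close>, that is,
        one of the two that have been taken out.\<close>
      have "k + 2 * int n \<notin> nn n"
      proof
        assume A: "k + 2 * int n \<in> nn n"
        then have "int n dvd k" using dvd_add_left_iff[of "int n" "2 * int n" k] by (auto simp: nn_def)
        then obtain q where q: "k = int n * q" by (auto simp: dvd_def)
        have "k < 0" using k \<open>int n dvd k\<close> by (auto simp: nn_def)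
        then have "q < 0" using q n by (auto simp: mult_less_0_iff)
        moreover have "0 \<le> int n * (q + 2)" using A q by (simp add: nn_def distrib_left mult.commute)
        then have "q + 2 \<ge> 0" using n by (auto simp: zero_le_mult_iff)
        ultimately have "q = -1 \<or> q = -2" by linarith
        then show False using False q by auto
      qed
      then show ?thesis unfolding bfc using False HA_fc[OF a] by auto
    qed
    finally show ?thesis .
  qed
  moreover have "tailz n a \<in> Linf" unfolding tailz_def[abs_def] by (intro Linf_mult bL Linf_powi)
  ultimately show ?thesis by (simp add: HA_def)
qed

lemma ext_le_bound:
  assumes [measurable]: "f \<in> borel_measurable circ" and "AE z in circ. cmod (f z) \<le> C" "C \<ge> 0"
  shows "ext f \<le> ennreal C"
proof -
  have "f \<in> Linf" using assms unfolding Linf_def by blast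
  then show ?thesis using a_le_bound[of f C] assms by (simp add: ext_Linf ennreal_leI)
qed

text \<open>The operation involves \<open>g\<close> and two of its coefficients, all continuous for
  \<alpha>; one third of \<open>e\<close> goes to each.\<close>

lemma tailz_acl:
  assumes n: "n \<ge> 1" and g: "g \<in> acl \<alpha> (HA (nn n))" shows "tailz n g \<in> acl \<alpha> (HA (nn n))"
proof (rule aclI)
  have gm [measurable]: "g \<in> borel_measurable circ" by (rule acl_meas[OF g])
  have gi: "integrable circ g" by (rule acl_integrable[OF HA_acl_Linf[OF g]])
  show "tailz n g \<in> borel_measurable circ" unfolding tailz_def[abs_def] by measurable
  fix e :: real assume e: "e > 0"
  then obtain a where a: "a \<in> HA (nn n)" "ext (\<lambda>z. a z - g z) \<le> ennreal (e/3)" using aclD[OF g, of "e/3"] by auto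
  have am [measurable]: "a \<in> borel_measurable circ" by (rule LinfD(1)[OF HA_Linf[OF a(1)]])
  have ai: "integrable circ a" by (rule Linf_integrable[OF HA_Linf[OF a(1)]])
  have d: "cmod (fc a k - fc g k) \<le> e/3" for k
    using order_trans[OF fc_diff_le_ext[OF ai gi, of k] a(2)] e by (simp add: ennreal_le_iff)
  let ?d0 = "fc g 0 - fc a 0" and ?d1 = "fc g (int n) - fc a (int n)"
  have "ext (\<lambda>z. tailz n a z - tailz n g z) = ext (\<lambda>z. z powi (- (2 * int n)) * ((a z - g z) + (?d0 + ?d1 * z powi int n)))"
    by (simp add: tailz_def algebra_simps)
  also have "\<dots> \<le> ennreal 1 * ext (\<lambda>z. (a z - g z) + (?d0 + ?d1 * z powi int n))"
    by (rule ext_mult_le[OF powi_bounded]) simp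
  also have "\<dots> \<le> ext (\<lambda>z. a z - g z) + ext (\<lambda>z. ?d0 + ?d1 * z powi int n)"
    unfolding ennreal_1 mult_1_left by (rule ext_add) measurable
  also have "\<dots> \<le> ennreal (e/3) + ennreal (e/3 + e/3)"
  proof (intro add_mono a(2) ext_le_bound)
    show "AE z in circ. cmod (?d0 + ?d1 * z powi int n) \<le> e/3 + e/3"
      using powi_bounded[of "int n"]
    proof eventually_elim
      case (elim z)
      have "cmod (?d1 * z powi int n) \<le> cmod ?d1 * 1" unfolding norm_mult by (intro mult_left_mono elim) simp
      then show ?case using norm_triangle_ineq[of ?d0 "?d1 * z powi int n"] d[of 0] d[of "int n"]
        by (simp add: norm_minus_commute del: power_int_of_nat)
    qed
  qed (use e in auto)
  also have "\<dots> = ennreal e" using e by (simp flip: ennreal_plus)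
  finally show "\<exists>s\<in>HA (nn n). ext (\<lambda>z. s z - tailz n g z) \<le> ennreal e" using tailz_HA[OF n a(1)] by blast
qed

lemma tailz_split: "z \<noteq> 0 \<Longrightarrow> g z = fc g 0 + fc g (int n) * z ^ n + z ^ (2 * n) * tailz n g z"
proof -
  assume z: "z \<noteq> 0"
  have "z ^ (2 * n) * z powi (- (2 * int n)) = 1"
  proof -
    have "z powi (int (2 * n)) * z powi (- int (2 * n)) = 1" using z by (simp add: power_int_minus)
    then show ?thesis unfolding power_int_of_nat by simp
  qed
  then have "z ^ (2 * n) * tailz n g z = g z + (- fc g 0) + (- fc g (int n)) * z powi int n"
    unfolding tailz_def mult.assoc[symmetric] by simp
  then show ?thesis by simp
qed

end

section \<open>Invariant subspaces of the Hardy space\<close>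

locale shifted_invariant = rsn +
  fixes n :: nat and M :: "(complex \<Rightarrow> complex) set"
  assumes n: "n \<ge> 1" and lin: "lin_subspace M" and sub: "M \<subseteq> Halpha \<alpha>" and cl: "acl \<alpha> M = M"
    and inv: "invariant_under (Hinf1_zn n) M"
begin

lemma Halpha_eq: "Halpha \<alpha> = acl \<alpha> (HA {0..})" by (simp add: Halpha_def Hinf_eq_HA)

lemma HA_meas: "HA A \<subseteq> borel_measurable circ" using LinfD(1) HA_Linf by auto

lemma M_0: "(\<lambda>z. 0) \<in> M" and M_add: "f \<in> M \<Longrightarrow> g \<in> M \<Longrightarrow> (\<lambda>z. f z + g z) \<in> M"
  and M_scale: "f \<in> M \<Longrightarrow> (\<lambda>z. c * f z) \<in> M"
  using lin unfolding lin_subspace_def by blast+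

lemma M_meas: "f \<in> M \<Longrightarrow> f \<in> borel_measurable circ"
  using acl_meas[of f M] cl by simp

text \<open>A set equal to its own closure is saturated for equality almost everywhere, since the
  closure admits every measurable function at distance 0.\<close>

lemma M_cong: "f \<in> M \<Longrightarrow> g \<in> borel_measurable circ \<Longrightarrow> AE z in circ. f z = g z \<Longrightarrow> g \<in> M"
  using acl_cong[of f M g] cl by simp

lemma M_sum: "finite I \<Longrightarrow> (\<And>i. i \<in> I \<Longrightarrow> f i \<in> M) \<Longrightarrow> (\<lambda>z. \<Sum>i\<in>I. f i z) \<in> M"
  by (induction I rule: finite_induct) (auto intro: M_0 M_add)

text \<open>Quantifying over all \<open>a\<close> builds in invariance: \<open>h f\<close> belongs
  to \<open>M'\<close> because \<open>a h\<close> is again a multiplier. Closedness is inherited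
  from \<open>M\<close>.\<close>

definition M' :: "(complex \<Rightarrow> complex) set" where
  "M' = {f \<in> Halpha \<alpha>. \<forall>a\<in>HA (nn n). (\<lambda>z. z ^ (2 * n) * a z * f z) \<in> M}"

text \<open>The invariance of \<open>M\<close> enters here: \<open>Hinf1_zn_shift\<close> puts
  \<open>z^(2n) a\<close> in the algebra under which \<open>M\<close> is invariant.\<close>

lemma M_sub_M': "f \<in> M \<Longrightarrow> f \<in> M'"
proof -
  assume f: "f \<in> M"
  have "(\<lambda>z. z ^ (2 * n) * a z * f z) \<in> M" if "a \<in> HA (nn n)" for a
    using bspec[OF bspec[OF inv[unfolded invariant_under_def] Hinf1_zn_shift[OF n that]] f] .
  then show ?thesis using f sub unfolding M'_def by blast
qed

lemma M'_Halpha: "f \<in> M' \<Longrightarrow> f \<in> acl \<alpha> (HA {0..})" by (simp add: M'_def Halpha_eq)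

lemma M'_meas: "f \<in> M' \<Longrightarrow> f \<in> borel_measurable circ" by (rule acl_meas[OF M'_Halpha])

lemma M'D: "f \<in> M' \<Longrightarrow> a \<in> HA (nn n) \<Longrightarrow> (\<lambda>z. z ^ (2 * n) * a z * f z) \<in> M" by (simp add: M'_def)

lemma M'I: "f \<in> acl \<alpha> (HA {0..}) \<Longrightarrow> (\<And>a. a \<in> HA (nn n) \<Longrightarrow> (\<lambda>z. z ^ (2 * n) * a z * f z) \<in> M) \<Longrightarrow> f \<in> M'"
  by (simp add: M'_def Halpha_eq)

lemma M'_shift: "f \<in> M' \<Longrightarrow> (\<lambda>z. z ^ (2 * n) * f z) \<in> M"
  using M'D[OF _ HA_const[OF nn_0], of f 1] by simp

lemma M'_add: assumes f: "f \<in> M'" and g: "g \<in> M'" shows "(\<lambda>z. f z + g z) \<in> M'"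
proof (rule M'I)
  show "(\<lambda>z. f z + g z) \<in> acl \<alpha> (HA {0..})"
    by (rule acl_add[OF HA_meas HA_meas _ M'_Halpha[OF f] M'_Halpha[OF g]]) (rule HA_add)
  fix a assume a: "a \<in> HA (nn n)"
  from M_add[OF M'D[OF f a] M'D[OF g a]] show "(\<lambda>z. z ^ (2 * n) * a z * (f z + g z)) \<in> M"
    by (simp add: distrib_left)
qed

lemma M'_mult: assumes h: "h \<in> HA (nn n)" and f: "f \<in> M'" shows "(\<lambda>z. h z * f z) \<in> M'"
proof (rule M'I)
  have h0: "h \<in> HA {0..}" by (rule HA_mono[OF h]) (auto simp: nn_def)
  show "(\<lambda>z. h z * f z) \<in> acl \<alpha> (HA {0..})"
    by (rule acl_mult[OF HA_Linf[OF h] _ M'_Halpha[OF f]]) (rule HA_mult[OF h0], auto)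
  fix a assume a: "a \<in> HA (nn n)"
  have "(\<lambda>z. a z * h z) \<in> HA (nn n)" by (rule HA_mult[OF a h]) (rule nn_add)
  from M'D[OF f this] show "(\<lambda>z. z ^ (2 * n) * a z * (h z * f z)) \<in> M" by (simp add: mult.assoc)
qed

lemma M'_scale: "f \<in> M' \<Longrightarrow> (\<lambda>z. c * f z) \<in> M'"
  by (rule M'_mult) (simp_all add: HA_const)

lemma M'_0: "(\<lambda>z. 0) \<in> M'" using M_sub_M'[OF M_0] .

lemma M'_sum: "finite I \<Longrightarrow> (\<And>i. i \<in> I \<Longrightarrow> f i \<in> M') \<Longrightarrow> (\<lambda>z. \<Sum>i\<in>I. f i z) \<in> M'"
  by (induction I rule: finite_induct) (auto intro: M'_0 M'_add)

lemma M'_closed: assumes f: "f \<in> acl \<alpha> M'" shows "f \<in> M'"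
proof (rule M'I)
  have "M' \<subseteq> acl \<alpha> (HA {0..})" using M'_Halpha by auto
  from acl_acl[OF HA_meas acl_mono[OF this f]] show "f \<in> acl \<alpha> (HA {0..})" .
  fix a assume a: "a \<in> HA (nn n)"
  have "(\<lambda>z. z ^ (2 * n) * a z * f z) \<in> acl \<alpha> M"
    by (rule acl_mult[OF Linf_mult[OF Linf_power HA_Linf[OF a]] _ f]) (rule M'D[OF _ a])
  then show "(\<lambda>z. z ^ (2 * n) * a z * f z) \<in> M" using cl by simp
qed

text \<open>In general neither of \<open>M'\<close> and \<open>L2m circ\<close> contains the other,
  so the bounded part of \<open>M'\<close> is closed up in mean square. \<open>B_N\<close> and
  \<open>N_Linf_M'\<close> show that \<open>N\<close> and \<open>M'\<close> have the same bounded
  functions.\<close>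

definition N :: "(complex \<Rightarrow> complex) set" where "N = cl2 circ (M' \<inter> Linf)"

lemma B_sub: "M' \<inter> Linf \<subseteq> L2m circ" using Linf_L2m by auto

sublocale zn_invariant n N
proof
  show "n \<ge> 1" by (rule n)
  show "N \<subseteq> L2m circ" unfolding N_def by (rule cl2_sub)
  show "closed2 circ N" unfolding N_def by (rule closed2_cl2[OF B_sub])
  show "(\<lambda>z. f z + g z) \<in> N" if "f \<in> N" "g \<in> N" for f g
    unfolding N_def by (rule cl2_add[OF B_sub _ that[unfolded N_def]]) (auto intro: M'_add Linf_add)
  show "(\<lambda>z. c * f z) \<in> N" if "f \<in> N" for f c
    unfolding N_def by (rule cl2_scale[OF _ B_sub that[unfolded N_def]]) (auto intro: M'_scale Linf_scale)
  show "(\<lambda>z. z powi int n * f z) \<in> N" if "f \<in> N" for f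
    unfolding N_def
  proof (rule cl2_bounded_mult[OF _ B_sub _ powi_bounded that[unfolded N_def]])
    fix f assume "f \<in> M' \<inter> Linf"
    moreover have "(\<lambda>z. z powi int n) \<in> HA (nn n)" by (rule HA_powi) (simp add: nn_def)
    ultimately show "(\<lambda>z. z powi int n * f z) \<in> M' \<inter> Linf"
      by (intro IntI M'_mult Linf_mult Linf_powi) auto
  qed measurable
  show "fc f k = 0" if f: "f \<in> N" and k: "k < 0" for f k
  proof -
    have fL: "f \<in> L2m circ" using f cl2_sub unfolding N_def by blast
    obtain s where s: "\<And>i. s i \<in> M' \<inter> Linf" "conv2 circ s f" using cl2_seq[OF f[unfolded N_def]] by metis
    have sL: "s i \<in> L2m circ" for i using s(1)[of i] B_sub by auto
    have s0: "fc (s i) k = 0" for i using s(1)[of i] k by (intro acl_fc[OF order_refl M'_Halpha]) auto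
    have "(\<lambda>i. fc (s i) k) \<longlonglongrightarrow> fc f k" by (rule fc_conv2[OF sL fL s(2)])
    then show ?thesis unfolding s0 using LIMSEQ_unique tendsto_const by blast
  qed
  have "(\<lambda>z. 0) \<in> M' \<inter> Linf" using M'_0 by simp
  then show "(\<lambda>z. 0) \<in> N" unfolding N_def using cl2_sup[OF B_sub] by blast
qed

lemma B_N: "f \<in> M' \<Longrightarrow> f \<in> Linf \<Longrightarrow> f \<in> N" unfolding N_def using cl2_sup[OF B_sub] by blast

lemma ext_mult_tendsto:
  assumes f: "f \<in> acl \<alpha> Linf" and h: "\<And>m. h m \<in> HA (nn n)" "\<And>m. AE z in circ. cmod (h m z) \<le> C"
    "AE z in circ. (\<lambda>m. h m z) \<longlonglongrightarrow> 1"
  shows "(\<lambda>m. ext (\<lambda>z. h m z * f z - f z)) \<longlonglongrightarrow> 0"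
  using ext_dominated[OF f LinfD(1)[OF HA_Linf[OF h(1)]] h(2,3)] by simp

text \<open>Multiplying an \<open>L\<^sup>2\<close>-convergent sequence by functions that tame its maximal deviation
  turns it into a boundedly convergent one, which also converges in \<open>\<alpha>\<close>.\<close>
lemma N_Linf_M':
  assumes f: "f \<in> N" and fL: "f \<in> Linf" shows "f \<in> M'"
proof -
  have f2: "f \<in> L2m circ" by (rule Linf_L2m[OF fL])
  obtain s where s: "\<And>i. s i \<in> M' \<inter> Linf" "\<And>i. sqn circ (\<lambda>z. f z - s i z) < (1/4) ^ i"
    using cl2_seq[OF f[unfolded N_def]] by metis
  have sM: "s i \<in> M'" and sL: "s i \<in> Linf" for i using s(1)[of i] by auto
  have d2: "(\<lambda>z. f z - s i z) \<in> L2m circ" for i by (rule L2m_diff[OF f2 Linf_L2m[OF sL]])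
  define d where "d i z = cmod (f z - s i z)" for i z
  have di: "integrable circ (d i)" for i unfolding d_def using circ.L2m_integrable[OF d2] by simp
  have db: "(LINT z|circ. d i z) \<le> (1/2) ^ i" for i
  proof -
    have "(LINT z|circ. d i z) \<le> sqrt (sqn circ (\<lambda>z. f z - s i z))" unfolding d_def using circ.L2m_L1_le[OF d2] by simp
    also have "\<dots> \<le> sqrt ((1/4) ^ i)" using s(2)[of i] by simp
    also have "\<dots> = (1/2) ^ i" by (simp add: real_sqrt_power real_sqrt_divide)
    finally show ?thesis .
  qed
  have d0: "0 \<le> d i z" for i z by (simp add: d_def)
  have sm: "summable (\<lambda>i. (1/2::real) ^ i)" by (rule summable_geometric) simp
  note S = integrable_suminf_nonneg[OF di d0 db sm]
  \<comment> \<open>The sum of all deviations is integrable by the rate of convergence and dominates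
    each of them at almost every point, so one multiplier tames the whole sequence at once.\<close>
  define F where "F z = complex_of_real (\<Sum>i. d i z)" for z
  have Fi: "integrable circ F" unfolding F_def using S(2) by simp
  have dF: "AE z in circ. \<forall>i. d i z \<le> cmod (F z)"
    using S(1)
  proof eventually_elim
    case (elim z)
    have "d i z \<le> (\<Sum>i. d i z)" for i using sum_le_suminf[OF elim, of "{i}"] d0 by simp
    then show ?case unfolding F_def norm_of_real by (meson abs_ge_self order_trans)
  qed
  have lim: "AE z in circ. (\<lambda>i. s i z) \<longlonglongrightarrow> f z"
    using S(1)
  proof eventually_elim
    case (elim z)
    have "(\<lambda>i. cmod (f z - s i z)) \<longlonglongrightarrow> 0" using summable_LIMSEQ_zero[OF elim] by (simp add: d_def)
    then have "(\<lambda>i. cmod (s i z - f z)) \<longlonglongrightarrow> 0" by (simp add: norm_minus_commute)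
    then show ?case by (simp add: tendsto_norm_zero_iff LIM_zero_iff)
  qed
  obtain h C where h: "\<And>m. h m \<in> HA (nn n)" "\<And>m. AE z in circ. cmod (h m z) \<le> C"
    "AE z in circ. (\<lambda>m. h m z) \<longlonglongrightarrow> 1" "\<And>m. \<exists>B. AE z in circ. cmod (h m z) * cmod (F z) \<le> B"
    using bounded_multipliers[OF n Fi] by blast
  \<comment> \<open>For fixed \<open>m\<close> the differences \<open>h m (s i - f)\<close> are
    bounded by \<open>B\<close> and tend to 0 pointwise in \<open>i\<close>; the limit in
    \<open>m\<close> is taken afterwards.\<close>
  have hf: "(\<lambda>z. h m z * f z) \<in> M'" for m
  proof (rule M'_closed)
    have hL: "h m \<in> Linf" by (rule HA_Linf[OF h(1)])
    note [measurable] = LinfD(1)[OF hL] LinfD(1)[OF fL] LinfD(1)[OF sL]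
    obtain B where B: "AE z in circ. cmod (h m z) * cmod (F z) \<le> B" using h(4)[of m] by blast
    have bd: "AE z in circ. cmod (h m z * s i z - h m z * f z) \<le> B" for i
      using B dF
    proof eventually_elim
      case (elim z)
      have "cmod (h m z * s i z - h m z * f z) = cmod (h m z) * d i z"
        by (simp add: d_def norm_mult[symmetric] right_diff_distrib norm_minus_commute)
      also have "\<dots> \<le> cmod (h m z) * cmod (F z)" using elim(2) by (intro mult_left_mono) auto
      finally show ?case using elim(1) by linarith
    qed
    have "(\<lambda>i. \<alpha> (\<lambda>z. h m z * s i z - h m z * f z)) \<longlonglongrightarrow> 0"
    proof (rule a_tendsto_0[OF _ bd])
      show "AE z in circ. (\<lambda>i. h m z * s i z - h m z * f z) \<longlonglongrightarrow> 0"
        using lim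
      proof eventually_elim
        case (elim z)
        have "(\<lambda>i. h m z * s i z - h m z * f z) \<longlonglongrightarrow> h m z * f z - h m z * f z" by (intro tendsto_intros elim)
        then show ?case by simp
      qed
    qed measurable
    then have "(\<lambda>i. ennreal (\<alpha> (\<lambda>z. h m z * s i z - h m z * f z))) \<longlonglongrightarrow> ennreal 0" by (rule tendsto_ennrealI)
    moreover have "ext (\<lambda>z. h m z * s i z - h m z * f z) = ennreal (\<alpha> (\<lambda>z. h m z * s i z - h m z * f z))" for i
      by (intro ext_Linf Linf_diff Linf_mult hL sL fL)
    ultimately have "(\<lambda>i. ext (\<lambda>z. h m z * s i z - h m z * f z)) \<longlonglongrightarrow> 0" by simp
    then show "(\<lambda>z. h m z * f z) \<in> acl \<alpha> M'"
      by (intro aclI_seq[of _ "\<lambda>i z. h m z * s i z"] M'_mult h(1) sM) measurable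
  qed
  show ?thesis
    by (rule M'_closed, rule aclI_seq[OF LinfD(1)[OF fL] hf ext_mult_tendsto[OF Linf_sub_acl[OF fL] h(1-3)]])
qed

section \<open>Expansion along the wandering family\<close>

lemma cf_cong_mult:
  assumes h: "h \<in> HA (nn n)"
  shows "AE z in circ. cf (\<lambda>z. h z * f z) K z = h z * cf f K z"
  unfolding cf_def using avg_mult_inv[OF HA_nn_inv[OF n h], of "\<lambda>z. f z * cnj (K z)"] by (simp add: mult.assoc)

text \<open>\<open>f\<close> may fail to be square-integrable, but its products with the
  \<open>h m\<close> are bounded, hence in \<open>N\<close>, where the expansion holds. The
  multipliers are invariant and pass through \<open>cf\<close>; at a given point some
  \<open>h m\<close> is nonzero and cancels. The coefficients of \<open>h m f\<close> lie in
  \<open>HA (nn n)\<close> and tend to those of \<open>f\<close> in \<alpha>.\<close>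

lemma M'_repr:
  assumes J: "fam r J" and ex: "\<And>f. f \<in> N \<Longrightarrow> AE z in circ. f z = (\<Sum>j<r. J j z * cf f (J j) z)"
    and f: "f \<in> M'"
  shows "AE z in circ. f z = (\<Sum>j<r. J j z * cf f (J j) z)" "\<And>j. j < r \<Longrightarrow> cf f (J j) \<in> acl \<alpha> (HA (nn n))"
proof -
  have fA: "f \<in> acl \<alpha> Linf" by (rule HA_acl_Linf[OF M'_Halpha[OF f]])
  have fm [measurable]: "f \<in> borel_measurable circ" by (rule M'_meas[OF f])
  have fi: "integrable circ f" by (rule acl_integrable[OF fA])
  obtain h C where h: "\<And>m. h m \<in> HA (nn n)" "\<And>m. AE z in circ. cmod (h m z) \<le> C"
    "AE z in circ. (\<lambda>m. h m z) \<longlonglongrightarrow> 1" "\<And>m. \<exists>B. AE z in circ. cmod (h m z) * cmod (f z) \<le> B"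
    using bounded_multipliers[OF n fi] by blast
  have hm [measurable]: "h m \<in> borel_measurable circ" for m by (rule LinfD(1)[OF HA_Linf[OF h(1)]])
  have hfL: "(\<lambda>z. h m z * f z) \<in> Linf" for m
  proof -
    obtain B where "AE z in circ. cmod (h m z) * cmod (f z) \<le> B" using h(4) by blast
    then have "AE z in circ. cmod (h m z * f z) \<le> B" by (simp add: norm_mult)
    then show ?thesis unfolding Linf_def by auto
  qed
  have hfN: "(\<lambda>z. h m z * f z) \<in> N" for m by (rule B_N[OF M'_mult[OF h(1) f] hfL])
  have "AE z in circ. \<forall>m. h m z * f z = (\<Sum>j<r. J j z * cf (\<lambda>z. h m z * f z) (J j) z)"
    unfolding AE_all_countable using ex[OF hfN] by blast
  moreover have "AE z in circ. \<forall>m. \<forall>j. cf (\<lambda>z. h m z * f z) (J j) z = h m z * cf f (J j) z"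
    unfolding AE_all_countable using cf_cong_mult[OF h(1)] by blast
  ultimately show "AE z in circ. f z = (\<Sum>j<r. J j z * cf f (J j) z)"
    using h(3)
  proof eventually_elim
    case (elim z)
    have "\<forall>\<^sub>F m in sequentially. h m z \<noteq> 0" by (rule tendsto_imp_eventually_ne[OF elim(3)]) simp
    then obtain m where m: "h m z \<noteq> 0" by (auto simp: eventually_sequentially)
    have "h m z * f z = (\<Sum>j<r. J j z * cf (\<lambda>z. h m z * f z) (J j) z)" using elim(1) by blast
    also have "\<dots> = (\<Sum>j<r. h m z * (J j z * cf f (J j) z))"
      by (rule sum.cong[OF refl]) (simp only: spec[OF spec[OF elim(2)]] mult.left_commute)
    also have "\<dots> = h m z * (\<Sum>j<r. J j z * cf f (J j) z)" by (simp only: sum_distrib_left)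
    finally show ?case using m by simp
  qed
  fix j assume j: "j < r"
  have JL: "J j \<in> Linf" by (rule fam_Linf[OF J j])
  note [measurable] = LinfD(1)[OF JL]
  have cm: "cf g (J j) \<in> borel_measurable circ" if [measurable]: "g \<in> borel_measurable circ" for g
    unfolding cf_def by (rule avg_meas) measurable
  obtain D where D: "D > 0" "AE z in circ. cmod (cnj (J j z)) \<le> D" using LinfE[OF Linf_cnj[OF JL]] by blast
  have "(\<lambda>m. ext (\<lambda>z. cf (\<lambda>z. h m z * f z) (J j) z - cf f (J j) z)) \<longlonglongrightarrow> 0"
  proof (rule ext_tendsto_scale[OF ext_mult_tendsto[OF fA h(1-3)], of "real n * D"])
    show "real n * D > 0" using n D(1) by simp
    fix m
    have "ext (\<lambda>z. cf (\<lambda>z. h m z * f z) (J j) z - cf f (J j) z) = ext (avg n (\<lambda>z. cnj (J j z) * (h m z * f z - f z)))"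
    proof -
      have "cf (\<lambda>z. h m z * f z) (J j) z - cf f (J j) z = avg n (\<lambda>z. cnj (J j z) * (h m z * f z - f z)) z" for z
        unfolding cf_def avg_def diff_divide_distrib[symmetric] sum_subtractf[symmetric]
        by (intro arg_cong2[where f = "(/)"] sum.cong refl) (simp add: algebra_simps)
      then show ?thesis by simp
    qed
    also have "\<dots> \<le> ennreal (real n) * ext (\<lambda>z. cnj (J j z) * (h m z * f z - f z))"
      by (rule ext_avg[OF n]) measurable
    also have "\<dots> \<le> ennreal (real n) * (ennreal D * ext (\<lambda>z. h m z * f z - f z))"
      by (intro mult_left_mono ext_mult_le D) auto
    also have "\<dots> = ennreal (real n * D) * ext (\<lambda>z. h m z * f z - f z)"
      using D(1) by (simp add: ennreal_mult mult.assoc)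
    finally show "ext (\<lambda>z. cf (\<lambda>z. h m z * f z) (J j) z - cf f (J j) z) \<le> ennreal (real n * D) * ext (\<lambda>z. h m z * f z - f z)" .
  qed
  moreover have "cf (\<lambda>z. h m z * f z) (J j) \<in> HA (nn n)" for m
  proof -
    have "cf (\<lambda>z. h m z * f z) (J j) \<in> Linf" unfolding cf_def by (rule avg_Linf[OF n Linf_mult[OF hfL Linf_cnj[OF JL]]])
    then show ?thesis using cf_supp[OF J j hfN] by (simp add: HA_def)
  qed
  ultimately show "cf f (J j) \<in> acl \<alpha> (HA (nn n))" by (intro aclI_seq[OF cm[OF fm]])
qed

lemma fam_M':
  assumes J: "fam r J" and g: "\<And>j. j < r \<Longrightarrow> g j \<in> acl \<alpha> (HA (nn n))"
  shows "(\<lambda>z. \<Sum>j<r. J j z * g j z) \<in> M'"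
proof (rule M'_sum)
  fix j assume "j \<in> {..<r}"
  then have j: "j < r" by simp
  have JL: "J j \<in> Linf" by (rule fam_Linf[OF J j])
  have JM: "J j \<in> M'" by (rule N_Linf_M'[OF fam_N[OF J j] JL])
  have "(\<lambda>z. J j z * g j z) \<in> acl \<alpha> M'"
  proof (rule acl_mult[OF JL _ g[OF j]])
    fix s assume "s \<in> HA (nn n)"
    from M'_mult[OF this JM] show "(\<lambda>z. J j z * s z) \<in> M'" by (simp add: mult.commute)
  qed
  then show "(\<lambda>z. J j z * g j z) \<in> M'" by (rule M'_closed)
qed simp

text \<open>The total factor of \<open>J j\<close> is an invariant function \<open>p j\<close>, so
  the function-valued inner product of the sum with \<open>J l\<close> is \<open>p l\<close>, which
  therefore vanishes. As \<open>z^(2n) g l\<close> starts at frequency \<open>2n\<close>, the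
  coefficients of \<open>p l\<close> at 0 and \<open>n\<close> are the two constants.\<close>

lemma fam_independent:
  assumes J: "fam r J" and g: "\<And>j. j < r \<Longrightarrow> g j \<in> acl \<alpha> (HA (nn n))"
    and z: "AE z in circ. (\<Sum>j<r. (c (2 * j) + c (2 * j + 1) * z ^ n) * J j z) + z ^ (2 * n) * (\<Sum>j<r. J j z * g j z) = 0"
    and l: "l < r"
  shows "c (2 * l) = 0" "c (2 * l + 1) = (0::complex)" "AE z in circ. g l z = 0"
proof -
  define p where "p j z = c (2 * j) + c (2 * j + 1) * z powi int n + z powi (2 * int n) * g j z" for j z
  have pw: "z powi (2 * int n) = z ^ (2 * n)" for z :: complex using power_int_of_nat[of z "2 * n"] by simp
  have gm [measurable]: "g j \<in> borel_measurable circ" if "j < r" for j by (rule acl_meas[OF g[OF that]])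
  have gi: "integrable circ (g j)" if "j < r" for j by (rule acl_integrable[OF HA_acl_Linf[OF g[OF that]]])
  have gs: "fc (g j) k = 0" if "j < r" "k \<notin> nn n" for j k by (rule acl_fc[OF order_refl g[OF that(1)] that(2)])
  have pz: "AE z in circ. (\<Sum>j<r. p j z * J j z) = 0"
    using z
  proof eventually_elim
    case (elim z)
    have "(\<Sum>j<r. p j z * J j z) = (\<Sum>j<r. (c (2 * j) + c (2 * j + 1) * z ^ n) * J j z + z ^ (2 * n) * (J j z * g j z))"
      unfolding p_def pw power_int_of_nat by (rule sum.cong[OF refl]) (simp add: algebra_simps)
    then show ?case using elim by (simp add: sum.distrib sum_distrib_left)
  qed
  have pinv: "AE z in circ. p j (om n * z) = p j z" if j: "j < r" for j
  proof -
    have "AE z in circ. g j (om n * z) = g j z"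
      by (rule supp_inv[OF n gi[OF j]]) (auto intro!: gs[OF j] simp: nn_def)
    then show ?thesis
    proof eventually_elim
      case (elim z)
      have "om n ^ (2 * n) = 1" using om_power_n[OF n] by (simp add: mult.commute[of 2] power_mult)
      then show ?case using elim om_power_n[OF n] by (simp add: p_def pw power_mult_distrib)
    qed
  qed
  have "AE z in circ. \<forall>j\<in>{..<r}. \<forall>i. p j (om n ^ i * z) = p j z"
    by (intro AE_finite_allI inv_all pinv) auto
  moreover have "AE z in circ. \<forall>i. (\<Sum>j<r. p j (om n ^ i * z) * J j (om n ^ i * z)) = 0"
    by (rule AE_avg_all[OF pz])
  moreover have "AE z in circ. \<forall>j\<in>{..<r}. avg n (\<lambda>z. J j z * cnj (J l z)) z = (if j = l then 1 else 0)"
    using l by (intro AE_finite_allI fam_avg[OF J]) auto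
  ultimately have p0: "AE z in circ. p l z = 0"
  proof eventually_elim
    case (elim z)
    have "0 = (\<Sum>i<n. (\<Sum>j<r. p j (om n ^ i * z) * J j (om n ^ i * z)) * cnj (J l (om n ^ i * z)))"
      using elim(2) by simp
    also have "\<dots> = (\<Sum>i<n. \<Sum>j<r. p j z * (J j (om n ^ i * z) * cnj (J l (om n ^ i * z))))"
      unfolding sum_distrib_right by (intro sum.cong refl) (use elim(1) in \<open>simp add: mult.assoc\<close>)
    also have "\<dots> = (\<Sum>j<r. p j z * (\<Sum>i<n. J j (om n ^ i * z) * cnj (J l (om n ^ i * z))))"
      by (subst sum.swap) (simp only: sum_distrib_left)
    also have "\<dots> = (\<Sum>j<r. if j = l then p j z * of_nat n else 0)"
    proof (rule sum.cong[OF refl])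
      fix j assume "j \<in> {..<r}"
      then have "avg n (\<lambda>z. J j z * cnj (J l z)) z = (if j = l then 1 else 0)" using elim(3) by blast
      then have "(\<Sum>i<n. J j (om n ^ i * z) * cnj (J l (om n ^ i * z))) = (if j = l then of_nat n else 0)"
        using n by (auto simp: avg_def split: if_splits)
      then show "p j z * (\<Sum>i<n. J j (om n ^ i * z) * cnj (J l (om n ^ i * z))) = (if j = l then p j z * of_nat n else 0)"
        by simp
    qed
    also have "\<dots> = p l z * of_nat n" using l by simp
    finally show ?case using n by simp
  qed
  note [measurable] = gm[OF l]
  have zg: "integrable circ (\<lambda>z. z powi (2 * int n) * g l z)"
    using integrable_mult_powi[OF gi[OF l], of "2 * int n"] by (simp only: mult.commute)
  have cfc: "fc (\<lambda>z. c) k = (if k = 0 then c else 0)" for c k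
    using fc_scale[of c "\<lambda>z. z powi 0" k] fc_powi[of 0 k] by auto
  have i1: "integrable circ (\<lambda>z. c (2 * l + 1) * z powi int n)" by (rule Linf_integrable[OF Linf_scale[OF Linf_powi]])
  have pfc: "fc (p l) k = (if k = 0 then c (2 * l) else 0) + c (2 * l + 1) * (if int n = k then 1 else 0) + fc (g l) (k - 2 * int n)" for k
  proof -
    have "fc (p l) k = fc (\<lambda>z. c (2 * l) + c (2 * l + 1) * z powi int n) k + fc (\<lambda>z. z powi (2 * int n) * g l z) k"
      unfolding p_def[abs_def] by (rule fc_add[OF Bochner_Integration.integrable_add[OF _ i1] zg]) simp
    also have "fc (\<lambda>z. c (2 * l) + c (2 * l + 1) * z powi int n) k = fc (\<lambda>z. c (2 * l)) k + fc (\<lambda>z. c (2 * l + 1) * z powi int n) k"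
      by (rule fc_add[OF _ i1]) simp
    finally show ?thesis by (simp only: cfc fc_scale fc_powi fc_shift[OF gm[OF l]])
  qed
  have pm: "p l \<in> borel_measurable circ" unfolding p_def[abs_def] by measurable
  have pf0: "fc (p l) k = 0" for k using fc_cong_AE[OF pm _ p0, of k] by simp
  have g0: "fc (g l) (0 - 2 * int n) = 0" "fc (g l) (int n - 2 * int n) = 0"
    using n by (auto intro!: gs[OF l] simp: nn_def)
  show c0: "c (2 * l) = 0" using pfc[of 0] unfolding pf0 g0 using n by simp
  show c1: "c (2 * l + 1) = 0" using pfc[of "int n"] unfolding pf0 g0 using n by simp
  show "AE z in circ. g l z = 0"
    using p0 AE_circ_ne_0
  proof eventually_elim
    case (elim z)
    have "p l z = z powi (2 * int n) * g l z" unfolding p_def c0 c1 by simp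
    then show ?case using elim by simp
  qed
qed

text \<open>The scalar product of two shifts of \<open>J j\<close> by powers of \<open>z^n\<close>
  is a coefficient of \<open>|J j|^2\<close> at a multiple of \<open>n\<close>, and these are fixed
  by the average being 1.\<close>

lemma fam_n_inner:
  assumes J: "fam r J" and j: "j < r" shows "n_inner n (J j)"
proof -
  have JL: "J j \<in> Linf" by (rule fam_Linf[OF J j])
  note [measurable] = LinfD(1)[OF JL]
  have H: "J j \<in> Hinf" unfolding Hinf_eq_HA HA_def using JL Npos[OF fam_N[OF J j]] by auto
  have i: "integrable circ (\<lambda>z. J j z * cnj (J j z))" by (rule mult_cnj_integrable[OF J j fam_N[OF J j]])
  have "AE z in circ. avg n (\<lambda>z. J j z * cnj (J j z)) z = 1" using fam_avg[OF J j j] by simp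
  then have fcJ: "fc (\<lambda>z. J j z * cnj (J j z)) k = (if k = 0 then 1 else 0)" if "int n dvd k" for k
    using that unfolding avg_eq_const_iff[OF n i] by blast
  have "inner2 (\<lambda>z. z ^ (n * m) * J j z) (\<lambda>z. z ^ (n * m') * J j z) = (if m = m' then 1 else 0)" for m m'
  proof -
    have "inner2 (\<lambda>z. z ^ (n * m) * J j z) (\<lambda>z. z ^ (n * m') * J j z) = fc (\<lambda>z. J j z * cnj (J j z)) (int (n * m') - int (n * m))"
      unfolding inner2_def fc_def
    proof (rule integral_cong_AE)
      show "AE z in circ. z ^ (n * m) * J j z * cnj (z ^ (n * m') * J j z) = J j z * cnj (J j z) * z powi - (int (n * m') - int (n * m))"
        using AE_circ
      proof eventually_elim
        case (elim z)
        then have z: "z \<noteq> 0" by auto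
        have "cnj (z ^ (n * m')) = z powi - int (n * m')" using cnj_powi[OF elim, of "int (n * m')"] by (simp only: power_int_of_nat)
        moreover have "z powi - (int (n * m') - int (n * m)) = z powi int (n * m) * z powi - int (n * m')"
          using z by (subst power_int_add[symmetric]) auto
        ultimately show ?case unfolding complex_cnj_mult power_int_of_nat by (simp only: mult_ac)
      qed
    qed measurable
    also have "\<dots> = (if int (n * m') - int (n * m) = 0 then 1 else 0)" by (rule fcJ) simp
    also have "\<dots> = (if m = m' then 1 else 0)" using n by auto
    finally show ?thesis .
  qed
  then show ?thesis using H unfolding n_inner_def by blast
qed

end

text \<open>The bound on \<open>k\<close> is additive because \<open>2 * r - 1\<close> on natural
  numbers would truncate at \<open>r = 0\<close>; in this form it includes \<open>r > 0\<close>.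
  Directness of the sum is expressed by the vanishing of all terms of a vanishing
  combination.\<close>

theorem theorem4p5:
  fixes \<alpha> :: "(complex \<Rightarrow> complex) \<Rightarrow> real"
    and n :: nat
    and M :: "(complex \<Rightarrow> complex) set"
  assumes "rot_sym_norm \<alpha>" and "cont_norm \<alpha>" and "n \<ge> 1"
    and "lin_subspace M" and "M \<subseteq> Halpha \<alpha>" and "acl \<alpha> M = M"
    and "invariant_under (Hinf1_zn n) M"
    and "\<not> invariant_under (Hinf_zn n) M"
  shows "\<exists>(r::nat) (J::nat \<Rightarrow> complex \<Rightarrow> complex) (k::nat) (\<beta>::nat \<Rightarrow> nat \<Rightarrow> complex).
     r \<le> n \<and> k + 1 \<le> 2 * r \<and> (\<forall>j<r. n_inner n (J j)) \<and>
     (let \<phi> = (\<lambda>i z. \<Sum>j<r. (\<beta> (2 * j) i + \<beta> (2 * j + 1) i * z ^ n) * J j z)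
      in (\<forall>f. f \<in> M \<longleftrightarrow>
            f \<in> borel_measurable circ \<and>
            (\<exists>(c::nat \<Rightarrow> complex) (g::nat \<Rightarrow> complex \<Rightarrow> complex).
               (\<forall>j<r. g j \<in> Malpha_zn \<alpha> n) \<and>
               (AE z in circ. f z = (\<Sum>i<k. c i * \<phi> i z)
                                   + z ^ (2 * n) * (\<Sum>j<r. J j z * g j z)))) \<and>
         (\<forall>(c::nat \<Rightarrow> complex) (g::nat \<Rightarrow> complex \<Rightarrow> complex).
            (\<forall>j<r. g j \<in> Malpha_zn \<alpha> n) \<and>
            (AE z in circ. (\<Sum>i<k. c i * \<phi> i z) + z ^ (2 * n) * (\<Sum>j<r. J j z * g j z) = 0)
            \<longrightarrow> (\<forall>i<k. AE z in circ. c i * \<phi> i z = 0) \<and>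
                (\<forall>j<r. AE z in circ. z ^ (2 * n) * J j z * g j z = 0)))"
proof -
  interpret shifted_invariant \<alpha> n M by unfold_locales fact+
  have mz: "g \<in> Malpha_zn \<alpha> n \<longleftrightarrow> g \<in> acl \<alpha> (HA (nn n))" for g by (rule Malpha_zn_iff[OF assms(3)])
  obtain r J where r: "r \<le> n" and J: "fam r J"
    and ex: "\<And>f. f \<in> N \<Longrightarrow> AE z in circ. f z = (\<Sum>j<r. J j z * cf f (J j) z)"
    using wandering_basis by blast
  have JL: "J j \<in> Linf" if "j < r" for j by (rule fam_Linf[OF J that])
  \<comment> \<open>Entries \<open>2j\<close> and \<open>2j + 1\<close> of a vector are the
    coefficients of \<open>J j\<close> and \<open>z^n J j\<close>, so low-frequency combinations are
    parametrized by vectors supported below \<open>2 * r\<close>.\<close>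
  define \<Phi> where "\<Phi> b z = (\<Sum>j<r. (b (2 * j) + b (2 * j + 1) * z ^ n) * J j z)" for b :: "nat \<Rightarrow> complex" and z
  have \<Phi>m: "\<Phi> b \<in> borel_measurable circ" for b
  proof -
    have "\<Phi> b \<in> Linf" unfolding \<Phi>_def[abs_def]
      by (rule Linf_sum) (intro Linf_mult Linf_add Linf_const Linf_power JL, simp)
    then show ?thesis by (rule LinfD)
  qed
  have \<Phi>sum: "\<Phi> (\<lambda>x. \<Sum>i<k. c i * b i x) z = (\<Sum>i<k. c i * \<Phi> (b i) z)" for k c b z
  proof -
    have "\<Phi> (\<lambda>x. \<Sum>i<k. c i * b i x) z = (\<Sum>j<r. \<Sum>i<k. c i * ((b i (2 * j) + b i (2 * j + 1) * z ^ n) * J j z))"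
      unfolding \<Phi>_def sum_distrib_right sum.distrib[symmetric] by (intro sum.cong refl) (simp add: algebra_simps)
    also have "\<dots> = (\<Sum>i<k. c i * \<Phi> (b i) z)"
      by (subst sum.swap) (simp only: \<Phi>_def sum_distrib_left)
    finally show ?thesis .
  qed
  \<comment> \<open>The support condition makes \<open>coefficient_basis\<close> applicable in
    dimension \<open>2 * r\<close>.\<close>
  define W where "W = {b. (\<forall>i\<ge>2 * r. b i = 0) \<and> \<Phi> b \<in> M}"
  have W1: "(\<lambda>_. 0) \<in> W" using M_0 by (simp add: W_def \<Phi>_def[abs_def])
  have W2: "(\<lambda>x. f x + c * g x) \<in> W" if f: "f \<in> W" and g: "g \<in> W" for f g c
  proof -
    have "\<Phi> (\<lambda>x. f x + c * g x) z = \<Phi> f z + c * \<Phi> g z" for z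
      unfolding \<Phi>_def sum_distrib_left sum.distrib[symmetric] by (intro sum.cong refl) (simp add: algebra_simps)
    then have "\<Phi> (\<lambda>x. f x + c * g x) = (\<lambda>z. \<Phi> f z + c * \<Phi> g z)" by (rule ext)
    moreover have "(\<lambda>z. \<Phi> f z + c * \<Phi> g z) \<in> M" using f g by (intro M_add M_scale) (auto simp: W_def)
    ultimately show ?thesis using f g by (simp add: W_def)
  qed
  have W3: "f i = 0" if "f \<in> W" "i \<ge> 2 * r" for f i using that by (simp add: W_def)
  have "\<exists>k b. k \<le> 2 * r \<and> (\<forall>i<k. b i \<in> W) \<and> (\<forall>f\<in>W. \<exists>c. f = (\<lambda>x. \<Sum>i<k. c i * b i x)) \<and>
    (\<forall>c. (\<forall>x. (\<Sum>i<k. c i * b i x) = 0) \<longrightarrow> (\<forall>i<k. c i = 0)) \<and>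
    (k = 2 * r \<longrightarrow> (\<forall>f. (\<forall>i\<ge>2 * r. f i = 0) \<longrightarrow> f \<in> W))"
    by (rule coefficient_basis) (rule W1, erule (1) W2, erule (1) W3)
  then obtain k b where kb: "k \<le> 2 * r" "\<forall>i<k. b i \<in> W" "\<forall>f\<in>W. \<exists>c. f = (\<lambda>x. \<Sum>i<k. c i * b i x)"
    "\<forall>c. (\<forall>x. (\<Sum>i<k. c i * b i x) = 0) \<longrightarrow> (\<forall>i<k. c i = 0)"
    "k = 2 * r \<longrightarrow> (\<forall>f. (\<forall>i\<ge>2 * r. f i = 0) \<longrightarrow> f \<in> W)" by (elim exE conjE)
  have decomp: "\<exists>d g. (\<forall>i\<ge>2 * r. d i = 0) \<and> (\<forall>j<r. g j \<in> acl \<alpha> (HA (nn n))) \<and>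
      (AE z in circ. f z = \<Phi> d z + z ^ (2 * n) * (\<Sum>j<r. J j z * g j z))" if f: "f \<in> M'" for f
  proof -
    define u where "u j = cf f (J j)" for j
    have u: "AE z in circ. f z = (\<Sum>j<r. J j z * u j z)" "\<And>j. j < r \<Longrightarrow> u j \<in> acl \<alpha> (HA (nn n))"
      unfolding u_def by (rule M'_repr[OF J ex f], assumption)+
    \<comment> \<open>Index \<open>i\<close> belongs to the function \<open>J (i div 2)\<close>, and
      its parity selects the frequency 0 or \<open>n\<close>.\<close>
    define d where "d i = (if i < 2 * r then fc (u (i div 2)) (if even i then 0 else int n) else 0)" for i
    have "AE z in circ. f z = \<Phi> d z + z ^ (2 * n) * (\<Sum>j<r. J j z * tailz n (u j) z)"
      using u(1) AE_circ_ne_0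
    proof eventually_elim
      case (elim z)
      have "(\<Sum>j<r. J j z * u j z) = (\<Sum>j<r. (d (2 * j) + d (2 * j + 1) * z ^ n) * J j z + z ^ (2 * n) * (J j z * tailz n (u j) z))"
      proof (rule sum.cong[OF refl])
        fix j assume "j \<in> {..<r}"
        then have "d (2 * j) = fc (u j) 0" "d (2 * j + 1) = fc (u j) (int n)" by (auto simp: d_def)
        then show "J j z * u j z = (d (2 * j) + d (2 * j + 1) * z ^ n) * J j z + z ^ (2 * n) * (J j z * tailz n (u j) z)"
          using tailz_split[OF elim(2), of "u j" n] by (simp add: algebra_simps)
      qed
      then show ?case using elim(1) by (simp add: \<Phi>_def sum.distrib sum_distrib_left)
    qed
    moreover have "\<forall>j<r. tailz n (u j) \<in> acl \<alpha> (HA (nn n))" using tailz_acl[OF assms(3) u(2)] by blast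
    moreover have "\<forall>i\<ge>2 * r. d i = 0" by (simp add: d_def)
    ultimately show ?thesis by (intro exI[of _ d] exI[of _ "\<lambda>j. tailz n (u j)"] conjI)
  qed
  have tail_M: "(\<lambda>z. z ^ (2 * n) * (\<Sum>j<r. J j z * g j z)) \<in> M" if "\<forall>j<r. g j \<in> acl \<alpha> (HA (nn n))" for g
    using that by (intro M'_shift fam_M'[OF J]) blast
  \<comment> \<open>Together with \<open>k <= 2 * r\<close> this also yields
    \<open>r > 0\<close>.\<close>
  have kr: "k \<noteq> 2 * r"
  proof
    assume "k = 2 * r"
    then have all: "\<Phi> d \<in> M" if "\<forall>i\<ge>2 * r. d i = 0" for d using kb(5) that by (simp add: W_def)
    have "f \<in> M" if f: "f \<in> M'" for f
    proof -
      from decomp[OF f] obtain d g where "\<forall>i\<ge>2 * r. d i = 0" and g: "\<forall>j<r. g j \<in> acl \<alpha> (HA (nn n))"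
        and ae: "AE z in circ. f z = \<Phi> d z + z ^ (2 * n) * (\<Sum>j<r. J j z * g j z)" by (elim exE conjE)
      from M_add[OF all[OF this(1)] tail_M[OF g]] show ?thesis
        by (rule M_cong[OF _ M'_meas[OF f]]) (use ae in \<open>auto elim: eventually_mono\<close>)
    qed
    then have "(\<lambda>z. a z * f z) \<in> M" if "a \<in> Hinf_zn n" "f \<in> M" for a f
      using M'_mult[OF Hinf_zn_HA[OF assms(3) that(1)] M_sub_M'[OF that(2)]] by blast
    then show False using assms(8) unfolding invariant_under_def by blast
  qed
  \<comment> \<open>The theorem indexes \<open>\<beta>\<close> by coordinate first and vector
    second, hence the transposition.\<close>
  define \<beta> where "\<beta> j i = b i j" for j i
  have \<phi>: "(\<lambda>i z. \<Sum>j<r. (\<beta> (2 * j) i + \<beta> (2 * j + 1) i * z ^ n) * J j z) = (\<lambda>i. \<Phi> (b i))"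
    by (simp add: \<beta>_def \<Phi>_def[abs_def])
  have fwd: "\<exists>c g. (\<forall>j<r. g j \<in> Malpha_zn \<alpha> n) \<and>
      (AE z in circ. f z = (\<Sum>i<k. c i * \<Phi> (b i) z) + z ^ (2 * n) * (\<Sum>j<r. J j z * g j z))" if f: "f \<in> M" for f
  proof -
    from decomp[OF M_sub_M'[OF f]] obtain d g where d: "\<forall>i\<ge>2 * r. d i = 0" and g: "\<forall>j<r. g j \<in> acl \<alpha> (HA (nn n))"
      and ae: "AE z in circ. f z = \<Phi> d z + z ^ (2 * n) * (\<Sum>j<r. J j z * g j z)" by (elim exE conjE)
    \<comment> \<open>The tail lies in \<open>M\<close> whatever its coefficients, so the
      low-frequency part of \<open>f\<close> is a difference of two elements of
      \<open>M\<close>.\<close>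
    have "\<Phi> d \<in> M"
      by (rule M_cong[OF M_add[OF f M_scale[OF tail_M[OF g], of "-1"]] \<Phi>m]) (use ae in \<open>auto elim: eventually_mono\<close>)
    then have "d \<in> W" using d by (simp add: W_def)
    then obtain c where c: "d = (\<lambda>x. \<Sum>i<k. c i * b i x)" using kb(3) by blast
    show ?thesis using ae g unfolding c \<Phi>sum mz by blast
  qed
  have bwd: "f \<in> M" if "f \<in> borel_measurable circ" and g: "\<forall>j<r. g j \<in> Malpha_zn \<alpha> n"
    and ae: "AE z in circ. f z = (\<Sum>i<k. c i * \<Phi> (b i) z) + z ^ (2 * n) * (\<Sum>j<r. J j z * g j z)" for f c g
  proof (rule M_cong[OF M_add[OF M_sum tail_M] that(1)])
    show "(\<lambda>z. c i * \<Phi> (b i) z) \<in> M" if "i \<in> {..<k}" for i using that kb(2) by (intro M_scale) (auto simp: W_def)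
    show "\<forall>j<r. g j \<in> acl \<alpha> (HA (nn n))" using g unfolding mz .
  qed (use ae in \<open>auto elim: eventually_mono\<close>)
  have uniq: "(\<forall>i<k. AE z in circ. c i * \<Phi> (b i) z = 0) \<and> (\<forall>j<r. AE z in circ. z ^ (2 * n) * J j z * g j z = 0)"
    if g: "\<forall>j<r. g j \<in> Malpha_zn \<alpha> n"
      and ae: "AE z in circ. (\<Sum>i<k. c i * \<Phi> (b i) z) + z ^ (2 * n) * (\<Sum>j<r. J j z * g j z) = 0" for c g
  proof -
    define d where "d x = (\<Sum>i<k. c i * b i x)" for x
    have g': "\<And>j. j < r \<Longrightarrow> g j \<in> acl \<alpha> (HA (nn n))" using g unfolding mz by blast
    have "AE z in circ. (\<Sum>j<r. (d (2 * j) + d (2 * j + 1) * z ^ n) * J j z) + z ^ (2 * n) * (\<Sum>j<r. J j z * g j z) = 0"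
    proof -
      have "\<Phi> d z = (\<Sum>i<k. c i * \<Phi> (b i) z)" for z unfolding d_def[abs_def] by (rule \<Phi>sum)
      with ae have "AE z in circ. \<Phi> d z + z ^ (2 * n) * (\<Sum>j<r. J j z * g j z) = 0" by simp
      then show ?thesis unfolding \<Phi>_def .
    qed
    note ae' = this
    have I: "d (2 * l) = 0" "d (2 * l + 1) = 0" "AE z in circ. g l z = 0" if "l < r" for l
      by (rule fam_independent[OF J _ ae' that], erule g')+
    \<comment> \<open>\<open>fam_independent\<close> settles the coordinates below
      \<open>2 * r\<close>, the support condition in \<open>W\<close> the others. Linear
      independence of the \<open>b i\<close> then forces all \<open>c i\<close> to vanish.\<close>
    have "d x = 0" for x
    proof (cases "x < 2 * r")
      case True
      then have x: "x div 2 < r" by simp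
      show ?thesis
      proof (cases "even x")
        case True then show ?thesis using I(1)[OF x] by simp
      next
        case False then show ?thesis using I(2)[OF x] by simp
      qed
    next
      case False
      then have "b i x = 0" if "i < k" for i using kb(2) that W3[of "b i" x] by simp
      then show ?thesis by (simp add: d_def)
    qed
    then have "\<forall>i<k. c i = 0" using kb(4) unfolding d_def by blast
    moreover have "AE z in circ. z ^ (2 * n) * J j z * g j z = 0" if "j < r" for j
      using I(3)[OF that] by eventually_elim simp
    ultimately show ?thesis by simp
  qed
  show ?thesis
  proof (rule exI[of _ r], rule exI[of _ J], rule exI[of _ k], rule exI[of _ \<beta>], intro conjI)
    show "r \<le> n" by fact
    show "k + 1 \<le> 2 * r" using kb(1) kr by simp
    show "\<forall>j<r. n_inner n (J j)" using fam_n_inner[OF J] by blast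
    show "let \<phi> = (\<lambda>i z. \<Sum>j<r. (\<beta> (2 * j) i + \<beta> (2 * j + 1) i * z ^ n) * J j z)
      in (\<forall>f. f \<in> M \<longleftrightarrow>
            f \<in> borel_measurable circ \<and>
            (\<exists>(c::nat \<Rightarrow> complex) (g::nat \<Rightarrow> complex \<Rightarrow> complex).
               (\<forall>j<r. g j \<in> Malpha_zn \<alpha> n) \<and>
               (AE z in circ. f z = (\<Sum>i<k. c i * \<phi> i z)
                                   + z ^ (2 * n) * (\<Sum>j<r. J j z * g j z)))) \<and>
         (\<forall>(c::nat \<Rightarrow> complex) (g::nat \<Rightarrow> complex \<Rightarrow> complex).
            (\<forall>j<r. g j \<in> Malpha_zn \<alpha> n) \<and>
            (AE z in circ. (\<Sum>i<k. c i * \<phi> i z) + z ^ (2 * n) * (\<Sum>j<r. J j z * g j z) = 0)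
            \<longrightarrow> (\<forall>i<k. AE z in circ. c i * \<phi> i z = 0) \<and>
                (\<forall>j<r. AE z in circ. z ^ (2 * n) * J j z * g j z = 0))"
      unfolding \<phi> Let_def
    proof (intro conjI allI iffI impI; (elim conjE exE)?)
      show "f \<in> borel_measurable circ" if "f \<in> M" for f by (rule M_meas[OF that])
      show "\<exists>c g. (\<forall>j<r. g j \<in> Malpha_zn \<alpha> n) \<and>
        (AE z in circ. f z = (\<Sum>i<k. c i * \<Phi> (b i) z) + z ^ (2 * n) * (\<Sum>j<r. J j z * g j z))" if "f \<in> M" for f
        by (rule fwd[OF that])
      show "f \<in> M" if "f \<in> borel_measurable circ" "\<forall>j<r. g j \<in> Malpha_zn \<alpha> n"
        "AE z in circ. f z = (\<Sum>i<k. c i * \<Phi> (b i) z) + z ^ (2 * n) * (\<Sum>j<r. J j z * g j z)" for f c g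
        by (rule bwd[OF that])
    qed (use uniq in blast)+
  qed
qed

end
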